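(* Let $G_1$ and $G_2$ be finite simple, three-regular, three-connected planar graphs (with chosen planar embeddings), and let $\mathcal{T}_{G_1}$ and $\mathcal{T}_{G_2}$ be the extended tropicalisations of the schön embeddings $X_{G_1}^{\rm sch}$ and $X_{G_2}^{\rm sch}$, respectively. There exists a finite sequence consisting of tropical $\Delta Y$, tropical $Y\Delta$ and tropical contraction-elongation transformations (with respect to the marked points $\{m_\xi\}_\xi$) that transforms $\mathcal{T}_{G_1}$ to $\mathcal{T}_{G_2}$.
   Context: $\kappa$ is an algebraically closed, valued field. For three-regular graphs, three-edge-connected and three-vertex-connected are equivalent; "three-connected" means either. **Planar embeddings.** A planar embedding of a simple graph $G$ is a continuous injective map $\tau:G^{\rm top}\to\mathbb{R}^2$ ($G^{\rm top}$ the underlying topological space of $G$) taking each edge to an open interval and such that $\mathbb{R}^2\setminus{\rm Im}(\tau)$ has finitely many connected components, exactly one unbounded; the closure of each bounded component is a convex polygon, and the unbounded component is the complement of a convex polygon. Closures of bounded components are the interior faces; the closure of the unbounded one is the exterior face. There are $g$ interior faces, where $g$ is the genus (first Betti number) of $G$. A vertex is exterior if it is incident on the exterior face, and interior otherwise. **Schön embedding.** Let $R=\kappa[x_F\mid F \text{ an interior face}]$ and $\mathbb{P}^{g-1}={\rm Proj}(R)$. For an interior vertex $v$, incident on interior faces $F_i,F_j,F_k$, let $L_v=\langle x_{F_i}+x_{F_j}+x_{F_k},\ x_F\mid F\text{ not incident on }v\rangle$. For an exterior vertex $v$ let $L_v=\langle x_F\mid F \text{ interior face not incident on } v\rangle$.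 Each $L_v$ defines a line. The schön embedding $X_G^{\rm sch}$ is the curve $\bigcup_v V(L_v)$ in $\mathbb{P}^{g-1}$. **Tropicalisation.** $\mathbb{TP}^{n}$ is the quotient of $(\mathbb{R}\cup\{\infty\})^{n+1}\setminus\{(\infty,\dots,\infty)\}$ by adding real multiples of $(1,\dots,1)$; it is identified with an $n$-simplex, whose facets are the loci where one coordinate is $\infty$. For a homogeneous ideal $I$, ${\rm tropproj}(I)\subset\mathbb{TP}^n$ is the union over torus orbits of $\mathbb{P}^n$ of the tropicalisation of $I$ restricted to that orbit: on the orbit where exactly the coordinates in $\mathcal V$ vanish, set these variables to $0$ in all elements of $I$, take the ideal $\tilde I$ they generate in the Laurent polynomial ring in the remaining variables, and take all real $w$ such that for each nonzero $f=\sum c_ax^a\in\tilde I$ the minimum of ${\rm val}(c_a)+w\cdot a$ is attained at least twice; the resulting points lie in the stratum where exactly the coordinates in $\mathcal V$ are $\infty$. $\mathcal{T}_G=\bigcup_v{\rm tropproj}(L_v)\subset\mathbb{TP}^{g-1}$, regarded as an arrangement (finite collection) of tropical lines. The facets of $\mathbb{TP}^{g-1}$ are labelled by the interior faces of $G$; arrangements are considered up to relabelling of the facets. **Marked points and standard lines.** For an edge $\xi$ of the simplex $\mathbb{TP}^{n}$ (only two coordinates $s,t$ can be finite), the marked point $m_\xi$ is the point of its relative interior whose $s$ and $t$ coordinates are equal and finite and whose other coordinates are $\infty$. For a two-dimensional face $D$, the standard tropical line $\mathcal{TL}_D$ is the unique branched tropical line in $D$ through the marked points of the three edges of $D$: it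 consists of the three rays from the origin of the interior of $D$ (the point with three equal finite coordinates) to these marked points. Equivalently it is ${\rm tropproj}\langle x_i+x_j+x_k,\ x_l\mid l\notin\{i,j,k\}\rangle$ where $i,j,k$ are the coordinates finite on the interior of $D$. **Tropical operations** on an arrangement $\mathcal T$ of tropical lines in $\mathbb{TP}^{g-1}$. Identify $\mathbb{TP}^{g-1}$ with a facet of $\mathbb{TP}^g$ and let $\nu$ be the vertex of $\mathbb{TP}^g$ not in $\mathbb{TP}^{g-1}$. (1) Tropical $Y\Delta$ transformation at a two-dimensional face $D$ of $\mathbb{TP}^{g-1}$ with $\mathcal{TL}_D$ contained in $\mathcal T$: the arrangement $(\mathcal T\setminus\mathcal{TL}_D)\cup\mathcal{TL}_{D^{(1)}}\cup\mathcal{TL}_{D^{(2)}}\cup\mathcal{TL}_{D^{(3)}}$ in $\mathbb{TP}^g$, where $D^{(1)},D^{(2)},D^{(3)}$ are the two-dimensional faces other than $D$ of the three-dimensional face of $\mathbb{TP}^g$ containing $D$ and $\nu$. (2) Tropical $Y\Delta$ transformation at an edge $\xi$ of $\mathbb{TP}^{g-1}$ contained in $\mathcal T$: the arrangement $(\mathcal T\setminus\xi)\cup\mathcal{TL}_{D_\xi}\cup\xi^{(1)}\cup\xi^{(2)}$ in $\mathbb{TP}^g$, where $D_\xi$ is the two-dimensional face of $\mathbb{TP}^g$ containing $\xi$ and $\nu$, and $\xi^{(1)},\xi^{(2)}$ are its edges other than $\xi$. (3) $\mathcal T_1$ is a tropical $\Delta Y$ transform of $\mathcal T_2$ if $\mathcal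 T_2$ is a tropical $Y\Delta$ transform of $\mathcal T_1$ (of type (1) or (2)). (4) Tropical contraction-elongation transformation at a pair $(D_1,D_2)$ of two-dimensional faces of $\mathbb{TP}^{g-1}$ sharing a common edge, with $\mathcal{TL}_{D_1},\mathcal{TL}_{D_2}$ contained in $\mathcal T$: the arrangement $(\mathcal T\setminus(\mathcal{TL}_{D_1}\cup\mathcal{TL}_{D_2}))\cup\mathcal{TL}_{\bar D_1}\cup\mathcal{TL}_{\bar D_2}$, where $\bar D_1,\bar D_2$ are the other two two-dimensional faces of the three-dimensional face of $\mathbb{TP}^{g-1}$ containing $D_1$ and $D_2$. In these formulas "$\setminus$" means removing the indicated tropical lines from the collection. *)

theory Defs
  imports
    "HOL-Analysis.Analysis"
    "HOL-Computational_Algebra.Polynomial"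
    "HOL-Library.Poly_Mapping"
    "HOL-Library.Extended_Real"
    "HOL-Algebra.Ideal"
begin

section \<open>Graphs\<close>

type_synonym 'v graph = "'v set \<times> 'v set set"

abbreviation verts :: "'v graph \<Rightarrow> 'v set" where "verts G \<equiv> fst G"
abbreviation edges :: "'v graph \<Rightarrow> 'v set set" where "edges G \<equiv> snd G"

definition finite_simple_graph :: "'v graph \<Rightarrow> bool" where
  "finite_simple_graph G \<longleftrightarrow> finite (verts G) \<and> (\<forall>e\<in>edges G. e \<subseteq> verts G \<and> card e = 2)"

definition three_regular :: "'v graph \<Rightarrow> bool" where
  "three_regular G \<longleftrightarrow> (\<forall>v\<in>verts G. card {e \<in> edges G. v \<in> e} = 3)"

definition graph_connected :: "'v graph \<Rightarrow> bool" where
  "graph_connected G \<longleftrightarrow> verts G \<noteq> {} \<and>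
     (\<forall>u\<in>verts G. \<forall>v\<in>verts G. (u, v) \<in> {(x, y). {x, y} \<in> edges G}\<^sup>*)"

definition delete_verts :: "'v graph \<Rightarrow> 'v set \<Rightarrow> 'v graph" where
  "delete_verts G X = (verts G - X, {e \<in> edges G. e \<inter> X = {}})"

definition three_connected :: "'v graph \<Rightarrow> bool" where
  "three_connected G \<longleftrightarrow> card (verts G) > 3 \<and>
     (\<forall>X. X \<subseteq> verts G \<and> card X < 3 \<longrightarrow> graph_connected (delete_verts G X))"


section \<open>Planar embeddings\<close>

text \<open>The topological space of a graph is its geometric realisation: a point is given by its
  barycentric coordinates, whose support is either a vertex or an edge. The topology is the
  subspace topology of the product topology on \<open>'v \<Rightarrow> real\<close>.\<close>

definition vertex_point :: "'v \<Rightarrow> 'v \<Rightarrow> real" where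
  "vertex_point v = (\<lambda>u. if u = v then 1 else 0)"

definition open_edge :: "'v set \<Rightarrow> ('v \<Rightarrow> real) set" where
  "open_edge e = {x. (\<forall>u\<in>e. x u > 0) \<and> (\<forall>u. u \<notin> e \<longrightarrow> x u = 0) \<and> (\<Sum>u\<in>e. x u) = 1}"

definition graph_top :: "'v graph \<Rightarrow> ('v \<Rightarrow> real) set" where
  "graph_top G = vertex_point ` verts G \<union> (\<Union>e\<in>edges G. open_edge e)"

definition convex_polygon :: "(real^2) set \<Rightarrow> bool" where
  "convex_polygon P \<longleftrightarrow> polytope P \<and> aff_dim P = 2"

definition embedding_components :: "'v graph \<Rightarrow> (('v \<Rightarrow> real) \<Rightarrow> real^2) \<Rightarrow> (real^2) set set" where
  "embedding_components G \<tau> = components (- (\<tau> ` graph_top G))"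

text \<open>An open interval in the plane is an open, nondegenerate, straight line segment; for an
  arbitrary homeomorphic copy of an interval the condition on edges would be void.\<close>

definition planar_embedding :: "'v graph \<Rightarrow> (('v \<Rightarrow> real) \<Rightarrow> real^2) \<Rightarrow> bool" where
  "planar_embedding G \<tau> \<longleftrightarrow>
     continuous_on (graph_top G) \<tau> \<and> inj_on \<tau> (graph_top G) \<and>
     (\<forall>e\<in>edges G. \<exists>a b. a \<noteq> b \<and> \<tau> ` open_edge e = open_segment a b) \<and>
     finite (embedding_components G \<tau>) \<and>
     (\<exists>!C. C \<in> embedding_components G \<tau> \<and> \<not> bounded C) \<and>
     (\<forall>C\<in>embedding_components G \<tau>. bounded C \<longrightarrow> convex_polygon (closure C)) \<and>
     (\<forall>C\<in>embedding_components G \<tau>. \<not> bounded C \<longrightarrow> (\<exists>P. convex_polygon P \<and> C = - P))"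

definition interior_faces :: "'v graph \<Rightarrow> (('v \<Rightarrow> real) \<Rightarrow> real^2) \<Rightarrow> (real^2) set set" where
  "interior_faces G \<tau> = closure ` {C \<in> embedding_components G \<tau>. bounded C}"

definition exterior_face :: "'v graph \<Rightarrow> (('v \<Rightarrow> real) \<Rightarrow> real^2) \<Rightarrow> (real^2) set" where
  "exterior_face G \<tau> = closure (THE C. C \<in> embedding_components G \<tau> \<and> \<not> bounded C)"

definition incident :: "(('v \<Rightarrow> real) \<Rightarrow> real^2) \<Rightarrow> 'v \<Rightarrow> (real^2) set \<Rightarrow> bool" where
  "incident \<tau> v F \<longleftrightarrow> \<tau> (vertex_point v) \<in> F"

definition exterior_vertex :: "'v graph \<Rightarrow> (('v \<Rightarrow> real) \<Rightarrow> real^2) \<Rightarrow> 'v \<Rightarrow> bool" where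
  "exterior_vertex G \<tau> v \<longleftrightarrow> incident \<tau> v (exterior_face G \<tau>)"


section \<open>Polynomials, Laurent polynomials and the ideals of the schoen embedding\<close>

text \<open>Exponent vectors with entries in \<open>nat\<close> give polynomials, with entries in \<open>int\<close> Laurent
  polynomials. \<open>var_ring J\<close> is the subring of those only involving the variables in \<open>J\<close>.\<close>

type_synonym ('i, 'k) mpoly = "('i \<Rightarrow>\<^sub>0 nat) \<Rightarrow>\<^sub>0 'k"
type_synonym ('i, 'k) laurent_mpoly = "('i \<Rightarrow>\<^sub>0 int) \<Rightarrow>\<^sub>0 'k"

definition var_ring :: "'i set \<Rightarrow> (('i \<Rightarrow>\<^sub>0 'e::comm_monoid_add) \<Rightarrow>\<^sub>0 'k::comm_ring_1) ring" where
  "var_ring J = \<lparr>carrier = {p. \<forall>a\<in>Poly_Mapping.keys p. Poly_Mapping.keys a \<subseteq> J},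
     monoid.mult = (*), one = 1, zero = 0, add = (+)\<rparr>"

lemma cring_var_ring:
  "cring (var_ring J :: (('i \<Rightarrow>\<^sub>0 'e::comm_monoid_add) \<Rightarrow>\<^sub>0 'k::comm_ring_1) ring)"
proof -
  define C :: "(('i \<Rightarrow>\<^sub>0 'e) \<Rightarrow>\<^sub>0 'k) set"
    where "C = {p. \<forall>a\<in>Poly_Mapping.keys p. Poly_Mapping.keys a \<subseteq> J}"
  have R: "var_ring J = \<lparr>carrier = C, monoid.mult = (*), one = 1, zero = 0, add = (+)\<rparr>"
    unfolding var_ring_def C_def ..
  have plus: "p + q \<in> C" if "p \<in> C" "q \<in> C" for p q
    using that Poly_Mapping.keys_add[of p q] unfolding C_def by blast
  have times: "p * q \<in> C" if "p \<in> C" "q \<in> C" for p q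
    unfolding C_def mem_Collect_eq
  proof
    fix c assume "c \<in> Poly_Mapping.keys (p * q)"
    then obtain a b where "a \<in> Poly_Mapping.keys p" "b \<in> Poly_Mapping.keys q" "c = a + b"
      using keys_mult[of p q] by blast
    then show "Poly_Mapping.keys c \<subseteq> J"
      using that Poly_Mapping.keys_add[of a b] unfolding C_def by blast
  qed
  have closed: "0 \<in> C" "1 \<in> C" "- p \<in> C \<longleftrightarrow> p \<in> C" for p
    by (simp_all add: C_def)
  show ?thesis
  proof (rule cringI)
    show "abelian_group (var_ring J :: (('i \<Rightarrow>\<^sub>0 'e) \<Rightarrow>\<^sub>0 'k) ring)"
      unfolding R
    proof (rule abelian_groupI, goal_cases)
      case (6 x)
      then show ?case by (intro bexI[of _ "- x"]) (simp_all add: closed)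
    qed (simp_all add: plus closed add.assoc add.commute)
    show "comm_monoid (var_ring J :: (('i \<Rightarrow>\<^sub>0 'e) \<Rightarrow>\<^sub>0 'k) ring)"
      unfolding R by (rule comm_monoidI) (simp_all add: times closed mult.assoc mult.commute)
  qed (simp add: R distrib_right)
qed

definition poly_ring :: "'i set \<Rightarrow> ('i, 'k::comm_ring_1) mpoly ring" where
  "poly_ring J = var_ring J"

definition laurent_ring :: "'i set \<Rightarrow> ('i, 'k::comm_ring_1) laurent_mpoly ring" where
  "laurent_ring J = var_ring J"

definition linear_form :: "'i set \<Rightarrow> ('i \<Rightarrow> 'k::comm_ring_1) \<Rightarrow> ('i, 'k) mpoly" where
  "linear_form J c = (\<Sum>i\<in>J. Poly_Mapping.single (Poly_Mapping.single i 1) (c i))"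

definition pvar :: "'i \<Rightarrow> ('i, 'k::comm_ring_1) mpoly" where
  "pvar i = Poly_Mapping.single (Poly_Mapping.single i 1) 1"

text \<open>An interior vertex of a three-regular, three-connected graph lies on exactly three interior
  faces, so that the first generator is a sum of three variables.\<close>

definition schoen_ideal ::
    "'v graph \<Rightarrow> (('v \<Rightarrow> real) \<Rightarrow> real^2) \<Rightarrow> 'v \<Rightarrow> ((real^2) set, 'k::comm_ring_1) mpoly set" where
  "schoen_ideal G \<tau> v =
     (let Fs = interior_faces G \<tau>;
          others = pvar ` {F \<in> Fs. \<not> incident \<tau> v F}
      in if exterior_vertex G \<tau> v
         then Idl\<^bsub>poly_ring Fs\<^esub> others
         else Idl\<^bsub>poly_ring Fs\<^esub> (insert (\<Sum>F\<in>{F \<in> Fs. incident \<tau> v F}. pvar F) others))"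


section \<open>Extended tropicalisation\<close>

definition field_valuation :: "('k::field \<Rightarrow> ereal) \<Rightarrow> bool" where
  "field_valuation val \<longleftrightarrow>
     (\<forall>x. val x \<noteq> -\<infinity>) \<and> (\<forall>x. val x = \<infinity> \<longleftrightarrow> x = 0) \<and>
     (\<forall>x y. val (x * y) = val x + val y) \<and>
     (\<forall>x y. val (x + y) \<ge> min (val x) (val y))"

text \<open>A point of the tropical projective space with coordinates labelled by \<open>I\<close> is represented by
  all its coordinate vectors, which are extended by \<open>\<infinity>\<close> to all labels outside \<open>I\<close>. In this way
  the face of \<open>TP I\<close> on which only the coordinates in \<open>J \<subseteq> I\<close> can be finite is literally \<open>TP J\<close>,
  and \<open>TP I\<close> is literally a facet of \<open>TP (insert \<nu> I)\<close> for \<open>\<nu> \<notin> I\<close>.\<close>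

type_synonym 'i tpoint = "('i \<Rightarrow> ereal) set"

definition tp_class :: "('i \<Rightarrow> ereal) \<Rightarrow> 'i tpoint" where
  "tp_class w = {w'. \<exists>c::real. w' = (\<lambda>i. w i + ereal c)}"

definition TP :: "'i set \<Rightarrow> 'i tpoint set" where
  "TP I = tp_class ` {w. (\<forall>i. w i \<noteq> -\<infinity>) \<and> (\<forall>i. i \<notin> I \<longrightarrow> w i = \<infinity>) \<and> (\<exists>i\<in>I. w i \<noteq> \<infinity>)}"

definition exponent_to_int :: "('i \<Rightarrow>\<^sub>0 nat) \<Rightarrow> ('i \<Rightarrow>\<^sub>0 int)" where
  "exponent_to_int a = Poly_Mapping.map int a"

text \<open>Set all variables outside \<open>J\<close> to zero and regard the result as a Laurent polynomial.\<close>

definition restrict_to_orbit :: "'i set \<Rightarrow> ('i, 'k::comm_ring_1) mpoly \<Rightarrow> ('i, 'k) laurent_mpoly" where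
  "restrict_to_orbit J f =
     (\<Sum>a\<in>{a \<in> Poly_Mapping.keys f. Poly_Mapping.keys a \<subseteq> J}.
        Poly_Mapping.single (exponent_to_int a) (Poly_Mapping.lookup f a))"

definition term_weight ::
    "('k::field \<Rightarrow> ereal) \<Rightarrow> 'i set \<Rightarrow> ('i \<Rightarrow> real) \<Rightarrow> ('i, 'k) laurent_mpoly \<Rightarrow> ('i \<Rightarrow>\<^sub>0 int) \<Rightarrow> ereal" where
  "term_weight val J w f a =
     val (Poly_Mapping.lookup f a) + ereal (\<Sum>i\<in>J. w i * of_int (Poly_Mapping.lookup a i))"

definition min_attained_twice ::
    "('k::field \<Rightarrow> ereal) \<Rightarrow> 'i set \<Rightarrow> ('i \<Rightarrow> real) \<Rightarrow> ('i, 'k) laurent_mpoly \<Rightarrow> bool" where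
  "min_attained_twice val J w f \<longleftrightarrow>
     (\<exists>a\<in>Poly_Mapping.keys f. \<exists>b\<in>Poly_Mapping.keys f. a \<noteq> b \<and>
        term_weight val J w f a = term_weight val J w f b \<and>
        (\<forall>c\<in>Poly_Mapping.keys f. term_weight val J w f a \<le> term_weight val J w f c))"

definition tropproj ::
    "('k::field \<Rightarrow> ereal) \<Rightarrow> 'i set \<Rightarrow> ('i, 'k) mpoly set \<Rightarrow> 'i tpoint set" where
  "tropproj val I L =
     (\<Union>J\<in>{J. J \<subseteq> I \<and> J \<noteq> {}}.
        {tp_class (\<lambda>i. if i \<in> J then ereal (w i) else \<infinity>) | w.
           \<forall>f \<in> Idl\<^bsub>laurent_ring J\<^esub> (restrict_to_orbit J ` L).
              f \<noteq> 0 \<longrightarrow> min_attained_twice val J w f})"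


section \<open>Arrangements of tropical lines\<close>

text \<open>A tropical line is the extended tropicalisation of the line through two distinct points
  \<open>[a]\<close> and \<open>[b]\<close> of projective space, i.e. of the ideal generated by the linear forms vanishing at
  \<open>a\<close> and \<open>b\<close>.\<close>

definition tropical_line :: "('k::field \<Rightarrow> ereal) \<Rightarrow> 'i set \<Rightarrow> 'i tpoint set \<Rightarrow> bool" where
  "tropical_line val I \<Lambda> \<longleftrightarrow>
     (\<exists>a b :: 'i \<Rightarrow> 'k.
        (\<forall>s t. (\<forall>i\<in>I. s * a i + t * b i = 0) \<longrightarrow> s = 0 \<and> t = 0) \<and>
        \<Lambda> = tropproj val I (Idl\<^bsub>poly_ring I\<^esub>
               {linear_form I c | c. (\<Sum>i\<in>I. c i * a i) = 0 \<and> (\<Sum>i\<in>I. c i * b i) = 0}))"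

text \<open>An arrangement comes with the set labelling the facets of its ambient space.\<close>

type_synonym 'i arr = "'i set \<times> 'i tpoint set set"

definition arrangement :: "('k::field \<Rightarrow> ereal) \<Rightarrow> 'i arr \<Rightarrow> bool" where
  "arrangement val = (\<lambda>(I, \<T>). finite I \<and> finite \<T> \<and> (\<forall>\<Lambda>\<in>\<T>. tropical_line val I \<Lambda>))"

definition schoen_tropicalisation ::
    "('k::field \<Rightarrow> ereal) \<Rightarrow> 'v graph \<Rightarrow> (('v \<Rightarrow> real) \<Rightarrow> real^2) \<Rightarrow> (real^2) set arr" where
  "schoen_tropicalisation val G \<tau> =
     (interior_faces G \<tau>,
      (\<lambda>v. tropproj val (interior_faces G \<tau>) (schoen_ideal G \<tau> v)) ` verts G)"

text \<open>The face \<open>TP J\<close> of a tropical projective space is identified by the set \<open>J\<close> of coordinates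
  finite on its interior. For \<open>J\<close> of size two, \<open>marked_point J\<close> is the marked point of an edge.
  The ray below runs from the origin of the interior of \<open>TP D\<close> (at \<open>c = 0\<close>) to the marked point of
  the edge \<open>TP \<xi>\<close> (at \<open>c = \<infinity>\<close>).\<close>

definition marked_point :: "'i set \<Rightarrow> 'i tpoint" where
  "marked_point \<xi> = tp_class (\<lambda>i. if i \<in> \<xi> then 0 else \<infinity>)"

definition ray_to_marked_point :: "'i set \<Rightarrow> 'i set \<Rightarrow> 'i tpoint set" where
  "ray_to_marked_point D \<xi> =
     {tp_class (\<lambda>i. if i \<in> \<xi> then 0 else if i \<in> D then c else \<infinity>) | c. 0 \<le> c}"

lemma marked_point_in_ray: "marked_point \<xi> \<in> ray_to_marked_point D \<xi>"
proof -
  have "marked_point \<xi> = tp_class (\<lambda>i. if i \<in> \<xi> then 0 else if i \<in> D then \<infinity> else \<infinity>)"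
    unfolding marked_point_def by (rule arg_cong[where f = tp_class]) auto
  then show ?thesis
    unfolding ray_to_marked_point_def by (intro CollectI exI[of _ \<infinity>]) simp
qed

definition standard_line :: "'i set \<Rightarrow> 'i tpoint set" where
  "standard_line D = (\<Union>\<xi>\<in>{\<xi>. \<xi> \<subseteq> D \<and> card \<xi> = 2}. ray_to_marked_point D \<xi>)"


section \<open>Tropical operations\<close>

inductive tropical_Y_Delta :: "('k::field \<Rightarrow> ereal) \<Rightarrow> 'i arr \<Rightarrow> 'i arr \<Rightarrow> bool"
  for val :: "'k::field \<Rightarrow> ereal" where
  at_face:
    "\<lbrakk>arrangement val (I, \<T>); D \<subseteq> I; card D = 3; standard_line D \<in> \<T>; \<nu> \<notin> I\<rbrakk> \<Longrightarrow>
     tropical_Y_Delta val (I, \<T>)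
       (insert \<nu> I,
        (\<T> - {standard_line D}) \<union>
        standard_line ` {D'. D' \<subseteq> insert \<nu> D \<and> card D' = 3 \<and> D' \<noteq> D})"
| at_edge:
    "\<lbrakk>arrangement val (I, \<T>); \<xi> \<subseteq> I; card \<xi> = 2; TP \<xi> \<in> \<T>; \<nu> \<notin> I\<rbrakk> \<Longrightarrow>
     tropical_Y_Delta val (I, \<T>)
       (insert \<nu> I,
        (\<T> - {TP \<xi>}) \<union> {standard_line (insert \<nu> \<xi>)} \<union>
        TP ` {\<xi>'. \<xi>' \<subseteq> insert \<nu> \<xi> \<and> card \<xi>' = 2 \<and> \<xi>' \<noteq> \<xi>})"

definition tropical_Delta_Y :: "('k::field \<Rightarrow> ereal) \<Rightarrow> 'i arr \<Rightarrow> 'i arr \<Rightarrow> bool" where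
  "tropical_Delta_Y val A B \<longleftrightarrow> tropical_Y_Delta val B A"

inductive tropical_contraction_elongation ::
    "('k::field \<Rightarrow> ereal) \<Rightarrow> 'i arr \<Rightarrow> 'i arr \<Rightarrow> bool"
  for val :: "'k::field \<Rightarrow> ereal" where
  "\<lbrakk>arrangement val (I, \<T>); D\<^sub>1 \<subseteq> I; D\<^sub>2 \<subseteq> I; card D\<^sub>1 = 3; card D\<^sub>2 = 3; card (D\<^sub>1 \<inter> D\<^sub>2) = 2;
    standard_line D\<^sub>1 \<in> \<T>; standard_line D\<^sub>2 \<in> \<T>\<rbrakk> \<Longrightarrow>
   tropical_contraction_elongation val (I, \<T>)
     (I,
      (\<T> - {standard_line D\<^sub>1, standard_line D\<^sub>2}) \<union>
      standard_line ` {D. D \<subseteq> D\<^sub>1 \<union> D\<^sub>2 \<and> card D = 3 \<and> D \<noteq> D\<^sub>1 \<and> D \<noteq> D\<^sub>2})"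

definition tropical_transformation :: "('k::field \<Rightarrow> ereal) \<Rightarrow> 'i arr \<Rightarrow> 'i arr \<Rightarrow> bool" where
  "tropical_transformation val A B \<longleftrightarrow>
     tropical_Delta_Y val A B \<or> tropical_Y_Delta val A B \<or> tropical_contraction_elongation val A B"

text \<open>A relabelling is given by a bijection of the whole type of labels; every bijection between
  two finite sets of labels extends to such a bijection.\<close>

definition relabelling :: "'i arr \<Rightarrow> 'i arr \<Rightarrow> bool" where
  "relabelling A B \<longleftrightarrow>
     (\<exists>\<sigma>. bij \<sigma> \<and> fst B = \<sigma> ` fst A \<and>
        snd B = (\<lambda>\<Lambda>. (\<lambda>p. (\<lambda>w. w \<circ> inv_into UNIV \<sigma>) ` p) ` \<Lambda>) ` snd A)"

definition tropically_transformable :: "('k::field \<Rightarrow> ereal) \<Rightarrow> 'i arr \<Rightarrow> 'i arr \<Rightarrow> bool" where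
  "tropically_transformable val =
     (\<lambda>A B. tropical_transformation val A B \<or> relabelling A B)\<^sup>*\<^sup>*"

end

theory Submission
  imports Defs "HOL-Algebra.QuotRing"
begin

text \<open>The faces at a vertex, the exterior face included, are the corners of a triangle, and these
  triangles form the dual of the drawing: a triangulated sphere with a distinguished corner for the
  exterior face. The arrangement of tropical lines is read off this sphere, and as long as no
  triangle is produced twice, contraction-elongation is the flip of an edge of the sphere, while a
  \<open>Y\<Delta>\<close> transformation inserts a corner of degree three. Flips lower the degree of a corner until it
  can be removed; one of any two consecutive edges at a corner of degree at least four can be
  flipped, since otherwise two chords would cross. Hence every sphere reduces to the tetrahedron, and
  all these steps can be reversed.

  Of planarity this needs that the dual is a surface whose first homology modulo 2 vanishes, that
  is, that an edge set of the graph meeting every face evenly is a cut. By the Jordan curve theorem,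
  such a set meets every cycle evenly, because modulo 2 a cycle is the sum of the boundaries of the
  faces inside it. Three-connectedness excludes two edges between the same two faces, as these
  would form a cut.\<close>

section \<open>Triangulated spheres\<close>

text \<open>An arrangement is a set of lines, so a triangle produced twice would silently merge with
  the one already there. Every move is guarded against this, and planarity enters in the proof that
  some guarded move is always available. Being a sphere is phrased through potentials on triangles
  because this condition survives a local exchange of triangles by a short gluing argument. The
  distinguished corner is the second obstacle: triangles containing it stand for edges of the
  simplex, whereas contraction-elongation acts on standard lines, so no flip may involve this
  corner. The corner to be removed is therefore taken not adjacent to the distinguished one whenever
  possible. Otherwise every corner is adjacent to it, and these adjacencies themselves exclude the
  chord that could block a flip. Going backwards reinserts labels that were removed before, so they
  are new at that moment, and two tetrahedra differ by a relabelling that respects the distinguished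
  corners.\<close>

definition skeleton :: "'i set set \<Rightarrow> 'i set set" where
  "skeleton K = {e. card e = 2 \<and> (\<exists>t\<in>K. e \<subseteq> t)}"

definition even_chain :: "'i set set \<Rightarrow> bool" where
  "even_chain z \<longleftrightarrow> (\<forall>v. even (card {e \<in> z. v \<in> e}))"

text \<open>Modulo 2, the edge set \<open>z\<close> is the boundary of the set of triangles on which the potential
  \<open>p\<close> holds.\<close>

definition potential :: "'i set set \<Rightarrow> 'i set set \<Rightarrow> ('i set \<Rightarrow> bool) \<Rightarrow> bool" where
  "potential K z p \<longleftrightarrow>
     (\<forall>t\<in>K. \<forall>t'\<in>K. card (t \<inter> t') = 2 \<longrightarrow> ((p t \<noteq> p t') \<longleftrightarrow> t \<inter> t' \<in> z))"

text \<open>A closed, strongly connected surface whose first homology with coefficients in \<open>\<int>/2\<close>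
  vanishes. Being a sphere is only used in this homological form.\<close>

definition trisphere :: "'i set set \<Rightarrow> bool" where
  "trisphere K \<longleftrightarrow> finite K \<and> K \<noteq> {} \<and> (\<forall>t\<in>K. card t = 3) \<and>
     (\<forall>e. card e = 2 \<longrightarrow> card {t \<in> K. e \<subseteq> t} = 0 \<or> card {t \<in> K. e \<subseteq> t} = 2) \<and>
     (\<forall>p. potential K {} p \<longrightarrow> (\<forall>t\<in>K. \<forall>t'\<in>K. p t = p t')) \<and>
     (\<forall>z\<subseteq>skeleton K. even_chain z \<longrightarrow> (\<exists>p. potential K z p))"

lemma trisphereD:
  assumes "trisphere K"
  shows "finite K" "K \<noteq> {}" "t \<in> K \<Longrightarrow> card t = 3" "t \<in> K \<Longrightarrow> finite t" "finite (\<Union>K)"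
    "card e = 2 \<Longrightarrow> card {t \<in> K. e \<subseteq> t} = 0 \<or> card {t \<in> K. e \<subseteq> t} = 2"
    "potential K {} p \<Longrightarrow> t \<in> K \<Longrightarrow> t' \<in> K \<Longrightarrow> p t = p t'"
    "z \<subseteq> skeleton K \<Longrightarrow> even_chain z \<Longrightarrow> \<exists>p. potential K z p"
proof -
  have c3: "\<forall>t\<in>K. card t = 3" using assms by (simp add: trisphere_def)
  then show fin: "finite t" if "t \<in> K" for t
    using that by (metis card.infinite zero_neq_numeral)
  have "finite K" using assms by (simp add: trisphere_def)
  then show "finite (\<Union>K)" using fin by (rule finite_Union)
qed (use assms in \<open>auto simp: trisphere_def\<close>)

lemma potentialD:
  assumes "potential K z p" "t \<in> K" "t' \<in> K" "t \<inter> t' = e" "card e = 2"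
  shows "(p t \<noteq> p t') \<longleftrightarrow> e \<in> z"
  using assms unfolding potential_def by auto

lemma card3_inter_eq:
  assumes "card t = 3" "card u = 3" "t \<noteq> u" "card e = 2" "e \<subseteq> t" "e \<subseteq> u"
  shows "t \<inter> u = e"
proof -
  have ft: "finite t" and fu: "finite u" using assms card.infinite by fastforce+
  have "card (t \<inter> u) \<le> 2"
  proof (rule ccontr)
    assume "\<not> card (t \<inter> u) \<le> 2"
    then have "card (t \<inter> u) \<ge> 3" by simp
    then have "t \<inter> u = t" "t \<inter> u = u"
      using card_seteq[of t "t \<inter> u"] card_seteq[of u "t \<inter> u"] assms ft fu by auto
    with assms show False by auto
  qed
  then show ?thesis
    using card_seteq[of "t \<inter> u" e] assms ft by auto
qed

section \<open>Edge sets modulo 2\<close>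

lemma even_card_sym_diff:
  assumes "finite A" "finite B"
  shows "even (card ((A - B) \<union> (B - A))) \<longleftrightarrow> (even (card A) \<longleftrightarrow> even (card B))"
proof -
  have "card ((A - B) \<union> (B - A)) = card (A - B) + card (B - A)"
    using assms by (intro card_Un_disjoint) auto
  moreover have "card A = card (A - B) + card (A \<inter> B)"
    using assms by (subst card_Un_disjoint[symmetric]) (auto intro: arg_cong[where f=card])
  moreover have "card B = card (B - A) + card (A \<inter> B)"
    using assms by (subst card_Un_disjoint[symmetric]) (auto intro: arg_cong[where f=card])
  ultimately show ?thesis by presburger
qed

lemma even_card_sym_diff_at:
  assumes "finite z" "finite y"
  shows "even (card {e \<in> (z - y) \<union> (y - z). v \<in> e}) \<longleftrightarrow>
     (even (card {e \<in> z. v \<in> e}) \<longleftrightarrow> even (card {e \<in> y. v \<in> e}))"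
proof -
  have "{e \<in> (z - y) \<union> (y - z). v \<in> e} =
     ({e \<in> z. v \<in> e} - {e \<in> y. v \<in> e}) \<union> ({e \<in> y. v \<in> e} - {e \<in> z. v \<in> e})" by auto
  then show ?thesis using assms by (simp only:) (rule even_card_sym_diff, auto)
qed

lemma card_filter_pair:
  assumes "T1 \<noteq> T2"
  shows "card {t \<in> {T1,T2}. Q t} = (if Q T1 then 1 else 0) + (if Q T2 then 1 else 0)"
proof -
  have "{t \<in> {T1,T2}. Q t} = (if Q T1 then {T1} else {}) \<union> (if Q T2 then {T2} else {})" by auto
  then show ?thesis using assms by auto
qed

lemma even_chain_triangle:
  assumes "a \<noteq> b" "b \<noteq> c" "a \<noteq> c"
  shows "even_chain {{a,b},{b,c},{a,c}}"
  unfolding even_chain_def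
proof
  fix v
  have d: "{a,b} \<noteq> {b,c}" "{a,b} \<noteq> {a,c}" "{b,c} \<noteq> {a,c}" using assms by (auto simp: doubleton_eq_iff)
  consider "v = a" | "v = b" | "v = c" | "v \<notin> {a,b,c}" by auto
  then show "even (card {e \<in> {{a,b},{b,c},{a,c}}. v \<in> e})"
  proof cases
    case 1
    then have "{e \<in> {{a,b},{b,c},{a,c}}. v \<in> e} = {{a,b},{a,c}}" using assms by auto
    then show ?thesis using d by simp
  next
    case 2
    then have "{e \<in> {{a,b},{b,c},{a,c}}. v \<in> e} = {{a,b},{b,c}}" using assms by auto
    then show ?thesis using d by simp
  next
    case 3
    then have "{e \<in> {{a,b},{b,c},{a,c}}. v \<in> e} = {{b,c},{a,c}}" using assms by auto
    then show ?thesis using d by simp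
  next
    case 4
    then have "{e \<in> {{a,b},{b,c},{a,c}}. v \<in> e} = {}" by auto
    then show ?thesis by (simp only:) simp
  qed
qed

lemma even_chain_sym_diff:
  assumes "finite z" "finite y" "even_chain z" "even_chain y"
  shows "even_chain ((z - y) \<union> (y - z))"
  using assms even_card_sym_diff_at[OF assms(1,2)] unfolding even_chain_def by blast

lemma skeletonD:
  assumes "trisphere K" "e \<in> skeleton K"
  obtains x y u v where "e = {x,y}" "x \<noteq> y" "x \<noteq> u" "y \<noteq> u" "x \<noteq> v" "y \<noteq> v" "u \<noteq> v"
    "{x,y,u} \<in> K" "{x,y,v} \<in> K" "{t \<in> K. e \<subseteq> t} = {{x,y,u},{x,y,v}}"
proof -
  have e: "card e = 2" and "{t \<in> K. e \<subseteq> t} \<noteq> {}" using assms by (auto simp: skeleton_def)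
  then have "card {t \<in> K. e \<subseteq> t} = 2"
    using trisphereD(1)[OF assms(1)] trisphereD(6)[OF assms(1) e] by auto
  then obtain t t' where tt: "{t \<in> K. e \<subseteq> t} = {t,t'}" "t \<noteq> t'" by (meson card_2_iff)
  from e obtain x y where xy: "e = {x,y}" "x \<noteq> y" by (meson card_2_iff)
  have ex: "\<exists>u. s = {x,y,u} \<and> u \<noteq> x \<and> u \<noteq> y" if "s \<in> {t,t'}" for s
  proof -
    have s: "s \<in> K" "e \<subseteq> s" using that tt by auto
    then have "card (s - e) = 1" using trisphereD(3,4)[OF assms(1)] e
      by (simp add: card_Diff_subset finite_subset)
    then obtain u where "s - e = {u}" by (meson card_1_singletonE)
    then have "s = {x,y,u}" "u \<noteq> x" "u \<noteq> y" using s xy by auto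
    then show ?thesis by blast
  qed
  obtain u where u: "t = {x,y,u}" "u \<noteq> x" "u \<noteq> y" using ex[of t] by auto
  obtain v where v: "t' = {x,y,v}" "v \<noteq> x" "v \<noteq> y" using ex[of t'] by auto
  show ?thesis
    by (rule that[of x y u v]) (use xy u v tt in auto)
qed

lemma cofaces_eq:
  assumes K: "trisphere K" and "{x,y,u} \<in> K" "{x,y,v} \<in> K" "u \<noteq> v" "x \<noteq> y" "x \<noteq> u" "y \<noteq> u" "x \<noteq> v" "y \<noteq> v"
  shows "{t \<in> K. {x,y} \<subseteq> t} = {{x,y,u},{x,y,v}}"
proof -
  have sub: "{{x,y,u},{x,y,v}} \<subseteq> {t \<in> K. {x,y} \<subseteq> t}" using assms by auto
  have two: "card {{x,y,u},{x,y,v}} = 2" using assms by (auto simp: insert_eq_iff card_2_iff)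
  have "card {t \<in> K. {x,y} \<subseteq> t} = 0 \<or> card {t \<in> K. {x,y} \<subseteq> t} = 2"
    using trisphereD(6)[OF K, of "{x,y}"] assms by simp
  moreover have fin: "finite {t \<in> K. {x,y} \<subseteq> t}" using trisphereD(1)[OF K] by auto
  moreover have "{t \<in> K. {x,y} \<subseteq> t} \<noteq> {}" using sub by auto
  ultimately have "card {t \<in> K. {x,y} \<subseteq> t} = 2" by (simp only: card_0_eq) simp
  then show ?thesis using two by (intro card_seteq[OF fin sub, symmetric]) simp
qed

lemma other_coface:
  assumes K: "trisphere K" and "{x,y,u} \<in> K" "x \<noteq> y" "x \<noteq> u" "y \<noteq> u"
  obtains v where "{x,y,v} \<in> K" "v \<noteq> x" "v \<noteq> y" "v \<noteq> u"
proof -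
  have "{x,y} \<in> skeleton K" using assms unfolding skeleton_def by auto
  then obtain x' y' w w' where
    *: "{x,y} = {x',y'}" "x' \<noteq> y'" "x' \<noteq> w" "y' \<noteq> w" "x' \<noteq> w'" "y' \<noteq> w'" "w \<noteq> w'"
    "{x',y',w} \<in> K" "{x',y',w'} \<in> K" "{t \<in> K. {x,y} \<subseteq> t} = {{x',y',w},{x',y',w'}}"
    by (rule skeletonD[OF K])
  have "{x',y',w} = {x,y,w}" "{x',y',w'} = {x,y,w'}" 
  proof -
    have "{x',y',w} = insert w {x',y'}" "{x',y',w'} = insert w' {x',y'}" by auto
    then show "{x',y',w} = {x,y,w}" "{x',y',w'} = {x,y,w'}" unfolding *(1)[symmetric] by auto
  qed
  moreover have "w \<notin> {x,y}" "w' \<notin> {x,y}" using *(3-6) unfolding *(1) by auto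
  ultimately show ?thesis using that[of w] that[of w'] *(7,8,9) by (cases "w = u") auto
qed

text \<open>The patch \<open>P\<close> is replaced by \<open>P'\<close> while \<open>R\<close>
  stays. Across an edge between \<open>R\<close> and a new triangle \<open>t'\<close> the jump is
  the old one: by \<open>cov\<close> such an edge also lies in an old triangle \<open>u\<close>, and
  \<open>p u\<close> is the value that \<open>q\<close> takes on \<open>t'\<close>.\<close>

lemma potential_transfer:
  assumes "potential (R \<union> P) z p" "R \<inter> P' = {}" "potential P' z q"
    and "\<forall>t\<in>R \<union> P \<union> P'. card t = 3" "R \<inter> P = {}"
    and cov: "\<And>t' e. t' \<in> P' \<Longrightarrow> e \<subseteq> t' \<Longrightarrow> card e = 2 \<Longrightarrow>
      (\<exists>u\<in>P. e \<subseteq> u \<and> q t' = p u) \<or> (\<forall>t\<in>R. \<not> e \<subseteq> t)"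
  shows "potential (R \<union> P') z (\<lambda>t. if t \<in> P' then q t else p t)"
proof -
  have mixed: "(p t \<noteq> q t') \<longleftrightarrow> t \<inter> t' \<in> z" if h: "t \<in> R" "t' \<in> P'" "card (t \<inter> t') = 2" for t t'
  proof -
    obtain u where u: "u \<in> P" "t \<inter> t' \<subseteq> u" "q t' = p u"
      using cov[of t' "t \<inter> t'"] h by blast
    have "t \<inter> u = t \<inter> t'"
      by (rule card3_inter_eq) (use assms u h in auto)
    then show ?thesis using assms(1) h u unfolding potential_def by (metis UnCI)
  qed
  show ?thesis
    unfolding potential_def
  proof (intro ballI impI)
    fix t t' assume t: "t \<in> R \<union> P'" "t' \<in> R \<union> P'" and c: "card (t \<inter> t') = 2"
    consider "t \<in> P'" "t' \<in> P'" | "t \<in> P'" "t' \<in> R" | "t \<in> R" "t' \<in> P'" | "t \<in> R" "t' \<in> R"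
      using t by auto
    then show "((if t \<in> P' then q t else p t) \<noteq> (if t' \<in> P' then q t' else p t')) \<longleftrightarrow> t \<inter> t' \<in> z"
    proof cases
      case 1 then show ?thesis using assms(3) c unfolding potential_def by auto
    next
      case 2
      then have "t' \<notin> P'" using assms(2) by auto
      moreover have "(p t' \<noteq> q t) \<longleftrightarrow> t' \<inter> t \<in> z" using mixed 2 c by (simp add: Int_commute)
      ultimately show ?thesis using 2 by (auto simp: Int_commute)
    next
      case 3
      then have "t \<notin> P'" using assms(2) by auto
      then show ?thesis using mixed 3 c by auto
    next
      case 4
      then have "t \<notin> P'" "t' \<notin> P'" using assms(2) by auto
      then show ?thesis using assms(1) 4 c unfolding potential_def by auto
    qed
  qed
qed

text \<open>Changing the value on \<open>t\<close> adds the boundary of \<open>t\<close> modulo 2,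
  since each edge of \<open>t\<close> separates it from exactly one other triangle.\<close>

lemma potential_toggle:
  assumes pot: "potential K z p" and "t \<in> K" and c3: "\<forall>t\<in>K. card t = 3"
    and E: "\<And>e. card e = 2 \<Longrightarrow> card {t \<in> K. e \<subseteq> t} = 0 \<or> card {t \<in> K. e \<subseteq> t} = 2" and "finite K"
    and y: "y = {e. card e = 2 \<and> e \<subseteq> t}"
  shows "potential K ((z - y) \<union> (y - z)) (p(t := \<not> p t))"
  unfolding potential_def
proof (intro ballI impI)
  fix u u' assume u: "u \<in> K" "u' \<in> K" and c: "card (u \<inter> u') = 2"
  have "u \<noteq> u'" using c3 u c by auto
  \<comment> \<open>An edge of \<open>t\<close> shared by two further triangles would have three
    cofaces.\<close>
  have iff: "u \<inter> u' \<in> y \<longleftrightarrow> u = t \<or> u' = t"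
  proof
    assume "u \<inter> u' \<in> y"
    then have "{u,u',t} \<subseteq> {s \<in> K. u \<inter> u' \<subseteq> s}" using u assms by auto
    moreover have "card {s \<in> K. u \<inter> u' \<subseteq> s} \<le> 2" using E[OF c] by auto
    ultimately have "card {u,u',t} \<le> 2"
      using card_mono[of "{s \<in> K. u \<inter> u' \<subseteq> s}" "{u,u',t}"] \<open>finite K\<close> by simp
    then show "u = t \<or> u' = t" using \<open>u \<noteq> u'\<close> by (auto simp: card_insert_if split: if_splits)
  next
    assume "u = t \<or> u' = t"
    then show "u \<inter> u' \<in> y" using c y by auto
  qed
  have "(p u \<noteq> p u') \<longleftrightarrow> u \<inter> u' \<in> z" using pot u c unfolding potential_def by auto
  then show "((p(t := \<not> p t)) u \<noteq> (p(t := \<not> p t)) u') \<longleftrightarrow> u \<inter> u' \<in> z - y \<union> (y - z)"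
    using iff \<open>u \<noteq> u'\<close> by auto
qed

text \<open>The edges of a walk, added modulo 2, have boundary \<open>b\<close> plus
  \<open>c\<close>; the symmetric difference takes care of edges that the walk repeats. For
  \<open>b = c\<close> the boundary is empty.\<close>

lemma reachable_chain:
  assumes "(b, c) \<in> {(x, y). {x,y} \<in> E \<and> x \<noteq> y}\<^sup>*" "finite E"
  shows "\<exists>z\<subseteq>E. \<forall>v. odd (card {e \<in> z. v \<in> e}) \<longleftrightarrow> ((v = b) \<noteq> (v = c))"
  using assms(1)
proof (induction rule: rtrancl_induct)
  case base
  show ?case by (intro exI[of _ "{}"]) auto
next
  case (step x y)
  then obtain z where z: "z \<subseteq> E" "\<And>v. odd (card {e \<in> z. v \<in> e}) \<longleftrightarrow> ((v = b) \<noteq> (v = x))" by auto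
  have xy: "{x,y} \<in> E" "x \<noteq> y" using step by auto
  define w where "w = (z - {{x,y}}) \<union> ({{x,y}} - z)"
  have "w \<subseteq> E" using z xy by (auto simp: w_def)
  moreover have "odd (card {e \<in> w. v \<in> e}) \<longleftrightarrow> ((v = b) \<noteq> (v = y))" for v
  proof -
    have "finite z" using z assms finite_subset by auto
    then have 1: "even (card {e \<in> w. v \<in> e}) \<longleftrightarrow>
       (even (card {e \<in> z. v \<in> e}) \<longleftrightarrow> even (card {e \<in> {{x,y}}. v \<in> e}))"
      unfolding w_def by (intro even_card_sym_diff_at) auto
    have 2: "{e \<in> {{x,y}}. v \<in> e} = (if v = x \<or> v = y then {{x,y}} else {})" by auto
    show ?thesis using 1 z(2)[of v] xy unfolding 2 by auto
  qed
  ultimately show ?case by blast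
qed

text \<open>Otherwise a closed curve through \<open>A\<close> could enter and leave \<open>A\<close> through different components of
  its link. A potential for it would change exactly once around such a component.\<close>

lemma link_connected:
  assumes K: "trisphere K" and Y: "Y \<subseteq> {t \<in> K. A \<in> t}" "Y \<noteq> {}"
    and cl: "\<And>t t'. t \<in> Y \<Longrightarrow> t' \<in> K \<Longrightarrow> A \<in> t' \<Longrightarrow> card (t \<inter> t') = 2 \<Longrightarrow> t' \<in> Y"
  shows "Y = {t \<in> K. A \<in> t}"
proof (rule ccontr)
  assume "Y \<noteq> {t \<in> K. A \<in> t}"
  then obtain t' where t': "t' \<in> K" "A \<in> t'" "t' \<notin> Y" using Y by auto
  obtain t where t: "t \<in> Y" "t \<in> K" "A \<in> t" using Y by auto
  note K3 = trisphereD(3)[OF K] and fin = trisphereD(4)[OF K]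
  have nonA: "\<exists>x\<in>s. x \<noteq> A" if "s \<in> K" for s
    using K3[OF that] card_mono[of "{A}" s] by fastforce
  obtain b where b: "b \<in> t" "b \<noteq> A" using nonA t by auto
  obtain c where c: "c \<in> t'" "c \<noteq> A" using nonA t' by auto
  define E where "E = {e \<in> skeleton K. A \<notin> e}"
  define r where "r = {(x, y). {x,y} \<in> E \<and> x \<noteq> y}"
  have skel: "{x,y} \<in> skeleton K" if "s \<in> K" "x \<in> s" "y \<in> s" "x \<noteq> y" for s x y
    using that unfolding skeleton_def by auto
  have finE: "finite E"
    by (rule finite_subset[of _ "Pow (\<Union>K)"]) (use trisphereD(5)[OF K] in \<open>auto simp: E_def skeleton_def\<close>)
  \<comment> \<open>The graph of edges off \<open>A\<close> is connected: two adjacent triangles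
    share a corner other than \<open>A\<close>, so reachability from \<open>b\<close> off
    \<open>A\<close> is a potential of the empty chain and hence constant.\<close>
  define p where "p s \<longleftrightarrow> (\<exists>x\<in>s - {A}. (b, x) \<in> r\<^sup>*)" for s
  have p_all: "(b, x) \<in> r\<^sup>*" if h: "p s" "s \<in> K" "x \<in> s" "x \<noteq> A" for s x
  proof -
    obtain y where y: "y \<in> s" "y \<noteq> A" "(b, y) \<in> r\<^sup>*" using h by (auto simp: p_def)
    show ?thesis
    proof (cases "x = y")
      case False
      then have "(y, x) \<in> r" using skel[of s] h y by (auto simp: r_def E_def)
      then show ?thesis using y by auto
    qed (use y in auto)
  qed
  have "p s \<longleftrightarrow> p s'" if "s \<in> K" "s' \<in> K" "card (s \<inter> s') = 2" for s s'
  proof -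
    have "\<exists>x\<in>s \<inter> s'. x \<noteq> A"
      using that(3) card_mono[of "{A}" "s \<inter> s'"] by fastforce
    then obtain x where "x \<in> s" "x \<in> s'" "x \<noteq> A" by auto
    then show ?thesis using p_all that unfolding p_def by blast
  qed
  then have "potential K {} p" unfolding potential_def by auto
  then have "p t = p t'" using trisphereD(7)[OF K] t t' by blast
  moreover have "p t" using b by (auto simp: p_def)
  ultimately have "(b, c) \<in> r\<^sup>*" using p_all t' c by auto
  from reachable_chain[OF this[unfolded r_def] finE] obtain z where
    z: "z \<subseteq> E" "\<And>v. odd (card {e \<in> z. v \<in> e}) \<longleftrightarrow> ((v = b) \<noteq> (v = c))" by auto
  have both: "s \<in> Y \<longleftrightarrow> s' \<in> Y" if "s \<in> K" "s' \<in> K" "{A,x} \<subseteq> s" "{A,x} \<subseteq> s'" "x \<noteq> A" for s s' x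
  proof (cases "s = s'")
    case False
    have "s \<inter> s' = {A,x}" by (rule card3_inter_eq) (use K3 that False in auto)
    then have "card (s \<inter> s') = 2" "card (s' \<inter> s) = 2" using that by (auto simp: Int_commute)
    then show ?thesis using cl[of s s'] cl[of s' s] that by auto
  qed auto
  have bc: "b \<noteq> c" using both[of t t' b] t t' b c by auto
  \<comment> \<open>The chain from \<open>b\<close> to \<open>c\<close> off \<open>A\<close> is
    closed up by two spokes, one in a triangle of \<open>Y\<close> and one in a triangle outside
    \<open>Y\<close>.\<close>
  define zz where "zz = z \<union> {{A,b},{A,c}}"
  have zE: "A \<notin> e" if "e \<in> z" for e using that z by (auto simp: E_def)
  have "finite z" using z finE finite_subset by auto
  have "even_chain zz" unfolding even_chain_def
  proof
    fix v
    have "{e \<in> zz. v \<in> e} = {e \<in> z. v \<in> e} \<union> {e \<in> {{A,b},{A,c}}. v \<in> e}" by (auto simp: zz_def)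
    also have "card \<dots> = card {e \<in> z. v \<in> e} + card {e \<in> {{A,b},{A,c}}. v \<in> e}"
      using \<open>finite z\<close> zE by (intro card_Un_disjoint) auto
    finally have e: "card {e \<in> zz. v \<in> e} = card {e \<in> z. v \<in> e} + card {e \<in> {{A,b},{A,c}}. v \<in> e}" .
    have "{A,b} \<noteq> {A,c}" using bc by (auto simp: doubleton_eq_iff)
    moreover have "{e \<in> {{A,b},{A,c}}. v \<in> e} =
       (if v = A then {{A,b},{A,c}} else if v = b then {{A,b}} else if v = c then {{A,c}} else {})"
      using b c bc by auto
    ultimately have "odd (card {e \<in> {{A,b},{A,c}}. v \<in> e}) \<longleftrightarrow> v \<noteq> A \<and> (v = b \<or> v = c)" using bc by auto
    then show "even (card {e \<in> zz. v \<in> e})" using e z(2)[of v] b c bc by auto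
  qed
  moreover have "zz \<subseteq> skeleton K"
    using z skel[of t A b] skel[of t' A c] t t' b c by (auto simp: zz_def E_def)
  ultimately obtain q where q: "potential K zz q" using trisphereD(8)[OF K] by blast
  define P where "P = {s \<in> Y. q s}"
  have finP: "finite P" using Y trisphereD(1)[OF K] by (auto simp: P_def intro: finite_subset)
  define V where "V = \<Union>K - {A}"
  have finV: "finite V" using trisphereD(5)[OF K] by (auto simp: V_def)
  \<comment> \<open>Counted by triangles the incidences are even, as each triangle at
    \<open>A\<close> has two further corners. Counted by corners, the parity at \<open>x\<close>
    tells whether \<open>q\<close> jumps across the spoke \<open>{A,x}\<close>, which within
    \<open>Y\<close> happens at \<open>b\<close> only.\<close>
  have "(\<Sum>x\<in>V. card {s \<in> P. x \<in> s}) = (\<Sum>x\<in>V. \<Sum>s\<in>P. if x \<in> s then 1 else 0)"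
    by (simp only: card_eq_sum sum.inter_filter[OF finP])
  also have "\<dots> = (\<Sum>s\<in>P. \<Sum>x\<in>V. if x \<in> s then 1 else 0)" by (rule sum.swap)
  also have "\<dots> = (\<Sum>s\<in>P. 2)"
  proof (rule sum.cong[OF refl])
    fix s assume "s \<in> P"
    then have s: "s \<in> K" "A \<in> s" using Y by (auto simp: P_def)
    have "(\<Sum>x\<in>V. if x \<in> s then 1 else (0::nat)) = card {x \<in> V. x \<in> s}"
      by (simp only: card_eq_sum sum.inter_filter[OF finV])
    also have "{x \<in> V. x \<in> s} = s - {A}" using s by (auto simp: V_def)
    finally show "(\<Sum>x\<in>V. if x \<in> s then 1 else (0::nat)) = 2" using s K3[of s] fin[of s] by simp
  qed
  finally have "even (\<Sum>x\<in>V. card {s \<in> P. x \<in> s})" by simp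
  then have ev: "even (card {x \<in> V. odd (card {s \<in> P. x \<in> s})})" by (simp only: even_sum_iff[OF finV] not_not)
  have "odd (card {s \<in> P. x \<in> s}) \<longleftrightarrow> x = b" if x: "x \<in> V" for x
  proof (cases "\<exists>s\<in>Y. x \<in> s")
    case False
    then have "{s \<in> P. x \<in> s} = {}" by (auto simp: P_def)
    then have "card {s \<in> P. x \<in> s} = 0" by (simp only: card.empty)
    moreover have "x \<noteq> b" using False t b by auto
    ultimately show ?thesis by simp
  next
    case True
    then obtain s where s: "s \<in> Y" "x \<in> s" by auto
    have xA: "x \<noteq> A" using x by (auto simp: V_def)
    have "{A,x} \<in> skeleton K" using skel[of s A x] s Y xA by auto
    then obtain s1 s2 where ss: "s1 \<in> K" "s2 \<in> K" "{s \<in> K. {A,x} \<subseteq> s} = {s1,s2}" "s1 \<noteq> s2"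
      by (elim skeletonD[OF K]) (auto simp: insert_eq_iff)
    have sub: "{A,x} \<subseteq> s1" "{A,x} \<subseteq> s2" using ss by auto
    have inY: "s1 \<in> Y" "s2 \<in> Y" using both[of s s1 x] both[of s s2 x] s Y sub ss xA by auto
    have "s1 \<inter> s2 = {A,x}" by (rule card3_inter_eq) (use K3 ss sub xA in auto)
    then have "(q s1 \<noteq> q s2) \<longleftrightarrow> {A,x} \<in> zz"
      using q ss xA unfolding potential_def by auto
    also have "\<dots> \<longleftrightarrow> x = b \<or> x = c" using zE xA by (auto simp: zz_def doubleton_eq_iff)
    also have "\<dots> \<longleftrightarrow> x = b" using both[of s1 t' c] t' c ss sub inY by auto
    finally have qq: "(q s1 \<noteq> q s2) \<longleftrightarrow> x = b" .
    have "s \<in> Y \<and> x \<in> s \<longleftrightarrow> s \<in> {s1,s2}" for s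
    proof
      assume "s \<in> Y \<and> x \<in> s"
      then have "s \<in> {s \<in> K. {A,x} \<subseteq> s}" using Y by auto
      then show "s \<in> {s1,s2}" unfolding ss(3) .
    qed (use inY sub in auto)
    then have "{s \<in> P. x \<in> s} = {s \<in> {s1,s2}. q s}" unfolding P_def by blast
    then have cq: "card {s \<in> P. x \<in> s} = (if q s1 then 1 else 0) + (if q s2 then 1 else 0)"
      by (simp only: card_filter_pair[OF ss(4)])
    show ?thesis unfolding cq using qq by auto
  qed
  then have "{x \<in> V. odd (card {s \<in> P. x \<in> s})} = {b}" using b t by (auto simp: V_def)
  with ev show False by simp
qed

text \<open>Modulo 2, the closed curve through \<open>A\<close>, \<open>B0\<close>, \<open>B2\<close> separates \<open>B1\<close> from \<open>B3\<close>.\<close>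

lemma chords_do_not_cross:
  assumes K: "trisphere K" and dist: "distinct [A,B0,B1,B2,B3]"
    and tri: "{A,B0,B1} \<in> K" "{A,B1,B2} \<in> K" "{A,B2,B3} \<in> K"
    and ch: "{B0,B2} \<in> skeleton K" "{B1,B3} \<in> skeleton K"
  shows False
proof -
  define z where "z = {{A,B0},{B0,B2},{A,B2}}"
  have "even_chain z" unfolding z_def by (rule even_chain_triangle) (use dist in auto)
  moreover have "z \<subseteq> skeleton K"
    using ch dist tri unfolding z_def skeleton_def by (auto intro: bexI[OF _ tri(1)] bexI[OF _ tri(2)])
  ultimately obtain p where p: "potential K z p" using trisphereD(8)[OF K] by blast
  have 1: "{A,B0,B1} \<inter> {A,B1,B2} = {A,B1}" "{A,B1,B2} \<inter> {A,B2,B3} = {A,B2}" using dist by auto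
  have "(p {A,B0,B1} \<noteq> p {A,B1,B2}) \<longleftrightarrow> {A,B1} \<in> z"
    by (rule potentialD[OF p tri(1,2) 1(1)]) (use dist in auto)
  moreover have "(p {A,B1,B2} \<noteq> p {A,B2,B3}) \<longleftrightarrow> {A,B2} \<in> z"
    by (rule potentialD[OF p tri(2,3) 1(2)]) (use dist in auto)
  ultimately have pp: "p {A,B0,B1} = p {A,B1,B2}" "p {A,B1,B2} \<noteq> p {A,B2,B3}"
    using dist by (auto simp: z_def doubleton_eq_iff)
  \<comment> \<open>Around a corner off the curve there is no jump, so by connectedness of the link
    the potential has a single value there.\<close>
  have star: "p t = p s" if "t \<in> K" "s \<in> K" "B \<in> t" "B \<in> s" "\<And>e. e \<in> z \<Longrightarrow> B \<notin> e" for t s B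
  proof -
    have "{t \<in> K. B \<in> t \<and> p t = p s} = {t \<in> K. B \<in> t}"
    proof (rule link_connected[OF K])
      show "{t \<in> K. B \<in> t \<and> p t = p s} \<subseteq> {t \<in> K. B \<in> t}" "{t \<in> K. B \<in> t \<and> p t = p s} \<noteq> {}"
        using that by auto
      fix u u' assume u: "u \<in> {t \<in> K. B \<in> t \<and> p t = p s}" "u' \<in> K" "B \<in> u'" "card (u \<inter> u') = 2"
      have "u \<inter> u' \<notin> z" using that(5) u by auto
      then show "u' \<in> {t \<in> K. B \<in> t \<and> p t = p s}" using p u unfolding potential_def by auto
    qed
    then show ?thesis using that by auto
  qed
  \<comment> \<open>A triangle on the second chord belongs to the stars of both \<open>B1\<close>
    and \<open>B3\<close>, on which \<open>p\<close> has different values.\<close>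
  obtain t where t: "t \<in> K" "B1 \<in> t" "B3 \<in> t" using ch by (auto simp: skeleton_def)
  have "p t = p {A,B1,B2}" by (rule star[where B=B1]) (use t tri dist in \<open>auto simp: z_def\<close>)
  moreover have "p t = p {A,B2,B3}" by (rule star[where B=B3]) (use t tri dist in \<open>auto simp: z_def\<close>)
  ultimately show False using pp by auto
qed

lemma pairs_of_triple:
  assumes "a \<noteq> b" "b \<noteq> c" "a \<noteq> c"
  shows "{e. card e = 2 \<and> e \<subseteq> {a,b,c}} = {{a,b},{b,c},{a,c}}"
proof (intro equalityI subsetI)
  fix e assume "e \<in> {e. card e = 2 \<and> e \<subseteq> {a,b,c}}"
  then obtain x y where "e = {x,y}" "x \<noteq> y" "{x,y} \<subseteq> {a,b,c}" by (auto simp: card_2_iff)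
  then show "e \<in> {{a,b},{b,c},{a,c}}" by auto
qed (use assms in auto)

lemma triples_of_four:
  assumes "distinct [a,b,c,d]"
  shows "{t. t \<subseteq> {a,b,c,d} \<and> card t = 3} = {{a,b,c},{a,b,d},{a,c,d},{b,c,d}}"
proof (intro equalityI subsetI)
  fix t assume "t \<in> {t. t \<subseteq> {a,b,c,d} \<and> card t = 3}"
  then have t: "t \<subseteq> {a,b,c,d}" "card t = 3" by auto
  then have "card ({a,b,c,d} - t) = 1" using assms by (subst card_Diff_subset) (auto intro: finite_subset)
  then obtain x where x: "{a,b,c,d} - t = {x}" by (meson card_1_singletonE)
  have "t = {a,b,c,d} - {x}" using x t(1) by blast
  moreover have "x \<in> {a,b,c,d}" using x by blast
  ultimately show "t \<in> {{a,b,c},{a,b,d},{a,c,d},{b,c,d}}" using assms by auto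
qed (use assms in auto)

lemma card_filter_triple:
  assumes "T1 \<noteq> T2" "T1 \<noteq> T3" "T2 \<noteq> T3"
  shows "card {t \<in> {T1,T2,T3}. Q t} = (if Q T1 then 1 else 0) + (if Q T2 then 1 else 0) + (if Q T3 then 1 else 0)"
proof -
  have "{t \<in> {T1,T2,T3}. Q t} =
     (if Q T1 then {T1} else {}) \<union> (if Q T2 then {T2} else {}) \<union> (if Q T3 then {T3} else {})" by auto
  then show ?thesis using assms by auto
qed

text \<open>The patch \<open>P\<close> is exchanged for \<open>P'\<close>. As the interior edges of either patch are not edges of
  the other complex, potentials are constant on the patches and can be carried over; a chain
  containing the new edge \<open>f\<close> is first pushed across the triangle \<open>t0\<close>.\<close>

lemma trisphere_replace:
  assumes K: "trisphere (R \<union> P)" and RP: "R \<inter> P = {}" "R \<inter> P' = {}" and P: "P \<noteq> {}"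
    and P': "finite P'" "\<And>t. t \<in> P' \<Longrightarrow> card t = 3"
    and count: "\<And>e. card e = 2 \<Longrightarrow> card {t \<in> P'. e \<subseteq> t} = card {t \<in> P. e \<subseteq> t} \<or>
       (\<forall>t\<in>R. \<not> e \<subseteq> t) \<and> card {t \<in> P'. e \<subseteq> t} \<in> {0, 2}"
    and inner: "\<And>t t'. t \<in> P \<Longrightarrow> t' \<in> P \<Longrightarrow> t \<noteq> t' \<Longrightarrow> card (t \<inter> t') = 2 \<and> t \<inter> t' \<notin> skeleton (R \<union> P')"
    and inner': "\<And>t t'. t \<in> P' \<Longrightarrow> t' \<in> P' \<Longrightarrow> t \<noteq> t' \<Longrightarrow> card (t \<inter> t') = 2 \<and> t \<inter> t' \<notin> skeleton (R \<union> P)"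
    and t0: "t0 \<in> P'" and f: "f \<subseteq> t0" "skeleton (R \<union> P') \<subseteq> insert f (skeleton (R \<union> P))"
  shows "trisphere (R \<union> P')"
proof -
  note fin = trisphereD(1)[OF K] and K3 = trisphereD(3)[OF K]
  have finR: "finite R" and finP: "finite P" using fin by auto
  have c3: "\<forall>t\<in>R \<union> P \<union> P'. card t = 3" "\<forall>t\<in>R \<union> P' \<union> P. card t = 3" using K3 P' by auto
  have split: "card {t \<in> R \<union> X. e \<subseteq> t} = card {t \<in> R. e \<subseteq> t} + card {t \<in> X. e \<subseteq> t}"
    if "finite X" "R \<inter> X = {}" for X e
  proof -
    have "{t \<in> R \<union> X. e \<subseteq> t} = {t \<in> R. e \<subseteq> t} \<union> {t \<in> X. e \<subseteq> t}" by auto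
    then show ?thesis using finR that by (simp only:) (subst card_Un_disjoint, auto)
  qed
  have pos: "0 < card {t \<in> X. e \<subseteq> t} \<longleftrightarrow> (\<exists>t\<in>X. e \<subseteq> t)" if "finite X" for X and e :: "'a set"
    using that by (auto simp: card_gt_0_iff)
  have E: "card {t \<in> R \<union> P'. e \<subseteq> t} = 0 \<or> card {t \<in> R \<union> P'. e \<subseteq> t} = 2" if "card e = 2" for e
  proof -
    from count[OF that] show ?thesis
    proof
      assume "card {t \<in> P'. e \<subseteq> t} = card {t \<in> P. e \<subseteq> t}"
      then have "card {t \<in> R \<union> P'. e \<subseteq> t} = card {t \<in> R \<union> P. e \<subseteq> t}"
        using split[OF finP RP(1)] split[OF P'(1) RP(2)] by simp
      then show ?thesis using trisphereD(6)[OF K that] by simp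
    next
      assume *: "(\<forall>t\<in>R. \<not> e \<subseteq> t) \<and> card {t \<in> P'. e \<subseteq> t} \<in> {0, 2}"
      then have "{t \<in> R. e \<subseteq> t} = {}" by auto
      then have "card {t \<in> R. e \<subseteq> t} = 0" by (simp only: card.empty)
      then show ?thesis using split[OF P'(1) RP(2)] * by auto
    qed
  qed
  have cov: "(\<exists>u\<in>P. e \<subseteq> u) \<or> (\<forall>t\<in>R. \<not> e \<subseteq> t)" if "t' \<in> P'" "e \<subseteq> t'" "card e = 2" for t' e
    using count[OF that(3)] pos[OF finP, of e] pos[OF P'(1), of e] that by auto
  have cov': "(\<exists>u\<in>P'. e \<subseteq> u) \<or> (\<forall>t\<in>R. \<not> e \<subseteq> t)" if "t' \<in> P" "e \<subseteq> t'" "card e = 2" for t' e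
    using count[OF that(3)] pos[OF finP, of e] pos[OF P'(1), of e] that by auto
  obtain s0 where s0: "s0 \<in> P" using P by auto
  have conn: "p t = p t'" if p: "potential (R \<union> P') {} p" and t: "t \<in> R \<union> P'" "t' \<in> R \<union> P'" for p t t'
  proof -
    have pc: "p u = p t0" if "u \<in> P'" for u
      using inner'[OF that t0] p that t0 unfolding potential_def by (cases "u = t0") auto
    \<comment> \<open>By \<open>pc\<close> the potential has one value on the new patch, and the old
      patch inherits it.\<close>
    define p1 where "p1 = (\<lambda>t. if t \<in> P then p t0 else p t)"
    have "potential (R \<union> P) {} p1"
      unfolding p1_def
    proof (rule potential_transfer[OF p RP(1) _ _ RP(2)])
      show "potential P {} (\<lambda>t. p t0)" by (auto simp: potential_def)
      fix t' e assume "t' \<in> P" "e \<subseteq> t'" "card e = 2"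
      from cov'[OF this] pc[symmetric] show "(\<exists>u\<in>P'. e \<subseteq> u \<and> p t0 = p u) \<or> (\<forall>t\<in>R. \<not> e \<subseteq> t)"
        by metis
    qed (use c3 in blast)
    from trisphereD(7)[OF K this] have "p1 u = p1 s0" if "u \<in> R" for u using that s0 by simp
    moreover have "p1 u = p u" if "u \<in> R" for u using that RP unfolding p1_def by (metis IntI empty_iff)
    moreover have "p1 s0 = p t0" using s0 by (simp add: p1_def)
    ultimately have "p u = p t0" if "u \<in> R" for u using that by metis
    then have "p u = p t0" if "u \<in> R \<union> P'" for u using that pc by blast
    from this[OF t(1)] this[OF t(2)] show ?thesis by simp
  qed
  have H0: "\<exists>p. potential (R \<union> P') z p"
    if z: "z \<subseteq> skeleton (R \<union> P')" "z \<subseteq> skeleton (R \<union> P)" "even_chain z" for z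
  proof -
    obtain p where p: "potential (R \<union> P) z p" using trisphereD(8)[OF K] z by blast
    have pc: "p u = p s0" if "u \<in> P" for u
      using inner[OF that s0] p that s0 z(1) unfolding potential_def by (cases "u = s0") auto
    have "potential (R \<union> P') z (\<lambda>t. if t \<in> P' then p s0 else p t)"
    proof (rule potential_transfer[OF p RP(2) _ _ RP(1)])
      \<comment> \<open>The inner edges of the new patch are not edges of the old complex, so
        \<open>z\<close> avoids them and a constant is a potential on the patch.\<close>
      show "potential P' z (\<lambda>t. p s0)"
        unfolding potential_def
      proof (intro ballI impI)
        fix t t' assume "t \<in> P'" "t' \<in> P'" "card (t \<inter> t') = 2"
        moreover from this have "t \<noteq> t'" using P'(2)[of t] by auto
        ultimately have "t \<inter> t' \<notin> z" using inner' z(2) by blast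
        then show "(p s0 \<noteq> p s0) \<longleftrightarrow> t \<inter> t' \<in> z" by simp
      qed
      fix t' e assume "t' \<in> P'" "e \<subseteq> t'" "card e = 2"
      from cov[OF this] pc[symmetric] show "(\<exists>u\<in>P. e \<subseteq> u \<and> p s0 = p u) \<or> (\<forall>t\<in>R. \<not> e \<subseteq> t)"
        by metis
    qed (use c3 in blast)
    then show ?thesis by blast
  qed
  have H: "\<exists>p. potential (R \<union> P') z p" if z: "z \<subseteq> skeleton (R \<union> P')" "even_chain z" for z
  proof (cases "f \<in> z")
    case False
    then show ?thesis using H0 z f(2) by blast
  next
    case True
    define y where "y = {e. card e = 2 \<and> e \<subseteq> t0}"
    define w where "w = (z - y) \<union> (y - z)"
    obtain a b c where abc: "t0 = {a,b,c}" "a \<noteq> b" "b \<noteq> c" "a \<noteq> c" using P'(2)[OF t0] by (auto simp: card_3_iff)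
    have y3: "y = {{a,b},{b,c},{a,c}}" unfolding y_def abc(1) by (rule pairs_of_triple) (use abc in auto)
    have "\<forall>t\<in>R \<union> P'. finite t" using c3 by (metis UnI1 UnI2 card.infinite zero_neq_numeral UnE)
    then have "finite (\<Union>(R \<union> P'))" using finR P'(1) by blast
    then have "finite (skeleton (R \<union> P'))"
      by (rule finite_subset[rotated, OF finite_Pow_iff[THEN iffD2]]) (auto simp: skeleton_def)
    then have finz: "finite z" using z finite_subset by blast
    have "even_chain w" unfolding w_def
      by (rule even_chain_sym_diff[OF finz]) (use z(2) abc even_chain_triangle[of a b c] in \<open>auto simp: y3\<close>)
    moreover have "card f = 2" using True z by (auto simp: skeleton_def)
    moreover have "y \<subseteq> skeleton (R \<union> P')" using t0 by (auto simp: y_def skeleton_def)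
    moreover have "w \<subseteq> skeleton (R \<union> P')" using calculation(3) z(1) by (auto simp: w_def)
    \<comment> \<open>Both \<open>z\<close> and the boundary of \<open>t0\<close> contain
      \<open>f\<close>, so it cancels and \<open>w\<close> is a chain of old edges.\<close>
    moreover have "f \<notin> w" using True calculation(2) f(1) by (auto simp: w_def y_def)
    ultimately obtain p where "potential (R \<union> P') w p" using H0[of w] f(2) by blast
    then have "potential (R \<union> P') ((w - y) \<union> (y - w)) (p(t0 := \<not> p t0))"
      by (rule potential_toggle[OF _ _ _ E]) (use t0 c3 finR P'(1) y_def in auto)
    moreover have "(w - y) \<union> (y - w) = z" by (auto simp: w_def)
    ultimately show ?thesis by auto
  qed
  have "R \<union> P' \<noteq> {}" using t0 by auto
  moreover have "finite (R \<union> P')" using finR P'(1) by auto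
  moreover have "\<forall>t\<in>R \<union> P'. card t = 3" using c3 by auto
  ultimately show ?thesis
    unfolding trisphere_def using E conn H by blast
qed

text \<open>The excluded triangles are those whose repetition would lose a line. A flip keeps away
  from \<open>outer\<close> because all four of its triangles must carry standard lines, whereas a
  removal may have \<open>outer\<close> among \<open>b\<close>, \<open>c\<close>, \<open>d\<close>:
  the created triangle then stands for an edge of the simplex. That \<open>K'\<close> is a sphere is
  part of the rules so that they can be read in both directions.\<close>

inductive sphere_move :: "'i \<Rightarrow> 'i set set \<Rightarrow> 'i set set \<Rightarrow> bool" for outer where
  flip: "\<lbrakk>trisphere K; trisphere K'; distinct [a,b,c,d]; outer \<notin> {a,b,c,d}; {a,b,c} \<in> K; {a,b,d} \<in> K;
     {a,c,d} \<notin> K; {b,c,d} \<notin> K; \<Union>K' = \<Union>K; K' = (K - {{a,b,c},{a,b,d}}) \<union> {{a,c,d},{b,c,d}}\<rbrakk>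
     \<Longrightarrow> sphere_move outer K K'"
| remove: "\<lbrakk>trisphere K; trisphere K'; distinct [a,b,c,d]; a \<noteq> outer; {t \<in> K. a \<in> t} = {{a,b,c},{a,b,d},{a,c,d}};
     {b,c,d} \<notin> K; \<Union>K' = \<Union>K - {a}; K' = (K - {{a,b,c},{a,b,d},{a,c,d}}) \<union> {{b,c,d}}\<rbrakk>
     \<Longrightarrow> sphere_move outer K K'"

section \<open>Moves preserve spheres\<close>

lemma skeletonI: "t \<in> K \<Longrightarrow> x \<in> t \<Longrightarrow> y \<in> t \<Longrightarrow> x \<noteq> y \<Longrightarrow> {x,y} \<in> skeleton K"
  unfolding skeleton_def by auto

lemma skeletonE2:
  assumes "e \<in> skeleton K"
  obtains x y t where "e = {x,y}" "x \<noteq> y" "t \<in> K" "x \<in> t" "y \<in> t"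
  using assms unfolding skeleton_def card_2_iff by blast

text \<open>Since \<open>c\<close> and \<open>d\<close> are not adjacent, neither new triangle was
  present before, and the exchange trades the edge \<open>{a,b}\<close> for \<open>{c,d}\<close>.
  The two bounds on the skeleton serve to follow which corners are adjacent to
  \<open>outer\<close>.\<close>

lemma sphere_flip:
  assumes K: "trisphere K" and dist: "distinct [a,b,c,d]" and T: "{a,b,c} \<in> K" "{a,b,d} \<in> K"
    and cd: "{c,d} \<notin> skeleton K"
    and K': "K' = (K - {{a,b,c},{a,b,d}}) \<union> {{a,c,d},{b,c,d}}"
  shows "trisphere K'" "{a,c,d} \<notin> K" "{b,c,d} \<notin> K" "\<Union>K' = \<Union>K" "card K' = card K"
    "skeleton K' \<subseteq> insert {c,d} (skeleton K)" "skeleton K - {{a,b}} \<subseteq> skeleton K'"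
proof -
  define R where "R = K - {{a,b,c},{a,b,d}}"
  define P where "P = {{a,b,c},{a,b,d}}"
  define P' where "P' = {{a,c,d},{b,c,d}}"
  have KR: "K = R \<union> P" using T by (auto simp: R_def P_def)
  have K'R: "K' = R \<union> P'" by (simp add: K' R_def P'_def)
  have neT: "{a,b,c} \<noteq> {a,b,d}" "{a,c,d} \<noteq> {b,c,d}" using dist by auto
  have notcd: "\<not> {c,d} \<subseteq> t" if "t \<in> K" for t using cd that dist by (auto simp: skeleton_def)
  show acd: "{a,c,d} \<notin> K" and bcd: "{b,c,d} \<notin> K" using notcd by auto
  have RP: "R \<inter> P = {}" "R \<inter> P' = {}" using acd bcd by (auto simp: R_def P_def P'_def)
  have co: "{t \<in> K. {a,b} \<subseteq> t} = {{a,b,c},{a,b,d}}"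
    by (rule cofaces_eq[OF K T]) (use dist in auto)
  have Rab: "\<not> {a,b} \<subseteq> t" if "t \<in> R" for t
  proof
    assume "{a,b} \<subseteq> t"
    then have "t \<in> {t \<in> K. {a,b} \<subseteq> t}" using that by (simp add: R_def)
    then show False unfolding co using that by (simp add: R_def)
  qed
  have Rcd: "\<not> {c,d} \<subseteq> t" if "t \<in> R" for t using that notcd by (auto simp: R_def)
  have ab': "{a,b} \<notin> skeleton K'"
    using Rab dist by (auto simp: K'R P'_def skeleton_def)
  show "\<Union>K' = \<Union>K" unfolding K'R KR by (auto simp: P_def P'_def)
  have fin: "finite K" by (rule trisphereD(1)[OF K])
  have "card (K - {{a,b,c},{a,b,d}}) = card K - 2" using T neT fin by (simp add: card_Diff_subset)
  moreover have "card K \<ge> card {{a,b,c},{a,b,d}}" by (rule card_mono) (use T fin in auto)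
  moreover have "card K' = card R + card P'" unfolding K'R
    by (rule card_Un_disjoint) (use fin RP in \<open>auto simp: R_def P'_def\<close>)
  ultimately show "card K' = card K" using neT by (simp add: R_def P'_def)
  show sk: "skeleton K' \<subseteq> insert {c,d} (skeleton K)"
  proof
    fix e assume "e \<in> skeleton K'"
    then obtain x y t where e: "e = {x,y}" "x \<noteq> y" "t \<in> K'" "x \<in> t" "y \<in> t" by (rule skeletonE2)
    consider "t \<in> K" | "t = {a,c,d}" | "t = {b,c,d}" using e(3) K' by auto
    then show "e \<in> insert {c,d} (skeleton K)"
    proof cases
      case 1 then show ?thesis unfolding e(1) using e(2,4,5) by (intro insertI2 skeletonI)
    next
      case 2
      then have "e = {c,d} \<or> e = {a,c} \<or> e = {a,d}" using e by auto
      moreover have "{a,c} \<in> skeleton K" "{a,d} \<in> skeleton K"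
        using skeletonI[OF T(1), of a c] skeletonI[OF T(2), of a d] dist by auto
      ultimately show ?thesis by auto
    next
      case 3
      then have "e = {c,d} \<or> e = {b,c} \<or> e = {b,d}" using e by auto
      moreover have "{b,c} \<in> skeleton K" "{b,d} \<in> skeleton K"
        using skeletonI[OF T(1), of b c] skeletonI[OF T(2), of b d] dist by auto
      ultimately show ?thesis by auto
    qed
  qed
  show "skeleton K - {{a,b}} \<subseteq> skeleton K'"
  proof
    fix e assume "e \<in> skeleton K - {{a,b}}"
    then have e0: "e \<in> skeleton K" "e \<noteq> {a,b}" by auto
    obtain x y t where exy: "e = {x,y}" "x \<noteq> y" "t \<in> K" "x \<in> t" "y \<in> t"
      by (rule skeletonE2[OF e0(1)])
    note e = exy e0(2)
    have A: "{a,c,d} \<in> K'" and B: "{b,c,d} \<in> K'" by (auto simp: K')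
    consider "t \<in> K'" | "t = {a,b,c}" | "t = {a,b,d}" using e(3) K' by auto
    then show "e \<in> skeleton K'"
    proof cases
      case 1 then show ?thesis unfolding e(1) using e(2,4,5) by (intro skeletonI)
    next
      case 2
      then have "e = {a,c} \<or> e = {b,c}" using e by auto
      then show ?thesis using skeletonI[OF A, of a c] skeletonI[OF B, of b c] dist by auto
    next
      case 3
      then have "e = {a,d} \<or> e = {b,d}" using e by auto
      then show ?thesis using skeletonI[OF A, of a d] skeletonI[OF B, of b d] dist by auto
    qed
  qed
  have count: "card {t \<in> P'. e \<subseteq> t} = card {t \<in> P. e \<subseteq> t} \<or>
       (\<forall>t\<in>R. \<not> e \<subseteq> t) \<and> card {t \<in> P'. e \<subseteq> t} \<in> {0, 2}" if e: "card e = 2" for e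
  proof -
    obtain x y where xy: "e = {x,y}" "x \<noteq> y" using e by (auto simp: card_2_iff)
    have cP: "card {t \<in> P. e \<subseteq> t} = (if e \<subseteq> {a,b,c} then 1 else 0) + (if e \<subseteq> {a,b,d} then 1 else 0)"
      unfolding P_def by (rule card_filter_pair[OF neT(1)])
    have cP': "card {t \<in> P'. e \<subseteq> t} = (if e \<subseteq> {a,c,d} then 1 else 0) + (if e \<subseteq> {b,c,d} then 1 else 0)"
      unfolding P'_def by (rule card_filter_pair[OF neT(2)])
    \<comment> \<open>The four rim edges lie in one triangle of either patch; only the two diagonals
      are counted differently.\<close>
    consider "e = {a,b}" | "e = {c,d}" | "e \<noteq> {a,b}" "e \<noteq> {c,d}" by auto
    then show ?thesis
    proof cases
      case 1 then show ?thesis using Rab cP' dist by auto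
    next
      case 2 then show ?thesis using Rcd cP' dist by auto
    next
      case 3
      have "(if e \<subseteq> {a,b,c} then 1 else 0) + (if e \<subseteq> {a,b,d} then 1 else 0) =
        (if e \<subseteq> {a,c,d} then 1 else 0) + (if e \<subseteq> {b,c,d} then 1 else (0::nat))"
        using 3 xy(2) dist unfolding xy(1) by (auto simp: doubleton_eq_iff)
      then show ?thesis using cP cP' by simp
    qed
  qed
  have KP: "trisphere (R \<union> P)" using K KR by simp
  show "trisphere K'"
    unfolding K'R
  proof (rule trisphere_replace[OF KP RP _ _ _ count])
    show "{a,c,d} \<in> P'" "{c,d} \<subseteq> {a,c,d}" "P \<noteq> {}" "finite P'" by (auto simp: P'_def P_def)
    show "card t = 3" if "t \<in> P'" for t using that dist by (auto simp: P'_def)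
    show "skeleton (R \<union> P') \<subseteq> insert {c,d} (skeleton (R \<union> P))" using sk KR K'R by simp
    have i: "{a,b,c} \<inter> {a,b,d} = {a,b}" "{a,b,d} \<inter> {a,b,c} = {a,b}" using dist by auto
    show "card (t \<inter> t') = 2 \<and> t \<inter> t' \<notin> skeleton (R \<union> P')" if "t \<in> P" "t' \<in> P" "t \<noteq> t'" for t t'
      using that i ab' dist unfolding P_def K'R by auto
    have i': "{a,c,d} \<inter> {b,c,d} = {c,d}" "{b,c,d} \<inter> {a,c,d} = {c,d}" using dist by auto
    show "card (t \<inter> t') = 2 \<and> t \<inter> t' \<notin> skeleton (R \<union> P)" if "t \<in> P'" "t' \<in> P'" "t \<noteq> t'" for t t'
      using that i' cd dist unfolding P'_def KR by auto
  qed
qed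

text \<open>The three spokes at \<open>a\<close> disappear and no edge is created, so any edge of
  the new triangle can serve as the edge \<open>f\<close> of
  \<open>trisphere_replace\<close>.\<close>

lemma sphere_remove:
  assumes K: "trisphere K" and dist: "distinct [a,b,c,d]"
    and star: "{t \<in> K. a \<in> t} = {{a,b,c},{a,b,d},{a,c,d}}"
    and bcd: "{b,c,d} \<notin> K"
    and K': "K' = (K - {{a,b,c},{a,b,d},{a,c,d}}) \<union> {{b,c,d}}"
  shows "trisphere K'" "\<Union>K' = \<Union>K - {a}" "card K' < card K"
proof -
  define P where "P = {{a,b,c},{a,b,d},{a,c,d}}"
  define R where "R = K - P"
  define P' where "P' = {{b,c,d}}"
  have PK: "P \<subseteq> K" using star by (auto simp: P_def)
  have KR: "K = R \<union> P" using PK by (auto simp: R_def)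
  have K'R: "K' = R \<union> P'" by (simp add: K' R_def P'_def P_def)
  have neT: "{a,b,c} \<noteq> {a,b,d}" "{a,b,c} \<noteq> {a,c,d}" "{a,b,d} \<noteq> {a,c,d}" using dist by auto
  have RP: "R \<inter> P = {}" "R \<inter> P' = {}" using bcd by (auto simp: R_def P'_def)
  have Ra: "a \<notin> t" if "t \<in> R" for t using that star unfolding R_def P_def by blast
  have aK': "a \<notin> t" if "t \<in> K'" for t using that Ra dist unfolding K'R P'_def by auto
  show "\<Union>K' = \<Union>K - {a}" unfolding K'R KR using Ra dist by (auto simp: P_def P'_def)
  have fin: "finite K" by (rule trisphereD(1)[OF K])
  have "card P = 3" using neT by (simp add: P_def)
  moreover have "card R = card K - card P" unfolding R_def by (rule card_Diff_subset) (use PK fin finite_subset in auto)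
  moreover have "card K \<ge> card P" by (rule card_mono) (use PK fin in auto)
  moreover have "card K' \<le> card R + card P'" unfolding K'R by (rule card_Un_le)
  ultimately show "card K' < card K" by (simp add: P'_def)
  have count: "card {t \<in> P'. e \<subseteq> t} = card {t \<in> P. e \<subseteq> t} \<or>
       (\<forall>t\<in>R. \<not> e \<subseteq> t) \<and> card {t \<in> P'. e \<subseteq> t} \<in> {0, 2}" if e: "card e = 2" for e
  proof -
    obtain x y where xy: "e = {x,y}" "x \<noteq> y" using e by (auto simp: card_2_iff)
    have cP: "card {t \<in> P. e \<subseteq> t} = (if e \<subseteq> {a,b,c} then 1 else 0) + (if e \<subseteq> {a,b,d} then 1 else 0)
         + (if e \<subseteq> {a,c,d} then 1 else 0)"
      unfolding P_def by (rule card_filter_triple[OF neT])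
    show ?thesis
    proof (cases "a \<in> e")
      case True
      then have "{t \<in> P'. e \<subseteq> t} = {}" using dist by (auto simp: P'_def)
      then have "card {t \<in> P'. e \<subseteq> t} = 0" by (simp only: card.empty)
      then show ?thesis using True Ra by auto
    next
      case False
      have "(if e \<subseteq> {a,b,c} then 1 else 0) + (if e \<subseteq> {a,b,d} then 1 else 0) + (if e \<subseteq> {a,c,d} then 1 else 0) =
        (if e \<subseteq> {b,c,d} then 1 else (0::nat))"
        using False xy(2) dist unfolding xy(1) by auto
      moreover have "{t \<in> P'. e \<subseteq> t} = (if e \<subseteq> {b,c,d} then {{b,c,d}} else {})" by (auto simp: P'_def)
      ultimately show ?thesis using cP by simp
    qed
  qed
  have KP: "trisphere (R \<union> P)" using K KR by simp
  have mem: "{a,b,c} \<in> K" "{a,b,d} \<in> K" "{a,c,d} \<in> K" using PK by (auto simp: P_def)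
  have sk: "skeleton (R \<union> P') \<subseteq> skeleton (R \<union> P)"
  proof
    fix e assume "e \<in> skeleton (R \<union> P')"
    then obtain x y t where e: "e = {x,y}" "x \<noteq> y" "t \<in> R \<union> P'" "x \<in> t" "y \<in> t" by (rule skeletonE2)
    show "e \<in> skeleton (R \<union> P)"
    proof (cases "t \<in> R")
      case True then show ?thesis unfolding e(1) using e(2,4,5) by (intro skeletonI[of t]) auto
    next
      case False
      then have "e = {b,c} \<or> e = {b,d} \<or> e = {c,d}" using e by (auto simp: P'_def)
      then show ?thesis
        using skeletonI[OF mem(1), of b c] skeletonI[OF mem(2), of b d] skeletonI[OF mem(3), of c d] dist KR by auto
    qed
  qed
  have inn: "e \<notin> skeleton (R \<union> P')" if "a \<in> e" for e
    using aK' that unfolding K'R[symmetric] skeleton_def by auto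
  show "trisphere K'"
    unfolding K'R
  proof (rule trisphere_replace[OF KP RP _ _ _ count])
    show "{b,c,d} \<in> P'" "{b,c} \<subseteq> {b,c,d}" "P \<noteq> {}" "finite P'" by (auto simp: P'_def P_def)
    show "card t = 3" if "t \<in> P'" for t using that dist by (auto simp: P'_def)
    show "skeleton (R \<union> P') \<subseteq> insert {b,c} (skeleton (R \<union> P))" using sk by auto
    show "card (t \<inter> t') = 2 \<and> t \<inter> t' \<notin> skeleton (R \<union> P')" if "t \<in> P" "t' \<in> P" "t \<noteq> t'" for t t'
    proof -
      have "t \<inter> t' = {a,b} \<or> t \<inter> t' = {a,c} \<or> t \<inter> t' = {a,d}"
        using that dist unfolding P_def by auto
      then show ?thesis using inn[of "t \<inter> t'"] dist by auto
    qed
    show "card (t \<inter> t') = 2 \<and> t \<inter> t' \<notin> skeleton (R \<union> P)" if "t \<in> P'" "t' \<in> P'" "t \<noteq> t'" for t t'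
      using that unfolding P'_def by auto
  qed
qed

section \<open>Reduction to the tetrahedron\<close>

lemma triangle_star_cases:
  assumes K: "trisphere K" and T: "{A,B1,B2} \<in> K" and dist: "distinct [A,B1,B2]"
  obtains (three) B0 where "distinct [A,B0,B1,B2]" "{t \<in> K. A \<in> t} = {{A,B0,B1},{A,B0,B2},{A,B1,B2}}"
  | (more) B0 B3 where "distinct [A,B0,B1,B2,B3]" "{A,B0,B1} \<in> K" "{A,B2,B3} \<in> K"
proof -
  obtain B0 where B0: "{A,B1,B0} \<in> K" "B0 \<noteq> A" "B0 \<noteq> B1" "B0 \<noteq> B2"
    using other_coface[OF K, of A B1 B2] T dist by auto
  have "{A,B2,B1} = {A,B1,B2}" by auto
  then obtain B3 where B3: "{A,B2,B3} \<in> K" "B3 \<noteq> A" "B3 \<noteq> B2" "B3 \<noteq> B1"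
    using other_coface[OF K, of A B2 B1] T dist by auto
  have perm: "{A,B1,B0} = {A,B0,B1}" "{A,B2,B0} = {A,B0,B2}" by auto
  \<comment> \<open>The neighbouring triangles across \<open>{A,B1}\<close> and
    \<open>{A,B2}\<close> have apexes \<open>B0\<close> and \<open>B3\<close>; if these agree, three
    triangles close up around \<open>A\<close>.\<close>
  show ?thesis
  proof (cases "B0 = B3")
    case False
    show ?thesis by (rule more[of B0 B3]) (use B0 B3 dist False perm in auto)
  next
    case True
    define Y where "Y = {{A,B0,B1},{A,B0,B2},{A,B1,B2}}"
    have mem: "{A,B0,B1} \<in> K" "{A,B0,B2} \<in> K" "{A,B1,B2} \<in> K" using B0 B3 True T perm by auto
    have co: "{t \<in> K. {A,B0} \<subseteq> t} = {{A,B0,B1},{A,B0,B2}}"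
      by (rule cofaces_eq[OF K]) (use mem B0 B3 dist in auto)
    have co1: "{t \<in> K. {A,B1} \<subseteq> t} = {{A,B1,B0},{A,B1,B2}}"
      by (rule cofaces_eq[OF K]) (use mem perm B0 B3 dist in auto)
    have co2: "{t \<in> K. {A,B2} \<subseteq> t} = {{A,B2,B0},{A,B2,B1}}"
      by (rule cofaces_eq[OF K]) (use mem perm B0 B3 dist \<open>{A,B2,B1} = {A,B1,B2}\<close> in auto)
    have perm3: "{A,B2,B1} = {A,B1,B2}" by auto
    \<comment> \<open>Every edge at \<open>A\<close> in these triangles has both its cofaces among
      them, so they exhaust the star by connectedness of the link.\<close>
    have "Y = {t \<in> K. A \<in> t}"
    proof (rule link_connected[OF K])
      show "Y \<subseteq> {t \<in> K. A \<in> t}" "Y \<noteq> {}" using mem by (auto simp: Y_def)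
      fix t t' assume t: "t \<in> Y" "t' \<in> K" "A \<in> t'" "card (t \<inter> t') = 2"
      have "\<not> t \<inter> t' \<subseteq> {A}" using t(4) card_mono[of "{A}" "t \<inter> t'"] by auto
      then obtain x where "x \<in> t" "x \<in> t'" "x \<noteq> A" by auto
      then have "x \<in> {B0,B1,B2}" using t(1) by (auto simp: Y_def)
      then have "t' \<in> {t \<in> K. {A,B0} \<subseteq> t} \<or> t' \<in> {t \<in> K. {A,B1} \<subseteq> t} \<or> t' \<in> {t \<in> K. {A,B2} \<subseteq> t}"
        using \<open>x \<in> t'\<close> t by auto
      then show "t' \<in> Y" unfolding co co1 co2 Y_def perm perm3 by auto
    qed
    then show ?thesis using three[of B0] B0 dist by (auto simp: Y_def)
  qed
qed

text \<open>Every edge of the tetrahedron has its two cofaces among the four triangles, so their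
  indicator is a potential of the empty chain and therefore constant.\<close>

lemma trisphere_tetrahedron:
  assumes K: "trisphere K" and dist: "distinct [a,b,c,d]"
    and sub: "{{a,b,c},{a,b,d},{a,c,d},{b,c,d}} \<subseteq> K"
  shows "K = {t. t \<subseteq> {a,b,c,d} \<and> card t = 3}"
proof -
  define T where "T = {t. t \<subseteq> {a,b,c,d} \<and> card t = 3}"
  have T: "T = {{a,b,c},{a,b,d},{a,c,d},{b,c,d}}" unfolding T_def by (rule triples_of_four[OF dist])
  have TK: "T \<subseteq> K" using sub unfolding T .
  have step: "t' \<in> T" if h: "t \<in> T" "t' \<in> K" "card (t \<inter> t') = 2" for t t'
  proof -
    define e where "e = t \<inter> t'"
    have e: "e \<subseteq> {a,b,c,d}" "card e = 2" using h by (auto simp: e_def T_def)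
    then have "card ({a,b,c,d} - e) = 2" using dist by (subst card_Diff_subset) (auto intro: finite_subset)
    then obtain u v where uv: "{a,b,c,d} - e = {u,v}" "u \<noteq> v" by (auto simp: card_2_iff)
    have fe: "finite e" using e card.infinite by fastforce
    have uve: "u \<notin> e" "v \<notin> e" "u \<in> {a,b,c,d}" "v \<in> {a,b,c,d}" using uv by blast+
    have "{insert u e, insert v e} \<subseteq> {s \<in> K. e \<subseteq> s}"
    proof -
      have "insert u e \<in> T" "insert v e \<in> T" using uve e fe by (auto simp: T_def)
      then show ?thesis using TK by auto
    qed
    moreover have "card {insert u e, insert v e} = 2" using uve uv(2) by (auto simp: card_2_iff)
    moreover have "card {s \<in> K. e \<subseteq> s} \<le> 2" using trisphereD(6)[OF K e(2)] by auto
    moreover have "finite {s \<in> K. e \<subseteq> s}" using trisphereD(1)[OF K] by auto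
    ultimately have "{s \<in> K. e \<subseteq> s} = {insert u e, insert v e}"
      using card_seteq[of "{s \<in> K. e \<subseteq> s}" "{insert u e, insert v e}"] by simp
    moreover have "t' \<in> {s \<in> K. e \<subseteq> s}" using h by (auto simp: e_def)
    ultimately have "t' = insert u e \<or> t' = insert v e" by blast
    then show ?thesis using uve e fe by (auto simp: T_def)
  qed
  have "potential K {} (\<lambda>t. t \<in> T)"
    unfolding potential_def
  proof (intro ballI impI)
    fix t t' assume h: "t \<in> K" "t' \<in> K" "card (t \<inter> t') = 2"
    show "(t \<in> T) \<noteq> (t' \<in> T) \<longleftrightarrow> t \<inter> t' \<in> {}"
      using step[of t t'] step[of t' t] h by (auto simp: Int_commute)
  qed
  note const = trisphereD(7)[OF K this]
  have "{a,b,c} \<in> T" by (simp add: T)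
  then have "t \<in> T" if "t \<in> K" for t
    using const[OF that, of "{a,b,c}"] TK by auto
  then show ?thesis using TK unfolding T_def[symmetric] by auto
qed

text \<open>In the second alternative every label is adjacent to \<open>outer\<close>. Flips of edges between other
  labels preserve this.\<close>

definition reducible_at :: "'i \<Rightarrow> 'i set set \<Rightarrow> 'i \<Rightarrow> bool" where
  "reducible_at outer K A \<longleftrightarrow> A \<in> \<Union>K \<and> A \<noteq> outer \<and>
     ({A,outer} \<notin> skeleton K \<or> (\<forall>B\<in>\<Union>K - {outer}. {B,outer} \<in> skeleton K))"

definition is_tetrahedron :: "'i \<Rightarrow> 'i set set \<Rightarrow> bool" where
  "is_tetrahedron outer K \<longleftrightarrow> (\<exists>Q. card Q = 4 \<and> outer \<in> Q \<and> K = {t. t \<subseteq> Q \<and> card t = 3})"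

text \<open>Two triangles at \<open>A\<close> are exchanged for one. Edges at \<open>outer\<close>
  are neither created nor destroyed, so \<open>A\<close> stays reducible.\<close>

lemma reduce_flip:
  assumes K: "trisphere K" and dist: "distinct [A,B,c,d]" and T: "{A,B,c} \<in> K" "{A,B,d} \<in> K"
    and cd: "{c,d} \<notin> skeleton K" and red: "reducible_at outer K A" and o: "outer \<in> \<Union>K" "outer \<notin> {A,B,c,d}"
  obtains K' where "sphere_move outer K K'" "reducible_at outer K' A" "outer \<in> \<Union>K'" "card K' = card K"
    "card {t \<in> K'. A \<in> t} < card {t \<in> K. A \<in> t}"
proof -
  define K' where "K' = (K - {{A,B,c},{A,B,d}}) \<union> {{A,c,d},{B,c,d}}"
  note fl = sphere_flip[OF K dist T cd K'_def]
  have mv: "sphere_move outer K K'"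
    by (rule sphere_move.flip[of K K' A B c d]) (use fl K dist T o K'_def in auto)
  have ne: "{A,outer} \<noteq> {c,d}" "\<And>X. {X,outer} \<noteq> {A,B}" using o by (auto simp: doubleton_eq_iff)
  have 1: "{A,outer} \<notin> skeleton K'" if "{A,outer} \<notin> skeleton K" using that fl(6) ne(1) by auto
  have 2: "{X,outer} \<in> skeleton K'" if "{X,outer} \<in> skeleton K" for X using that fl(7) ne(2)[of X] by auto
  have red': "reducible_at outer K' A" using red 1 2 unfolding reducible_at_def fl(4) by metis
  have fin: "finite K" by (rule trisphereD(1)[OF K])
  have "{t \<in> K'. A \<in> t} = ({t \<in> K. A \<in> t} - {{A,B,c},{A,B,d}}) \<union> {{A,c,d}}"
    using dist by (auto simp: K'_def)
  then have "card {t \<in> K'. A \<in> t} \<le> card ({t \<in> K. A \<in> t} - {{A,B,c},{A,B,d}}) + card {{A,c,d}}"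
    by (simp only: card_Un_le)
  also have "card ({t \<in> K. A \<in> t} - {{A,B,c},{A,B,d}}) = card {t \<in> K. A \<in> t} - card {{A,B,c},{A,B,d}}"
    by (rule card_Diff_subset) (use T in auto)
  also have two: "card {{A,B,c},{A,B,d}} = 2"
  proof -
    have "{A,B,c} \<noteq> {A,B,d}" using dist by auto
    then show ?thesis by simp
  qed
  finally have le: "card {t \<in> K'. A \<in> t} \<le> card {t \<in> K. A \<in> t} - 2 + 1" by simp
  have "card {{A,B,c},{A,B,d}} \<le> card {t \<in> K. A \<in> t}" by (rule card_mono) (use T fin in auto)
  with le two have "card {t \<in> K'. A \<in> t} < card {t \<in> K. A \<in> t}" by simp
  then show ?thesis using o(1) fl(4) by (intro that[OF mv red' _ fl(5)]) simp_all
qed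

text \<open>The removal is blocked only when the triangle it would create exists already, and then
  this triangle and the star of \<open>A\<close> form a whole tetrahedron.\<close>

lemma reduce_remove:
  assumes K: "trisphere K" and dist: "distinct [A,b,c,d]" and star: "{t \<in> K. A \<in> t} = {{A,b,c},{A,b,d},{A,c,d}}"
    and o: "outer \<in> \<Union>K" "outer \<noteq> A"
  shows "is_tetrahedron outer K \<or> (\<exists>K'. sphere_move outer K K' \<and> outer \<in> \<Union>K' \<and> card K' < card K)"
proof (cases "{b,c,d} \<in> K")
  case True
  have sub: "{{A,b,c},{A,b,d},{A,c,d}} \<subseteq> K" unfolding star[symmetric] by auto
  have K4: "K = {t. t \<subseteq> {A,b,c,d} \<and> card t = 3}"
    by (rule trisphere_tetrahedron[OF K dist]) (use sub True in auto)
  moreover have "outer \<in> {A,b,c,d}" using o(1) K4 by blast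
  moreover have "card {A,b,c,d} = 4" using dist by auto
  ultimately show ?thesis unfolding is_tetrahedron_def by blast
next
  case False
  define K' where "K' = (K - {{A,b,c},{A,b,d},{A,c,d}}) \<union> {{b,c,d}}"
  note r = sphere_remove[OF K dist star False K'_def]
  have "sphere_move outer K K'"
    by (rule sphere_move.remove[of K K' A b c d]) (use r K dist star False K'_def o in auto)
  then show ?thesis using r o by blast
qed

text \<open>Induction on the degree of \<open>A\<close>: each flip takes away one triangle at
  \<open>A\<close>, until three are left.\<close>

lemma reduce_at:
  assumes "trisphere K" "reducible_at outer K A" "outer \<in> \<Union>K"
  shows "\<exists>K'. (sphere_move outer)\<^sup>*\<^sup>* K K' \<and> outer \<in> \<Union>K' \<and> (is_tetrahedron outer K' \<or> card K' < card K)"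
  using assms
proof (induction "card {t \<in> K. A \<in> t}" arbitrary: K rule: less_induct)
  case less
  note K = less.prems(1) and red = less.prems(2) and o = less.prems(3)
  have tri: "trisphere K''" if "sphere_move outer K K''" for K'' using that by cases auto
  have flip: ?case if h: "distinct [A,B,c,d]" "{A,B,c} \<in> K" "{A,B,d} \<in> K" "{c,d} \<notin> skeleton K"
    "outer \<notin> {A,B,c,d}" for B c d
  proof -
    from reduce_flip[OF K h(1-4) red o h(5)] obtain K' where K': "sphere_move outer K K'" "reducible_at outer K' A"
      "outer \<in> \<Union>K'" "card K' = card K" "card {t \<in> K'. A \<in> t} < card {t \<in> K. A \<in> t}" .
    from less.hyps[OF K'(5) tri[OF K'(1)] K'(2,3)] K'(1,4) show ?thesis
      by (metis converse_rtranclp_into_rtranclp)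
  qed
  have remove: ?case if h: "distinct [A,b,c,d]" "{t \<in> K. A \<in> t} = {{A,b,c},{A,b,d},{A,c,d}}" for b c d
    using reduce_remove[OF K h o] red o unfolding reducible_at_def by (metis r_into_rtranclp rtranclp.rtrancl_refl)
  have A: "A \<in> \<Union>K" "A \<noteq> outer" using red by (auto simp: reducible_at_def)
  show ?case
  proof (cases "{A,outer} \<in> skeleton K")
    case False
    \<comment> \<open>No triangle at \<open>A\<close> contains \<open>outer\<close>, so
      \<open>outer\<close> forbids no flip here.\<close>
    then have far: "outer \<noteq> x" if "{A,y,x} \<in> K \<or> {A,x,y} \<in> K" for x y
      using that A skeletonI[of "{A,y,x}" K A outer] skeletonI[of "{A,x,y}" K A outer] by auto
    obtain t where t: "t \<in> K" "A \<in> t" using A by auto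
    then have "card (t - {A}) = 2" using trisphereD(3,4)[OF K] by simp
    then obtain B1 B2 where B12: "t - {A} = {B1,B2}" "B1 \<noteq> B2" unfolding card_2_iff by blast
    have "t = {A,B1,B2}" "A \<notin> {B1,B2}" using t(2) B12(1) by blast+
    then have t12: "{A,B1,B2} \<in> K" "distinct [A,B1,B2]" using t(1) B12(2) by auto
    from K t12 show ?thesis
    proof (cases rule: triangle_star_cases)
      case (three B0)
      then show ?thesis by (rule remove)
    next
      case (more B0 B3)
      have oo: "outer \<notin> {A,B0,B1,B2,B3}" using A far more t12 by blast
      \<comment> \<open>Two present chords would cross; an absent one is the edge inserted by the
        flip of \<open>{A,B1}\<close> or of \<open>{A,B2}\<close>.\<close>
      consider "{B0,B2} \<notin> skeleton K" | "{B1,B3} \<notin> skeleton K"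
        using chords_do_not_cross[OF K more(1,2) t12(1) more(3)] by blast
      then show ?thesis
      proof cases
        case 1
        show ?thesis by (rule flip[of B1 B0 B2]) (use 1 more t12 oo in \<open>auto simp: insert_commute\<close>)
      next
        case 2
        show ?thesis by (rule flip[of B2 B1 B3]) (use 2 more t12 oo in \<open>auto simp: insert_commute\<close>)
      qed
    qed
  next
    case True
    then have adj: "{B,outer} \<in> skeleton K" if "B \<in> \<Union>K - {outer}" for B
      using red that unfolding reducible_at_def by auto
    \<comment> \<open>The corners around \<open>A\<close> are read from a triangle
      \<open>{A,B1,outer}\<close> on, so that \<open>B0\<close> turns out to be
      \<open>outer\<close>. Its chord to \<open>B2\<close> exists by \<open>adj\<close>; hence the
      chord from \<open>B1\<close> to \<open>B3\<close> is absent, and the flip inserting it avoids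
      \<open>outer\<close>.\<close>
    obtain t where t: "t \<in> K" "A \<in> t" "outer \<in> t" using True by (auto simp: skeleton_def)
    then have "card (t - {A,outer}) = 1" using trisphereD(3,4)[OF K] A by (simp add: card_Diff_subset)
    then obtain B1 where B: "t - {A,outer} = {B1}" by (meson card_1_singletonE)
    have "t = {A,B1,outer}" "B1 \<notin> {A,outer}" using t(2,3) B by blast+
    then have B1: "{A,B1,outer} \<in> K" "B1 \<noteq> A" "B1 \<noteq> outer" using t(1) by auto
    obtain B2 where B2: "{A,B1,B2} \<in> K" "B2 \<noteq> A" "B2 \<noteq> B1" "B2 \<noteq> outer"
      using other_coface[OF K B1(1)] B1 A by auto
    have co: "{t \<in> K. {A,B1} \<subseteq> t} = {{A,B1,outer},{A,B1,B2}}"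
      by (rule cofaces_eq[OF K]) (use B1 B2 A in auto)
    have d3: "distinct [A,B1,B2]" using B1 B2 by auto
    from K B2(1) d3 show ?thesis
    proof (cases rule: triangle_star_cases)
      case (three B0)
      then show ?thesis by (rule remove)
    next
      case (more B0 B3)
      have "{A,B0,B1} \<in> {t \<in> K. {A,B1} \<subseteq> t}" using more by auto
      then have "B0 = outer" unfolding co using more(1) by (auto simp: set_eq_iff)
      moreover have "B2 \<in> \<Union>K" using B2(1) by blast
      ultimately have "{B0,B2} \<in> skeleton K" using adj[of B2] B2(4) by (auto simp: insert_commute)
      then have "{B1,B3} \<notin> skeleton K"
        using chords_do_not_cross[OF K more(1,2) B2(1) more(3)] by blast
      moreover have "outer \<notin> {A,B1,B2,B3}" using more(1) \<open>B0 = outer\<close> by auto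
      ultimately show ?thesis
        by (intro flip[of B2 B1 B3]) (use more B2 in \<open>auto simp: insert_commute\<close>)
    qed
  qed
qed

theorem trisphere_reduces_to_tetrahedron:
  assumes "trisphere K" "outer \<in> \<Union>K"
  shows "\<exists>K'. (sphere_move outer)\<^sup>*\<^sup>* K K' \<and> is_tetrahedron outer K'"
  using assms
proof (induction "card K" arbitrary: K rule: less_induct)
  case less
  note K = less.prems(1) and o = less.prems(2)
  \<comment> \<open>A corner not adjacent to \<open>outer\<close> if there is one; otherwise any
    corner other than \<open>outer\<close> qualifies.\<close>
  obtain A where "reducible_at outer K A"
  proof (cases "\<forall>B\<in>\<Union>K - {outer}. {B,outer} \<in> skeleton K")
    case True
    obtain t where t: "t \<in> K" using trisphereD(2)[OF K] by auto
    have "\<not> t \<subseteq> {outer}" using trisphereD(3)[OF K t] card_mono[of "{outer}" t] by auto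
    then show ?thesis using that t True unfolding reducible_at_def by blast
  next
    case False
    then show ?thesis using that unfolding reducible_at_def by blast
  qed
  from reduce_at[OF K this o] obtain K' where K': "(sphere_move outer)\<^sup>*\<^sup>* K K'" "outer \<in> \<Union>K'"
    "is_tetrahedron outer K' \<or> card K' < card K" by auto
  have "trisphere K'" using K'(1) K by (induction rule: rtranclp_induct) (auto elim: sphere_move.cases)
  then show ?case using less.hyps[of K'] K' by (metis rtranclp_trans)
qed

section \<open>Tropicalised coordinate lines\<close>

lemma poly_mapping_as_sum:
  "f = (\<Sum>a\<in>Poly_Mapping.keys f. Poly_Mapping.single a (Poly_Mapping.lookup f a))"
  by (rule poly_mapping_eqI) (simp add: lookup_sum lookup_single when_def in_keys_iff sum.delta)

lemma lookup_mult_single_right: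
  fixes h :: "('e::ab_group_add) \<Rightarrow>\<^sub>0 ('k::comm_ring_1)"
  shows "Poly_Mapping.lookup (h * Poly_Mapping.single a 1) c = Poly_Mapping.lookup h (c - a)"
proof -
  have "h * Poly_Mapping.single a 1 =
      (\<Sum>b\<in>Poly_Mapping.keys h. Poly_Mapping.single (b + a) (Poly_Mapping.lookup h b))"
    by (subst poly_mapping_as_sum[of h]) (simp add: sum_distrib_right mult_single)
  then have "Poly_Mapping.lookup (h * Poly_Mapping.single a 1) c =
      (\<Sum>b\<in>Poly_Mapping.keys h. if b = c - a then Poly_Mapping.lookup h b else 0)"
    by (simp add: lookup_sum lookup_single when_def eq_diff_eq)
  also have "\<dots> = Poly_Mapping.lookup h (c - a)" by (simp add: sum.delta in_keys_iff)
  finally show ?thesis .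
qed

section \<open>Restriction to torus orbits\<close>

lemma exponent_to_int_add: "exponent_to_int (a + b) = exponent_to_int a + exponent_to_int b"
  unfolding exponent_to_int_def by (rule poly_mapping_eqI) (simp add: lookup_add map.rep_eq when_def)

lemma exponent_to_int_0 [simp]: "exponent_to_int 0 = 0"
  unfolding exponent_to_int_def by (rule poly_mapping_eqI) (simp add: map.rep_eq)

lemma exponent_to_int_single: "exponent_to_int (Poly_Mapping.single i n) = Poly_Mapping.single i (int n)"
  unfolding exponent_to_int_def by (rule poly_mapping_eqI) (simp add: map.rep_eq lookup_single when_def)

lemma keys_exponent_to_int [simp]: "Poly_Mapping.keys (exponent_to_int a) = Poly_Mapping.keys a"
  unfolding exponent_to_int_def by (auto simp: in_keys_iff map.rep_eq when_def split: if_splits)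

lemma keys_add_nat:
  fixes a b :: "'i \<Rightarrow>\<^sub>0 nat"
  shows "Poly_Mapping.keys (a + b) = Poly_Mapping.keys a \<union> Poly_Mapping.keys b"
  by (auto simp: in_keys_iff lookup_add)

text \<open>Terms that vanish on the orbit are kept as zeros. Restriction thus becomes a sum over
  any finite set containing the exponents, and additivity can be checked termwise.\<close>

definition restrict_term :: "'i set \<Rightarrow> ('i \<Rightarrow>\<^sub>0 nat) \<Rightarrow> 'k::comm_ring_1 \<Rightarrow> ('i, 'k) laurent_mpoly" where
  "restrict_term J a c = (if Poly_Mapping.keys a \<subseteq> J then Poly_Mapping.single (exponent_to_int a) c else 0)"

lemma restrict_to_orbit_alt:
  assumes "finite A" "Poly_Mapping.keys f \<subseteq> A"
  shows "restrict_to_orbit J f = (\<Sum>a\<in>A. restrict_term J a (Poly_Mapping.lookup f a))"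
proof -
  have "restrict_to_orbit J f = (\<Sum>a\<in>Poly_Mapping.keys f. restrict_term J a (Poly_Mapping.lookup f a))"
    unfolding restrict_to_orbit_def restrict_term_def by (subst sum.inter_filter[symmetric]) auto
  also have "\<dots> = (\<Sum>a\<in>A. restrict_term J a (Poly_Mapping.lookup f a))"
    by (rule sum.mono_neutral_left) (use assms in \<open>auto simp: in_keys_iff restrict_term_def\<close>)
  finally show ?thesis .
qed

lemma restrict_to_orbit_add: "restrict_to_orbit J (f + g) = restrict_to_orbit J f + restrict_to_orbit J g"
proof -
  let ?A = "Poly_Mapping.keys f \<union> Poly_Mapping.keys g"
  have "restrict_to_orbit J (f + g) = (\<Sum>a\<in>?A. restrict_term J a (Poly_Mapping.lookup (f + g) a))"
    by (rule restrict_to_orbit_alt) (use Poly_Mapping.keys_add[of f g] in auto)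
  also have "\<dots> = (\<Sum>a\<in>?A. restrict_term J a (Poly_Mapping.lookup f a) + restrict_term J a (Poly_Mapping.lookup g a))"
    by (rule sum.cong) (auto simp: restrict_term_def lookup_add single_add)
  also have "\<dots> = restrict_to_orbit J f + restrict_to_orbit J g"
    by (simp add: sum.distrib restrict_to_orbit_alt[of ?A])
  finally show ?thesis .
qed

lemma restrict_to_orbit_0 [simp]: "restrict_to_orbit J 0 = 0"
  by (simp add: restrict_to_orbit_def)

lemma restrict_to_orbit_sum: "restrict_to_orbit J (sum f A) = (\<Sum>x\<in>A. restrict_to_orbit J (f x))"
  by (induction A rule: infinite_finite_induct) (auto simp: restrict_to_orbit_add)

lemma restrict_to_orbit_single: "restrict_to_orbit J (Poly_Mapping.single a c) = restrict_term J a c"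
  by (subst restrict_to_orbit_alt[of "{a}"]) auto

lemma restrict_term_mult: "restrict_term J (a + b) (c * d) = restrict_term J a c * restrict_term J b d"
  by (auto simp: restrict_term_def keys_add_nat mult_single exponent_to_int_add)

lemma restrict_to_orbit_mult: "restrict_to_orbit J (f * g) = restrict_to_orbit J f * restrict_to_orbit J g"
proof -
  have "f * g = (\<Sum>a\<in>Poly_Mapping.keys f. \<Sum>b\<in>Poly_Mapping.keys g.
      Poly_Mapping.single (a + b) (Poly_Mapping.lookup f a * Poly_Mapping.lookup g b))"
    by (subst poly_mapping_as_sum[of f], subst poly_mapping_as_sum[of g])
       (simp add: sum_product mult_single)
  then have "restrict_to_orbit J (f * g) = (\<Sum>a\<in>Poly_Mapping.keys f. \<Sum>b\<in>Poly_Mapping.keys g.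
      restrict_term J a (Poly_Mapping.lookup f a) * restrict_term J b (Poly_Mapping.lookup g b))"
    by (simp add: restrict_to_orbit_sum restrict_to_orbit_single restrict_term_mult)
  then show ?thesis
    by (simp add: sum_product restrict_to_orbit_alt[OF finite_keys order_refl])
qed

text \<open>Setting variables to zero and then passing to Laurent polynomials are both
  homomorphisms; the point is that ideals can be pulled back along the composition.\<close>

lemma restrict_to_orbit_hom:
  "ring_hom_ring (poly_ring I) (laurent_ring J) (restrict_to_orbit J :: ('i, 'k::comm_ring_1) mpoly \<Rightarrow> _)"
proof (rule ring_hom_ringI)
  show "ring (poly_ring I :: ('i, 'k) mpoly ring)" "ring (laurent_ring J :: ('i, 'k) laurent_mpoly ring)"
    unfolding poly_ring_def laurent_ring_def by (intro cring.axioms(1) cring_var_ring)+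
  have "Poly_Mapping.keys a \<subseteq> J" if a: "a \<in> Poly_Mapping.keys (restrict_to_orbit J f)" for f :: "('i, 'k) mpoly" and a
  proof -
    have "Poly_Mapping.keys (restrict_to_orbit J f) \<subseteq>
       (\<Union>b\<in>{a \<in> Poly_Mapping.keys f. Poly_Mapping.keys a \<subseteq> J}.
         Poly_Mapping.keys (Poly_Mapping.single (exponent_to_int b) (Poly_Mapping.lookup f b)))"
      unfolding restrict_to_orbit_def by (rule Poly_Mapping.keys_sum)
    then obtain b where "Poly_Mapping.keys b \<subseteq> J"
      "a \<in> Poly_Mapping.keys (Poly_Mapping.single (exponent_to_int b) (Poly_Mapping.lookup f b))"
      using a by blast
    then show ?thesis by (auto split: if_splits)
  qed
  then show "restrict_to_orbit J f \<in> carrier (laurent_ring J)" for f :: "('i, 'k) mpoly"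
    by (auto simp: laurent_ring_def var_ring_def)
  have one: "restrict_to_orbit J (1 :: ('i, 'k) mpoly) = 1"
    using restrict_to_orbit_single[of J 0 "1::'k"] by (simp add: restrict_term_def)
  show "restrict_to_orbit J (\<one>\<^bsub>poly_ring I\<^esub> :: ('i, 'k) mpoly) = \<one>\<^bsub>laurent_ring J\<^esub>"
    using one by (simp add: poly_ring_def laurent_ring_def var_ring_def)
qed (simp_all add: poly_ring_def laurent_ring_def var_ring_def restrict_to_orbit_add restrict_to_orbit_mult)

text \<open>The preimage of the principal ideal of \<open>g\<close> is an ideal containing the
  generators, so checking the generators settles the whole restricted ideal.\<close>

lemma orbit_ideal_principal:
  fixes gens :: "('i, 'k::comm_ring_1) mpoly set"
  assumes "gens \<subseteq> carrier (poly_ring I)" "g \<in> carrier (laurent_ring J)"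
    and "\<And>s. s \<in> gens \<Longrightarrow> \<exists>h\<in>carrier (laurent_ring J). restrict_to_orbit J s = h * g"
    and f: "f \<in> Idl\<^bsub>laurent_ring J\<^esub> (restrict_to_orbit J ` (Idl\<^bsub>poly_ring I\<^esub> gens))"
  shows "\<exists>h\<in>carrier (laurent_ring J). f = h * g"
proof -
  interpret hom: ring_hom_ring "poly_ring I" "laurent_ring J" "restrict_to_orbit J :: ('i, 'k) mpoly \<Rightarrow> _"
    by (rule restrict_to_orbit_hom)
  interpret L: cring "laurent_ring J :: ('i, 'k) laurent_mpoly ring"
    unfolding laurent_ring_def by (rule cring_var_ring)
  define P where "P = PIdl\<^bsub>laurent_ring J\<^esub> g"
  have P: "P = {h * g | h. h \<in> carrier (laurent_ring J)}"
    unfolding P_def cgenideal_def by (simp add: laurent_ring_def var_ring_def)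
  have idP: "ideal P (laurent_ring J)" unfolding P_def by (rule L.cgenideal_ideal) fact
  have "Idl\<^bsub>poly_ring I\<^esub> gens \<subseteq> {r \<in> carrier (poly_ring I). restrict_to_orbit J r \<in> P}"
    by (rule hom.R.genideal_minimal[OF hom.ideal_vimage[OF idP]]) (use assms(1,3) P in blast)
  then have "Idl\<^bsub>laurent_ring J\<^esub> (restrict_to_orbit J ` (Idl\<^bsub>poly_ring I\<^esub> gens)) \<subseteq> P"
    by (intro hom.S.genideal_minimal idP) auto
  then show ?thesis using f P by auto
qed

lemma orbit_ideal_mem:
  fixes gens :: "('i, 'k::comm_ring_1) mpoly set"
  assumes "gens \<subseteq> carrier (poly_ring I)" "s \<in> gens"
  shows "restrict_to_orbit J s \<in> Idl\<^bsub>laurent_ring J\<^esub> (restrict_to_orbit J ` (Idl\<^bsub>poly_ring I\<^esub> gens))"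
proof -
  interpret hom: ring_hom_ring "poly_ring I" "laurent_ring J" "restrict_to_orbit J :: ('i, 'k) mpoly \<Rightarrow> _"
    by (rule restrict_to_orbit_hom)
  have 1: "gens \<subseteq> Idl\<^bsub>poly_ring I\<^esub> gens" by (rule hom.R.genideal_self) fact
  have "Idl\<^bsub>poly_ring I\<^esub> gens \<subseteq> carrier (poly_ring I)"
    using additive_subgroup.a_subset[OF ideal.axioms(1)[OF hom.R.genideal_ideal[OF assms(1)]]] .
  then have "restrict_to_orbit J ` (Idl\<^bsub>poly_ring I\<^esub> gens) \<subseteq> carrier (laurent_ring J)"
    using hom.hom_closed by blast
  from hom.S.genideal_self[OF this] show ?thesis using 1 assms(2) by blast
qed

lemma linear_form_carrier: "linear_form I c \<in> carrier (poly_ring I)"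
proof -
  have "Poly_Mapping.keys a \<subseteq> I" if "a \<in> Poly_Mapping.keys (linear_form I c)" for a
  proof -
    have "Poly_Mapping.keys (linear_form I c) \<subseteq>
       (\<Union>i\<in>I. Poly_Mapping.keys (Poly_Mapping.single (Poly_Mapping.single i (1::nat)) (c i)))"
      unfolding linear_form_def by (rule Poly_Mapping.keys_sum)
    then show ?thesis using that by (auto split: if_splits)
  qed
  then show ?thesis by (auto simp: poly_ring_def var_ring_def)
qed

lemma restrict_linear_form:
  assumes "finite I" "J \<subseteq> I"
  shows "restrict_to_orbit J (linear_form I c) =
     (\<Sum>i\<in>J. Poly_Mapping.single (Poly_Mapping.single i 1) (c i))"
proof -
  have "restrict_to_orbit J (linear_form I c) =
     (\<Sum>i\<in>I. if i \<in> J then Poly_Mapping.single (Poly_Mapping.single i 1) (c i) else 0)"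
    unfolding linear_form_def restrict_to_orbit_sum restrict_to_orbit_single restrict_term_def
    by (rule sum.cong) (auto simp: exponent_to_int_single)
  also have "\<dots> = (\<Sum>i\<in>{i \<in> I. i \<in> J}. Poly_Mapping.single (Poly_Mapping.single i 1) (c i))"
    by (rule sum.inter_filter[symmetric]) fact
  also have "{i \<in> I. i \<in> J} = J" using assms by auto
  finally show ?thesis .
qed

section \<open>Valuations and initial terms\<close>

context
  fixes val :: "'k::field \<Rightarrow> ereal"
  assumes val: "field_valuation val"
begin

lemma val_0: "val 0 = \<infinity>" and val_finite: "x \<noteq> 0 \<Longrightarrow> \<exists>r. val x = ereal r"
proof -
  show "val 0 = \<infinity>" using val by (auto simp: field_valuation_def)
  assume "x \<noteq> 0"
  then have "val x \<noteq> \<infinity>" "val x \<noteq> -\<infinity>" using val by (auto simp: field_valuation_def)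
  then show "\<exists>r. val x = ereal r" by (cases "val x") auto
qed

lemma val_mult: "val (x * y) = val x + val y" and val_add: "min (val x) (val y) \<le> val (x + y)"
  using val by (auto simp: field_valuation_def)

lemma val_1: "val 1 = 0"
proof -
  obtain r where "val 1 = ereal r" using val_finite[of 1] by auto
  then show ?thesis using val_mult[of 1 1] by simp
qed

lemma val_minus: "val (- x) = val x"
proof -
  obtain r where r: "val (- 1) = ereal r" using val_finite[of "-1"] by auto
  then have "val (- 1) = 0" using val_mult[of "-1" "-1"] val_1 by simp
  then show ?thesis using val_mult[of "-1" x] by simp
qed

lemma val_sum_ge: "(\<And>k. k \<in> A \<Longrightarrow> ereal t \<le> val (f k)) \<Longrightarrow> ereal t \<le> val (sum f A)"
proof (induction A rule: infinite_finite_induct)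
  case (insert x F)
  then show ?case using val_add[of "f x" "sum f F"] by (auto simp: min_le_iff_disj intro: order_trans)
qed (auto simp: val_0)

lemma val_sum_gt: "(\<And>k. k \<in> A \<Longrightarrow> ereal t < val (f k)) \<Longrightarrow> ereal t < val (sum f A)"
proof (induction A rule: infinite_finite_induct)
  case (insert x F)
  then have "ereal t < min (val (f x)) (val (sum f F))" by simp
  from less_le_trans[OF this val_add] show ?case using insert.hyps by simp
qed (auto simp: val_0)

lemma val_add_dominant:
  assumes "val x < val y"
  shows "val (x + y) = val x"
proof (rule antisym)
  show "val x \<le> val (x + y)" using val_add[of x y] assms by auto
  show "val (x + y) \<le> val x"
    using val_add[of "x + y" "- y"] assms by (auto simp: val_minus min_def split: if_splits)
qed

definition weight :: "'i set \<Rightarrow> ('i \<Rightarrow> real) \<Rightarrow> ('i \<Rightarrow>\<^sub>0 int) \<Rightarrow> real" where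
  "weight J w a = (\<Sum>i\<in>J. w i * of_int (Poly_Mapping.lookup a i))"

lemma weight_add: "weight J w (a + b) = weight J w a + weight J w b"
  by (simp add: weight_def lookup_add distrib_left sum.distrib)

lemma weight_single: "finite J \<Longrightarrow> k \<in> J \<Longrightarrow> weight J w (Poly_Mapping.single k 1) = w k"
proof -
  assume "finite J" "k \<in> J"
  have "weight J w (Poly_Mapping.single k 1) = (\<Sum>i\<in>J. if i = k then w i else 0)"
    unfolding weight_def by (rule sum.cong) (auto simp: lookup_single when_def)
  then show ?thesis using \<open>finite J\<close> \<open>k \<in> J\<close> by simp
qed

lemma term_weight_alt: "term_weight val J w f a = val (Poly_Mapping.lookup f a) + ereal (weight J w a)"
  by (simp add: term_weight_def weight_def)

text \<open>Among the terms of \<open>h\<close> of minimal weight, those for which the difference of the exponents of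
  \<open>x i\<close> and \<open>x j\<close> is extremal produce terms of \<open>h * (\<Sum>k\<in>J. x k)\<close> that cannot cancel.\<close>

lemma extremal_term_survives:
  fixes h :: "('i, 'k) laurent_mpoly"
  assumes J: "finite J" "i \<in> J" and wi: "\<And>k. k \<in> J \<Longrightarrow> w i \<le> w k"
    and a: "a \<in> Poly_Mapping.keys h" "val (Poly_Mapping.lookup h a) + ereal (weight J w a) = ereal m"
    and low: "\<And>b. ereal m \<le> val (Poly_Mapping.lookup h b) + ereal (weight J w b)"
    and ext: "\<And>k. k \<in> J \<Longrightarrow> k \<noteq> i \<Longrightarrow> w k = w i \<Longrightarrow>
       val (Poly_Mapping.lookup h (a + Poly_Mapping.single i 1 - Poly_Mapping.single k 1)) +
       ereal (weight J w (a + Poly_Mapping.single i 1 - Poly_Mapping.single k 1)) \<noteq> ereal m"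
    and f: "f = h * (\<Sum>k\<in>J. Poly_Mapping.single (Poly_Mapping.single k 1) 1)"
  shows "term_weight val J w f (a + Poly_Mapping.single i 1) = ereal (m + w i)"
proof -
  let ?e = "\<lambda>k. Poly_Mapping.single k (1::int)"
  define c where "c = a + ?e i"
  have look: "Poly_Mapping.lookup f c = (\<Sum>k\<in>J. Poly_Mapping.lookup h (c - ?e k))"
    unfolding f by (simp add: sum_distrib_left lookup_sum lookup_mult_single_right)
  also have "\<dots> = Poly_Mapping.lookup h a + (\<Sum>k\<in>J - {i}. Poly_Mapping.lookup h (c - ?e k))"
    using J by (simp add: sum.remove[of J i] c_def)
  finally have look: "Poly_Mapping.lookup f c =
     Poly_Mapping.lookup h a + (\<Sum>k\<in>J - {i}. Poly_Mapping.lookup h (c - ?e k))" .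
  obtain r where r: "val (Poly_Mapping.lookup h a) = ereal r" using a(1) val_finite by (auto simp: in_keys_iff)
  then have rm: "r + weight J w a = m" using a(2) by simp
  have wc: "weight J w c = weight J w a + w i" using J by (simp add: c_def weight_add weight_single)
  \<comment> \<open>The other contributions to this coefficient come from the exponents
    \<open>c - ?e k\<close>. They have larger valuation, either because \<open>w k\<close> exceeds
    \<open>w i\<close> or, for equal weights, because \<open>ext\<close> keeps this exponent away
    from the minimal terms of \<open>h\<close>.\<close>
  have "ereal r < val (\<Sum>k\<in>J - {i}. Poly_Mapping.lookup h (c - ?e k))"
  proof (rule val_sum_gt)
    fix k assume k: "k \<in> J - {i}"
    define b where "b = c - ?e k"
    have wb: "weight J w b + w k = weight J w c"
      using weight_add[of J w b "?e k"] k J by (simp add: b_def weight_single)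
    show "ereal r < val (Poly_Mapping.lookup h (c - ?e k))"
    proof (cases "val (Poly_Mapping.lookup h b)")
      case (real s)
      have "m \<le> s + weight J w b" using low[of b] real by simp
      moreover have "m \<noteq> s + weight J w b" if "w k = w i"
        using ext[of k] k that real by (simp add: b_def c_def)
      ultimately have "r < s" using wi[of k] k wb wc rm by (cases "w k = w i") auto
      then show ?thesis using real by (simp add: b_def)
    next
      case PInf then show ?thesis by (simp add: b_def)
    next
      case MInf then show ?thesis using low[of b] by simp
    qed
  qed
  then have "val (Poly_Mapping.lookup f c) = ereal r"
    unfolding look using val_add_dominant r by metis
  then show ?thesis using wc rm by (simp add: term_weight_alt c_def)
qed

text \<open>The initial form of a product is the product of the initial forms, and a multiple of a
  form with at least two terms is not a monomial. The two witnesses sit at opposite ends of the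
  exponent difference between \<open>i\<close> and \<open>j\<close>.\<close>

lemma min_attained_twice_multiple:
  fixes h :: "('i, 'k) laurent_mpoly"
  assumes J: "finite J" "i \<in> J" "j \<in> J" "i \<noteq> j" and w: "w i = w j" "\<And>k. k \<in> J \<Longrightarrow> w i \<le> w k"
    and f: "f = h * (\<Sum>k\<in>J. Poly_Mapping.single (Poly_Mapping.single k 1) 1)" "f \<noteq> 0"
  shows "min_attained_twice val J w f"
proof -
  let ?e = "\<lambda>k. Poly_Mapping.single k (1::int)"
  let ?W = "\<lambda>b. val (Poly_Mapping.lookup h b) + ereal (weight J w b)"
  have "h \<noteq> 0" using f by auto
  then have ne: "Poly_Mapping.keys h \<noteq> {}" by (metis keys_eq_empty)
  define m where "m = Min (real_of_ereal ` ?W ` Poly_Mapping.keys h)"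
  have real: "?W b = ereal (real_of_ereal (?W b))" if "b \<in> Poly_Mapping.keys h" for b
    using that val_finite[of "Poly_Mapping.lookup h b"] by (auto simp: in_keys_iff)
  have low: "ereal m \<le> ?W b" for b
  proof (cases "b \<in> Poly_Mapping.keys h")
    case True
    then have "m \<le> real_of_ereal (?W b)" unfolding m_def by (intro Min_le) auto
    then show ?thesis using real[OF True] by (metis ereal_less_eq(3))
  qed (simp add: in_keys_iff val_0)
  define M where "M = {b \<in> Poly_Mapping.keys h. ?W b = ereal m}"
  have "m \<in> real_of_ereal ` ?W ` Poly_Mapping.keys h" unfolding m_def using ne by (intro Min_in) auto
  then have "M \<noteq> {}" using real unfolding M_def by fastforce
  have finM: "finite M" by (simp add: M_def)
  have WM: "b \<in> M" if "?W b = ereal m" for b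
    using that by (auto simp: M_def in_keys_iff val_0)
  \<comment> \<open>Multiplication by \<open>x i\<close> raises \<open>\<psi>\<close>, by
    \<open>x j\<close> lowers it, and any other variable leaves it unchanged. So a
    \<open>\<psi>\<close>-maximal term of \<open>M\<close> times \<open>x i\<close>, or a
    \<open>\<psi>\<close>-minimal one times \<open>x j\<close>, arises from \<open>M\<close> in one
    way only.\<close>
  define \<psi> where "\<psi> b = Poly_Mapping.lookup b i - Poly_Mapping.lookup b j" for b :: "'i \<Rightarrow>\<^sub>0 int"
  have "Max (\<psi> ` M) \<in> \<psi> ` M" "Min (\<psi> ` M) \<in> \<psi> ` M" using finM \<open>M \<noteq> {}\<close> by simp_all
  then obtain a a' where aa: "a \<in> M" "\<psi> a = Max (\<psi> ` M)" "a' \<in> M" "\<psi> a' = Min (\<psi> ` M)" by auto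
  have a: "a \<in> M" "\<And>b. b \<in> M \<Longrightarrow> \<psi> b \<le> \<psi> a" using aa finM by auto
  have a': "a' \<in> M" "\<And>b. b \<in> M \<Longrightarrow> \<psi> a' \<le> \<psi> b" using aa finM by auto
  have 1: "term_weight val J w f (a + ?e i) = ereal (m + w i)"
  proof (rule extremal_term_survives[OF J(1,2) w(2) _ _ low _ f(1)])
    show "a \<in> Poly_Mapping.keys h" "?W a = ereal m" using a by (auto simp: M_def)
    fix k assume k: "k \<in> J" "k \<noteq> i"
    then have "\<psi> (a + ?e i - ?e k) > \<psi> a" using J(4) by (auto simp: \<psi>_def lookup_add lookup_minus lookup_single when_def)
    then have "a + ?e i - ?e k \<notin> M" using a(2) by (metis not_le)
    then show "?W (a + ?e i - ?e k) \<noteq> ereal m" using WM by blast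
  qed
  have 2: "term_weight val J w f (a' + ?e j) = ereal (m + w j)"
  proof (rule extremal_term_survives[OF J(1,3) _ _ _ low _ f(1)])
    show "w j \<le> w k" if "k \<in> J" for k using w that by simp
    show "a' \<in> Poly_Mapping.keys h" "?W a' = ereal m" using a' by (auto simp: M_def)
    fix k assume k: "k \<in> J" "k \<noteq> j"
    then have "\<psi> (a' + ?e j - ?e k) < \<psi> a'" using J(4) by (auto simp: \<psi>_def lookup_add lookup_minus lookup_single when_def)
    then have "a' + ?e j - ?e k \<notin> M" using a'(2) by (metis not_le)
    then show "?W (a' + ?e j - ?e k) \<noteq> ereal m" using WM by blast
  qed
  have low_f: "ereal (m + w i) \<le> term_weight val J w f c" for c
  proof -
    have look: "Poly_Mapping.lookup f c = (\<Sum>k\<in>J. Poly_Mapping.lookup h (c - ?e k))"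
      unfolding f by (simp add: sum_distrib_left lookup_sum lookup_mult_single_right)
    have "ereal (m + w i - weight J w c) \<le> val (Poly_Mapping.lookup f c)"
      unfolding look
    proof (rule val_sum_ge)
      fix k assume k: "k \<in> J"
      have wb: "weight J w (c - ?e k) + w k = weight J w c"
        using weight_add[of J w "c - ?e k" "?e k"] k J by (simp add: weight_single)
      show "ereal (m + w i - weight J w c) \<le> val (Poly_Mapping.lookup h (c - ?e k))"
        using low[of "c - ?e k"] w(2)[OF k] wb
        by (cases "val (Poly_Mapping.lookup h (c - ?e k))") auto
    qed
    then show ?thesis unfolding term_weight_alt
      by (cases "val (Poly_Mapping.lookup f c)") auto
  qed
  have keyI: "c \<in> Poly_Mapping.keys f" if "term_weight val J w f c = ereal r" for c r
    using that by (auto simp: term_weight_alt in_keys_iff val_0)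
  \<comment> \<open>The values are the maximum plus one and the minimum minus one.\<close>
  have "\<psi> (a + ?e i) \<noteq> \<psi> (a' + ?e j)"
    using a(2)[OF a'(1)] J(4) by (auto simp: \<psi>_def lookup_add lookup_single when_def)
  then have "a + ?e i \<noteq> a' + ?e j" by auto
  then show ?thesis
    unfolding min_attained_twice_def using keyI[OF 1] keyI[OF 2] 1 2 w(1) low_f by metis
qed

lemma not_min_attained_twice_single: "\<not> min_attained_twice val J w (Poly_Mapping.single a c)"
  by (auto simp: min_attained_twice_def split: if_splits)

lemma tp_class_shift: "tp_class (\<lambda>i. w i + ereal c) = tp_class w"
proof -
  have "(\<lambda>i. w i + ereal c + ereal d) = (\<lambda>i. w i + ereal (c + d))" for d
    by (simp add: add.assoc)
  moreover have "(\<lambda>i. w i + ereal d) = (\<lambda>i. w i + ereal c + ereal (d - c))" for d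
    by (simp add: add.assoc)
  ultimately show ?thesis unfolding tp_class_def by blast
qed

text \<open>On an orbit where some coordinate \<open>l\<close> outside \<open>D\<close> is finite,
  the restricted ideal contains the monomial \<open>x l\<close>, whose minimum is attained once; so
  only orbits inside the face \<open>D\<close> contribute.\<close>

lemma tropproj_orbits:
  fixes gens :: "('i, 'k) mpoly set"
  assumes I: "finite I" "D \<subseteq> I"
    and lin: "\<And>s. s \<in> gens \<Longrightarrow> \<exists>c. s = linear_form I c"
    and out: "\<And>l. l \<in> I - D \<Longrightarrow> linear_form I (\<lambda>i. if i = l then 1 else 0) \<in> gens"
    and orb: "\<And>J w. J \<subseteq> D \<Longrightarrow> J \<noteq> {} \<Longrightarrow>
       (\<forall>f\<in>Idl\<^bsub>laurent_ring J\<^esub> (restrict_to_orbit J ` (Idl\<^bsub>poly_ring I\<^esub> gens)).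
          f \<noteq> 0 \<longrightarrow> min_attained_twice val J w f) \<longleftrightarrow> Q J w"
  shows "tropproj val I (Idl\<^bsub>poly_ring I\<^esub> gens) =
     {tp_class (\<lambda>i. if i \<in> J then ereal (w i) else \<infinity>) | J w. J \<subseteq> D \<and> J \<noteq> {} \<and> Q J w}"
proof -
  have sub: "gens \<subseteq> carrier (poly_ring I)" using lin linear_form_carrier by blast
  have no: "\<not> (\<forall>f\<in>Idl\<^bsub>laurent_ring J\<^esub> (restrict_to_orbit J ` (Idl\<^bsub>poly_ring I\<^esub> gens)).
          f \<noteq> 0 \<longrightarrow> min_attained_twice val J w f)" if J: "J \<subseteq> I" "\<not> J \<subseteq> D" for J w
  proof -
    obtain l where l: "l \<in> J" "l \<in> I - D" using J by auto
    have "finite J" using J I finite_subset by auto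
    have "restrict_to_orbit J (linear_form I (\<lambda>i. if i = l then 1 else (0::'k))) =
       (\<Sum>i\<in>J. if i = l then Poly_Mapping.single (Poly_Mapping.single i 1) 1 else 0)"
      unfolding restrict_linear_form[OF I(1) J(1)] by (rule sum.cong) auto
    also have "\<dots> = Poly_Mapping.single (Poly_Mapping.single l 1) 1" using l \<open>finite J\<close> by (simp add: sum.delta)
    finally have "Poly_Mapping.single (Poly_Mapping.single l 1) 1 \<in>
        Idl\<^bsub>laurent_ring J\<^esub> (restrict_to_orbit J ` (Idl\<^bsub>poly_ring I\<^esub> gens))"
      using orbit_ideal_mem[OF sub out[OF l(2)], of J] by simp
    moreover have "Poly_Mapping.single (Poly_Mapping.single l (1::int)) (1::'k) \<noteq> 0"
      by (metis lookup_single_eq lookup_zero zero_neq_one)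
    ultimately show ?thesis using not_min_attained_twice_single by blast
  qed
  show ?thesis
    unfolding tropproj_def
  proof (intro equalityI subsetI, goal_cases)
    case (1 p)
    then obtain J w where J: "J \<subseteq> I" "J \<noteq> {}" "p = tp_class (\<lambda>i. if i \<in> J then ereal (w i) else \<infinity>)"
      "\<forall>f\<in>Idl\<^bsub>laurent_ring J\<^esub> (restrict_to_orbit J ` (Idl\<^bsub>poly_ring I\<^esub> gens)).
          f \<noteq> 0 \<longrightarrow> min_attained_twice val J w f" by blast
    moreover have "J \<subseteq> D" using no J(1,4) by blast
    ultimately have "Q J w" using orb[of J w] by simp
    then show ?case using J(2,3) \<open>J \<subseteq> D\<close> by blast
  next
    case (2 p)
    then obtain J w where J: "J \<subseteq> D" "J \<noteq> {}" "Q J w" "p = tp_class (\<lambda>i. if i \<in> J then ereal (w i) else \<infinity>)"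
      by blast
    have "\<forall>f\<in>Idl\<^bsub>laurent_ring J\<^esub> (restrict_to_orbit J ` (Idl\<^bsub>poly_ring I\<^esub> gens)).
          f \<noteq> 0 \<longrightarrow> min_attained_twice val J w f" using orb[OF J(1,2)] J(3) by simp
    then show ?case using J(1,2,4) I(2) by (intro UN_I[of J] CollectI exI[of _ w] conjI) auto
  qed
qed

text \<open>On the orbit \<open>J\<close> the ideal becomes principal, generated by the sum of the
  variables in \<open>J\<close>, so the condition is that the least weight is attained twice on
  \<open>J\<close>. Asking the generators for constant coefficients on \<open>D\<close> covers both
  the ideal of an interior vertex and the ideal of all linear forms vanishing at two points.\<close>

lemma tropproj_face:
  fixes gens :: "('i, 'k) mpoly set"
  assumes I: "finite I" "D \<subseteq> I" and D: "card D = 3"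
    and lin: "\<And>s. s \<in> gens \<Longrightarrow> \<exists>c r. s = linear_form I c \<and> (\<forall>i\<in>D. c i = r)"
    and out: "\<And>l. l \<in> I - D \<Longrightarrow> linear_form I (\<lambda>i. if i = l then 1 else 0) \<in> gens"
    and main: "linear_form I (\<lambda>i. if i \<in> D then 1 else 0) \<in> gens"
  shows "tropproj val I (Idl\<^bsub>poly_ring I\<^esub> gens) = standard_line D"
proof -
  define Q where "Q J w \<longleftrightarrow> (\<exists>i\<in>J. \<exists>j\<in>J. i \<noteq> j \<and> w i = w j \<and> (\<forall>k\<in>J. w i \<le> w k))" for J and w :: "'i \<Rightarrow> real"
  have sub: "gens \<subseteq> carrier (poly_ring I)" using lin linear_form_carrier by blast
  have "finite D" using D card.infinite by fastforce
  have *: "tropproj val I (Idl\<^bsub>poly_ring I\<^esub> gens) =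
     {tp_class (\<lambda>i. if i \<in> J then ereal (w i) else \<infinity>) | J w. J \<subseteq> D \<and> J \<noteq> {} \<and> Q J w}"
  proof (rule tropproj_orbits[OF I _ out])
    show "\<exists>c. s = linear_form I c" if "s \<in> gens" for s using lin[OF that] by blast
    fix J and w :: "'i \<Rightarrow> real" assume J: "J \<subseteq> D" "J \<noteq> {}"
    then have JI: "J \<subseteq> I" using I by auto
    then have finJ: "finite J" using I(1) by (rule finite_subset)
    define g :: "('i, 'k) laurent_mpoly" where "g = (\<Sum>k\<in>J. Poly_Mapping.single (Poly_Mapping.single k 1) 1)"
    have "Poly_Mapping.keys g \<subseteq> (\<Union>k\<in>J. Poly_Mapping.keys (Poly_Mapping.single (Poly_Mapping.single k (1::int)) (1::'k)))"
      unfolding g_def by (rule Poly_Mapping.keys_sum)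
    then have keys_g: "Poly_Mapping.keys g \<subseteq> (\<lambda>k. Poly_Mapping.single k 1) ` J" by auto
    then have g: "g \<in> carrier (laurent_ring J)" by (auto simp: laurent_ring_def var_ring_def)
    have gmem: "g \<in> Idl\<^bsub>laurent_ring J\<^esub> (restrict_to_orbit J ` (Idl\<^bsub>poly_ring I\<^esub> gens))"
    proof -
      have "restrict_to_orbit J (linear_form I (\<lambda>i. if i \<in> D then 1 else (0::'k))) = g"
        unfolding restrict_linear_form[OF I(1) JI] g_def by (rule sum.cong) (use J in auto)
      then show ?thesis using orbit_ideal_mem[OF sub main, of J] by simp
    qed
    have look_g: "Poly_Mapping.lookup g (Poly_Mapping.single k 1) = 1" if "k \<in> J" for k
    proof -
      have "Poly_Mapping.lookup g (Poly_Mapping.single k 1) = (\<Sum>l\<in>J. if l = k then 1 else 0)"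
        unfolding g_def lookup_sum lookup_single when_def
        by (rule sum.cong) (auto dest: fun_cong simp: poly_mapping_eq_iff fun_eq_iff lookup_single when_def split: if_splits)
      then show ?thesis using that finJ by simp
    qed
    show "(\<forall>f\<in>Idl\<^bsub>laurent_ring J\<^esub> (restrict_to_orbit J ` (Idl\<^bsub>poly_ring I\<^esub> gens)).
          f \<noteq> 0 \<longrightarrow> min_attained_twice val J w f) \<longleftrightarrow> Q J w"
    proof
      assume "\<forall>f\<in>Idl\<^bsub>laurent_ring J\<^esub> (restrict_to_orbit J ` (Idl\<^bsub>poly_ring I\<^esub> gens)).
          f \<noteq> 0 \<longrightarrow> min_attained_twice val J w f"
      moreover have "g \<noteq> 0" using look_g J by (metis all_not_in_conv lookup_zero zero_neq_one)
      ultimately have "min_attained_twice val J w g" using gmem by blast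
      then obtain a b where ab: "a \<in> Poly_Mapping.keys g" "b \<in> Poly_Mapping.keys g" "a \<noteq> b"
        "term_weight val J w g a = term_weight val J w g b"
        "\<forall>c\<in>Poly_Mapping.keys g. term_weight val J w g a \<le> term_weight val J w g c"
        unfolding min_attained_twice_def by blast
      obtain i j where ij: "i \<in> J" "j \<in> J" "a = Poly_Mapping.single i 1" "b = Poly_Mapping.single j 1"
        using ab(1,2) keys_g by blast
      have tw: "term_weight val J w g (Poly_Mapping.single k 1) = ereal (w k)" if "k \<in> J" for k
        using look_g[OF that] that finJ by (simp add: term_weight_alt val_1 weight_single)
      have "w i = w j" using ab(4) tw ij by simp
      moreover have "w i \<le> w k" if "k \<in> J" for k
      proof -
        have "Poly_Mapping.single k 1 \<in> Poly_Mapping.keys g" using look_g[OF that] by (simp add: in_keys_iff)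
        then have "term_weight val J w g a \<le> term_weight val J w g (Poly_Mapping.single k 1)" using ab(5) by blast
        then show ?thesis using tw[OF that] tw[OF ij(1)] ij(3) by simp
      qed
      moreover have "i \<noteq> j" using ab(3) ij by auto
      ultimately show "Q J w" unfolding Q_def using ij by blast
    next
      assume "Q J w"
      then obtain i j where ij: "i \<in> J" "j \<in> J" "i \<noteq> j" "w i = w j" "\<And>k. k \<in> J \<Longrightarrow> w i \<le> w k"
        unfolding Q_def by blast
      show "\<forall>f\<in>Idl\<^bsub>laurent_ring J\<^esub> (restrict_to_orbit J ` (Idl\<^bsub>poly_ring I\<^esub> gens)).
          f \<noteq> 0 \<longrightarrow> min_attained_twice val J w f"
      proof (intro ballI impI)
        fix f assume f: "f \<in> Idl\<^bsub>laurent_ring J\<^esub> (restrict_to_orbit J ` (Idl\<^bsub>poly_ring I\<^esub> gens))" "f \<noteq> 0"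
        have "\<exists>h\<in>carrier (laurent_ring J). f = h * g"
        proof (rule orbit_ideal_principal[OF sub g _ f(1)])
          fix s assume "s \<in> gens"
          then obtain c r where c: "s = linear_form I c" "\<forall>i\<in>D. c i = r" using lin by blast
          have "restrict_to_orbit J s = (\<Sum>k\<in>J. Poly_Mapping.single 0 r * Poly_Mapping.single (Poly_Mapping.single k 1) 1)"
            unfolding c(1) restrict_linear_form[OF I(1) JI] by (rule sum.cong) (use c(2) J in \<open>auto simp: mult_single\<close>)
          then have "restrict_to_orbit J s = Poly_Mapping.single 0 r * g" by (simp add: g_def sum_distrib_left)
          moreover have "Poly_Mapping.single 0 r \<in> carrier (laurent_ring J :: ('i, 'k) laurent_mpoly ring)"
            by (auto simp: laurent_ring_def var_ring_def split: if_splits)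
          ultimately show "\<exists>h\<in>carrier (laurent_ring J). restrict_to_orbit J s = h * g" by blast
        qed
        then obtain h where "f = h * g" by blast
        then show "min_attained_twice val J w f"
          using min_attained_twice_multiple[OF finJ ij(1,2,3,4,5)] f(2) unfolding g_def by blast
      qed
    qed
  qed
  show ?thesis unfolding *
  proof (intro equalityI subsetI)
    fix p assume "p \<in> {tp_class (\<lambda>i. if i \<in> J then ereal (w i) else \<infinity>) | J w. J \<subseteq> D \<and> J \<noteq> {} \<and> Q J w}"
    then obtain J w where J: "J \<subseteq> D" "Q J w" "p = tp_class (\<lambda>i. if i \<in> J then ereal (w i) else \<infinity>)" by blast
    then obtain i j where ij: "i \<in> J" "j \<in> J" "i \<noteq> j" "w i = w j" "\<And>k. k \<in> J \<Longrightarrow> w i \<le> w k"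
      unfolding Q_def by blast
    have "card (D - {i,j}) = 1" using D ij J(1) \<open>finite D\<close> by (subst card_Diff_subset) auto
    then obtain k where k: "D - {i,j} = {k}" by (meson card_1_singletonE)
    \<comment> \<open>Once the two least weights are normalised to 0, \<open>c\<close> is the
      coordinate of the third corner, infinite if this corner lies outside the orbit.\<close>
    define c where "c = (if k \<in> J then ereal (w k - w i) else \<infinity>)"
    have "p = tp_class (\<lambda>l. (if l \<in> J then ereal (w l) else \<infinity>) + ereal (- w i))"
      unfolding J(3) tp_class_shift ..
    also have "(\<lambda>l. (if l \<in> J then ereal (w l) else \<infinity>) + ereal (- w i)) =
       (\<lambda>l. if l \<in> {i,j} then 0 else if l \<in> D then c else \<infinity>)"
    proof
      fix l
      have "l = k" if "l \<in> D" "l \<notin> {i,j}" using k that by blast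
      then show "(if l \<in> J then ereal (w l) else \<infinity>) + ereal (- w i) =
        (if l \<in> {i,j} then 0 else if l \<in> D then c else \<infinity>)"
        using ij J(1) by (auto simp: c_def)
    qed
    finally have p: "p = tp_class (\<lambda>l. if l \<in> {i,j} then 0 else if l \<in> D then c else \<infinity>)" .
    have "0 \<le> c" using ij(5) by (auto simp: c_def)
    then have "p \<in> ray_to_marked_point D {i,j}" unfolding ray_to_marked_point_def p by blast
    moreover have "{i,j} \<subseteq> D" "card {i,j} = 2" using ij J(1) by auto
    ultimately show "p \<in> standard_line D" unfolding standard_line_def by blast
  next
    fix p assume "p \<in> standard_line D"
    then obtain \<xi> c where \<xi>: "\<xi> \<subseteq> D" "card \<xi> = 2" "0 \<le> c"
      "p = tp_class (\<lambda>i. if i \<in> \<xi> then 0 else if i \<in> D then c else \<infinity>)"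
      unfolding standard_line_def ray_to_marked_point_def by blast
    then obtain i j where ij: "\<xi> = {i,j}" "i \<noteq> j" by (auto simp: card_2_iff)
    \<comment> \<open>A finite \<open>c\<close> belongs to the open orbit of \<open>D\<close>; an
      infinite one gives the marked point, in the orbit of \<open>\<xi>\<close>.\<close>
    have "\<exists>J w. p = tp_class (\<lambda>i. if i \<in> J then ereal (w i) else \<infinity>) \<and> J \<subseteq> D \<and> J \<noteq> {} \<and> Q J w"
    proof (cases c)
      case (real r)
      have "p = tp_class (\<lambda>l. if l \<in> D then ereal (if l \<in> \<xi> then 0 else r) else \<infinity>)"
        unfolding \<xi>(4) real by (rule arg_cong[where f = tp_class]) (use \<xi>(1) in \<open>auto simp: fun_eq_iff zero_ereal_def[symmetric]\<close>)
      moreover have "Q D (\<lambda>l. if l \<in> \<xi> then 0 else r)"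
        unfolding Q_def by (intro bexI[of _ i] bexI[of _ j]) (use \<xi> ij real in auto)
      ultimately show ?thesis using \<xi>(1) ij(1)
        by (intro exI[of _ D] exI[of _ "\<lambda>l. if l \<in> \<xi> then 0 else r"]) auto
    next
      case PInf
      have "p = tp_class (\<lambda>l. if l \<in> \<xi> then ereal 0 else \<infinity>)"
        unfolding \<xi>(4) PInf by (rule arg_cong[where f = tp_class]) (use \<xi>(1) in \<open>auto simp: fun_eq_iff zero_ereal_def[symmetric]\<close>)
      moreover have "Q \<xi> (\<lambda>l. 0)"
        unfolding Q_def by (intro bexI[of _ i] bexI[of _ j]) (use ij in auto)
      ultimately show ?thesis using \<xi>(1) ij(1) by (intro exI[of _ \<xi>] exI[of _ "\<lambda>l. 0"]) auto
    qed (use \<xi>(3) in simp)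
    then show "p \<in> {tp_class (\<lambda>i. if i \<in> J then ereal (w i) else \<infinity>) | J w. J \<subseteq> D \<and> J \<noteq> {} \<and> Q J w}" by blast
  qed
qed

text \<open>All generators vanish on the orbits inside \<open>\<xi>\<close>, so the restricted ideal
  is zero and every point of the face satisfies the condition.\<close>

lemma tropproj_edge:
  fixes gens :: "('i, 'k) mpoly set"
  assumes I: "finite I" "\<xi> \<subseteq> I"
    and lin: "\<And>s. s \<in> gens \<Longrightarrow> \<exists>c. s = linear_form I c \<and> (\<forall>i\<in>\<xi>. c i = 0)"
    and out: "\<And>l. l \<in> I - \<xi> \<Longrightarrow> linear_form I (\<lambda>i. if i = l then 1 else 0) \<in> gens"
  shows "tropproj val I (Idl\<^bsub>poly_ring I\<^esub> gens) = TP \<xi>"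
proof -
  have sub: "gens \<subseteq> carrier (poly_ring I)" using lin linear_form_carrier by blast
  have *: "tropproj val I (Idl\<^bsub>poly_ring I\<^esub> gens) =
     {tp_class (\<lambda>i. if i \<in> J then ereal (w i) else \<infinity>) | J w. J \<subseteq> \<xi> \<and> J \<noteq> {} \<and> True}"
  proof (rule tropproj_orbits[OF I _ out])
    show "\<exists>c. s = linear_form I c" if "s \<in> gens" for s using lin[OF that] by blast
    fix J and w :: "'i \<Rightarrow> real" assume J: "J \<subseteq> \<xi>" "J \<noteq> {}"
    then have JI: "J \<subseteq> I" using I by auto
    have "f = 0" if f: "f \<in> Idl\<^bsub>laurent_ring J\<^esub> (restrict_to_orbit J ` (Idl\<^bsub>poly_ring I\<^esub> gens))" for f
    proof -
      have "\<exists>h\<in>carrier (laurent_ring J). f = h * 0"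
      proof (rule orbit_ideal_principal[OF sub _ _ f])
        show "0 \<in> carrier (laurent_ring J :: ('i, 'k) laurent_mpoly ring)" by (simp add: laurent_ring_def var_ring_def)
        fix s assume "s \<in> gens"
        then obtain c where c: "s = linear_form I c" "\<forall>i\<in>\<xi>. c i = 0" using lin by blast
        have "restrict_to_orbit J s = (\<Sum>k\<in>J. 0)"
          unfolding c(1) restrict_linear_form[OF I(1) JI] by (rule sum.cong) (use c(2) J in auto)
        moreover have "0 \<in> carrier (laurent_ring J :: ('i, 'k) laurent_mpoly ring)" by (simp add: laurent_ring_def var_ring_def)
        ultimately show "\<exists>h\<in>carrier (laurent_ring J). restrict_to_orbit J s = h * 0" by auto
      qed
      then show ?thesis by simp
    qed
    then show "(\<forall>f\<in>Idl\<^bsub>laurent_ring J\<^esub> (restrict_to_orbit J ` (Idl\<^bsub>poly_ring I\<^esub> gens)).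
          f \<noteq> 0 \<longrightarrow> min_attained_twice val J w f) \<longleftrightarrow> True" by blast
  qed
  show ?thesis unfolding *
  proof (intro equalityI subsetI)
    fix p assume "p \<in> {tp_class (\<lambda>i. if i \<in> J then ereal (w i) else \<infinity>) | J w. J \<subseteq> \<xi> \<and> J \<noteq> {} \<and> True}"
    then obtain J w where J: "J \<subseteq> \<xi>" "J \<noteq> {}" "p = tp_class (\<lambda>i. if i \<in> J then ereal (w i) else \<infinity>)" by blast
    show "p \<in> TP \<xi>" unfolding J(3) TP_def by (rule imageI) (use J(1,2) in auto)
  next
    fix p assume "p \<in> TP \<xi>"
    then obtain w where w: "p = tp_class w" "\<And>i. w i \<noteq> -\<infinity>" "\<And>i. i \<notin> \<xi> \<Longrightarrow> w i = \<infinity>" "\<exists>i\<in>\<xi>. w i \<noteq> \<infinity>"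
      unfolding TP_def by blast
    define J where "J = {i \<in> \<xi>. w i \<noteq> \<infinity>}"
    have "w = (\<lambda>i. if i \<in> J then ereal (real_of_ereal (w i)) else \<infinity>)"
      by (rule ext) (use w(2,3) in \<open>auto simp: J_def ereal_real\<close>)
    then have "p = tp_class (\<lambda>i. if i \<in> J then ereal (real_of_ereal (w i)) else \<infinity>)" using w(1) by simp
    moreover have "J \<subseteq> \<xi>" "J \<noteq> {}" using w(4) by (auto simp: J_def)
    ultimately show "p \<in> {tp_class (\<lambda>i. if i \<in> J then ereal (w i) else \<infinity>) | J w. J \<subseteq> \<xi> \<and> J \<noteq> {} \<and> True}"
      by (intro CollectI exI[of _ J] exI[of _ "\<lambda>i. real_of_ereal (w i)"]) simp
  qed
qed

text \<open>The line is spanned by the points \<open>e_i - e_j\<close> and \<open>e_j - e_k\<close>: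
  a linear form vanishes at both exactly if its three coefficients on \<open>D\<close>
  agree.\<close>

lemma tropical_line_standard_line:
  fixes I :: "'i set"
  assumes I: "finite I" "D \<subseteq> I" and D: "card D = 3"
  shows "tropical_line val I (standard_line D)"
proof -
  obtain i j k where ijk: "D = {i,j,k}" "i \<noteq> j" "j \<noteq> k" "i \<noteq> k" using D by (auto simp: card_3_iff)
  have mem: "i \<in> I" "j \<in> I" "k \<in> I" using ijk I by auto
  define a :: "'i \<Rightarrow> 'k" where "a = (\<lambda>l. if l = i then 1 else if l = j then - 1 else 0)"
  define b :: "'i \<Rightarrow> 'k" where "b = (\<lambda>l. if l = j then 1 else if l = k then - 1 else 0)"
  have sa: "(\<Sum>l\<in>I. c l * a l) = c i - c j" for c
  proof -
    have "(\<Sum>l\<in>I. c l * a l) = (\<Sum>l\<in>{i,j}. c l * a l)"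
      by (rule sum.mono_neutral_right) (use I mem in \<open>auto simp: a_def\<close>)
    then show ?thesis using ijk by (simp add: a_def)
  qed
  have sb: "(\<Sum>l\<in>I. c l * b l) = c j - c k" for c
  proof -
    have "(\<Sum>l\<in>I. c l * b l) = (\<Sum>l\<in>{j,k}. c l * b l)"
      by (rule sum.mono_neutral_right) (use I mem in \<open>auto simp: b_def\<close>)
    then show ?thesis using ijk by (simp add: b_def)
  qed
  have line: "tropproj val I (Idl\<^bsub>poly_ring I\<^esub>
      {linear_form I c | c. (\<Sum>i\<in>I. c i * a i) = 0 \<and> (\<Sum>i\<in>I. c i * b i) = 0}) = standard_line D"
    unfolding sa sb
  proof (rule tropproj_face[OF I D])
    fix s assume "s \<in> {linear_form I c | c :: 'i \<Rightarrow> 'k. c i - c j = 0 \<and> c j - c k = 0}"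
    then obtain c :: "'i \<Rightarrow> 'k" where "s = linear_form I c" "c i = c j" "c j = c k" by auto
    then show "\<exists>c r. s = linear_form I c \<and> (\<forall>i\<in>D. c i = r)"
      by (intro exI[of _ c] exI[of _ "c i"]) (auto simp: ijk(1))
  next
    fix l assume l: "l \<in> I - D"
    show "linear_form I (\<lambda>i. if i = l then 1 else 0) \<in> {linear_form I c | c :: 'i \<Rightarrow> 'k. c i - c j = 0 \<and> c j - c k = 0}"
      by (rule CollectI, rule exI[of _ "\<lambda>i. if i = l then 1 else 0"]) (use l ijk in auto)
  next
    show "linear_form I (\<lambda>i. if i \<in> D then 1 else 0) \<in> {linear_form I c | c :: 'i \<Rightarrow> 'k. c i - c j = 0 \<and> c j - c k = 0}"
      by (rule CollectI, rule exI[of _ "\<lambda>i. if i \<in> D then 1 else 0"]) (use ijk in auto)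
  qed
  have indep: "s = 0 \<and> t = 0" if st: "\<forall>l\<in>I. s * a l + t * b l = 0" for s t
  proof -
    have "s * a i + t * b i = 0" "s * a k + t * b k = 0" using st mem by blast+
    then show ?thesis using ijk by (simp add: a_def b_def)
  qed
  show ?thesis unfolding tropical_line_def
    by (intro exI[of _ a] exI[of _ b] conjI allI impI) (use indep line[symmetric] in blast)+
qed

text \<open>The line is spanned by the two coordinate points of \<open>\<xi>\<close>.\<close>

lemma tropical_line_TP:
  fixes I :: "'i set"
  assumes I: "finite I" "\<xi> \<subseteq> I" and \<xi>: "card \<xi> = 2"
  shows "tropical_line val I (TP \<xi>)"
proof -
  obtain i j where ij: "\<xi> = {i,j}" "i \<noteq> j" using \<xi> by (auto simp: card_2_iff)
  have mem: "i \<in> I" "j \<in> I" using ij I by auto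
  define a :: "'i \<Rightarrow> 'k" where "a = (\<lambda>l. if l = i then 1 else 0)"
  define b :: "'i \<Rightarrow> 'k" where "b = (\<lambda>l. if l = j then 1 else 0)"
  have sa: "(\<Sum>l\<in>I. c l * a l) = c i" for c
  proof -
    have "(\<Sum>l\<in>I. c l * a l) = (\<Sum>l\<in>{i}. c l * a l)"
      by (rule sum.mono_neutral_right) (use I mem in \<open>auto simp: a_def\<close>)
    then show ?thesis by (simp add: a_def)
  qed
  have sb: "(\<Sum>l\<in>I. c l * b l) = c j" for c
  proof -
    have "(\<Sum>l\<in>I. c l * b l) = (\<Sum>l\<in>{j}. c l * b l)"
      by (rule sum.mono_neutral_right) (use I mem in \<open>auto simp: b_def\<close>)
    then show ?thesis by (simp add: b_def)
  qed
  have line: "tropproj val I (Idl\<^bsub>poly_ring I\<^esub>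
      {linear_form I c | c. (\<Sum>i\<in>I. c i * a i) = 0 \<and> (\<Sum>i\<in>I. c i * b i) = 0}) = TP \<xi>"
    unfolding sa sb
  proof (rule tropproj_edge[OF I])
    fix s assume "s \<in> {linear_form I c | c :: 'i \<Rightarrow> 'k. c i = 0 \<and> c j = 0}"
    then obtain c :: "'i \<Rightarrow> 'k" where "s = linear_form I c" "c i = 0" "c j = 0" by auto
    then show "\<exists>c. s = linear_form I c \<and> (\<forall>i\<in>\<xi>. c i = 0)"
      by (intro exI[of _ c]) (auto simp: ij(1))
  next
    fix l assume l: "l \<in> I - \<xi>"
    show "linear_form I (\<lambda>i. if i = l then 1 else 0) \<in> {linear_form I c | c :: 'i \<Rightarrow> 'k. c i = 0 \<and> c j = 0}"
      by (rule CollectI, rule exI[of _ "\<lambda>i. if i = l then 1 else 0"]) (use l ij in auto)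
  qed
  have indep: "s = 0 \<and> t = 0" if st: "\<forall>l\<in>I. s * a l + t * b l = 0" for s t
  proof -
    have "s * a i + t * b i = 0" "s * a j + t * b j = 0" using st mem by blast+
    then show ?thesis using ij by (simp add: a_def b_def)
  qed
  show ?thesis unfolding tropical_line_def
    by (intro exI[of _ a] exI[of _ b] conjI allI impI) (use indep line[symmetric] in blast)+
qed

end

text \<open>The label \<open>outer\<close> stands for the exterior face and is not a coordinate: a triangle containing it
  is the dual of an exterior vertex, whose line is an edge of the tropical projective space.\<close>

definition pointed_line :: "'i \<Rightarrow> 'i set \<Rightarrow> 'i tpoint set" where
  "pointed_line outer t = (if outer \<in> t then TP (t - {outer}) else standard_line t)"

definition sphere_arrangement :: "'i \<Rightarrow> 'i set set \<Rightarrow> 'i arr" where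
  "sphere_arrangement outer K = (\<Union>K - {outer}, pointed_line outer ` K)"

text \<open>An invariant from which the triangle can be recovered from its line.\<close>

definition line_support :: "'i tpoint set \<Rightarrow> 'i set" where
  "line_support \<Lambda> = {i. \<exists>p\<in>\<Lambda>. \<exists>w\<in>p. w i \<noteq> \<infinity>}"

lemma self_in_tp_class: "w \<in> tp_class w"
  unfolding tp_class_def by (rule CollectI, rule exI[of _ 0]) simp

lemma tp_class_support: "w' \<in> tp_class w \<Longrightarrow> w' i \<noteq> \<infinity> \<longleftrightarrow> w i \<noteq> \<infinity>"
  unfolding tp_class_def by auto

lemma line_support_TP: "line_support (TP \<xi>) = \<xi>"
proof (intro equalityI subsetI)
  fix i assume "i \<in> line_support (TP \<xi>)"
  then obtain p w where p: "p \<in> TP \<xi>" "w \<in> p" "w i \<noteq> \<infinity>" by (auto simp: line_support_def)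
  then obtain w' where w': "p = tp_class w'" "\<forall>i. i \<notin> \<xi> \<longrightarrow> w' i = \<infinity>" by (auto simp: TP_def)
  have "w' i \<noteq> \<infinity>" using tp_class_support[of w w' i] p w'(1) by simp
  then show "i \<in> \<xi>" using w'(2) by blast
next
  fix i assume i: "i \<in> \<xi>"
  define w :: "_ \<Rightarrow> ereal" where "w = (\<lambda>j. if j \<in> \<xi> then 0 else \<infinity>)"
  have "tp_class w \<in> TP \<xi>" unfolding TP_def by (rule imageI) (use i in \<open>auto simp: w_def\<close>)
  moreover have "w i \<noteq> \<infinity>" using i by (simp add: w_def)
  ultimately show "i \<in> line_support (TP \<xi>)"
    unfolding line_support_def using self_in_tp_class[of w]
    by (intro CollectI bexI[of _ "tp_class w"] bexI[of _ w])
qed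

lemma line_support_standard_line:
  assumes "card D = 3"
  shows "line_support (standard_line D) = D"
proof (intro equalityI subsetI)
  fix i assume "i \<in> line_support (standard_line D)"
  then obtain p w where p: "p \<in> standard_line D" "w \<in> p" "w i \<noteq> \<infinity>" by (auto simp: line_support_def)
  then obtain \<xi> c where c: "\<xi> \<subseteq> D" "p = tp_class (\<lambda>i. if i \<in> \<xi> then 0 else if i \<in> D then c else \<infinity>)"
    unfolding standard_line_def ray_to_marked_point_def by blast
  have "(if i \<in> \<xi> then 0 else if i \<in> D then c else \<infinity>) \<noteq> (\<infinity>::ereal)"
    using tp_class_support[OF p(2)[unfolded c(2)], of i] p(3) by simp
  then show "i \<in> D" using c(1) by (auto split: if_splits)
next
  fix i assume i: "i \<in> D"
  obtain \<xi> where \<xi>: "\<xi> \<subseteq> D" "card \<xi> = 2" using obtain_subset_with_card_n[of 2 D] assms by auto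
  define w :: "_ \<Rightarrow> ereal" where "w = (\<lambda>i. if i \<in> \<xi> then 0 else if i \<in> D then 0 else \<infinity>)"
  have "tp_class w \<in> ray_to_marked_point D \<xi>"
    unfolding ray_to_marked_point_def w_def by (rule CollectI, rule exI[of _ 0]) simp
  then have "tp_class w \<in> standard_line D" unfolding standard_line_def using \<xi> by blast
  moreover have "w i \<noteq> \<infinity>" using i by (simp add: w_def)
  ultimately show "i \<in> line_support (standard_line D)"
    unfolding line_support_def using self_in_tp_class[of w]
    by (intro CollectI bexI[of _ "tp_class w"] bexI[of _ w])
qed

text \<open>The support of the line is \<open>t\<close> without \<open>outer\<close>, and its size
  tells whether \<open>outer\<close> was there. Removing lines from an arrangement thus amounts to
  removing triangles.\<close>

lemma pointed_line_inj:
  assumes "card t = 3" "card t' = 3" "pointed_line outer t = pointed_line outer t'"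
  shows "t = t'"
proof -
  have supp: "line_support (pointed_line outer s) = s - {outer}" if "card s = 3" for s
    using that by (auto simp: pointed_line_def line_support_TP line_support_standard_line)
  have eq: "t - {outer} = t' - {outer}" using supp[OF assms(1)] supp[OF assms(2)] assms(3) by metis
  have card: "card (s - {outer}) = (if outer \<in> s then 2 else 3)" if "card s = 3" for s
    using that card.infinite[of s] by (auto simp: card_Diff_singleton_if)
  have "outer \<in> t \<longleftrightarrow> outer \<in> t'" using card[OF assms(1)] card[OF assms(2)] eq by (auto split: if_splits)
  then show ?thesis using eq by blast
qed

lemma pointed_line_image_diff:
  assumes "\<And>t. t \<in> K \<Longrightarrow> card t = 3" "B \<subseteq> K"
  shows "pointed_line outer ` (K - B) = pointed_line outer ` K - pointed_line outer ` B"
proof (rule inj_on_image_set_diff[of _ K])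
  show "inj_on (pointed_line outer) K"
    by (rule inj_onI) (rule pointed_line_inj[OF assms(1) assms(1)])
qed (use assms in auto)

section \<open>Sphere moves as tropical transformations\<close>

context
  fixes val :: "'k::field \<Rightarrow> ereal"
  assumes val: "field_valuation val"
begin

lemma arrangement_sphere:
  assumes K: "trisphere K"
  shows "arrangement val (\<Union>K - {outer}, pointed_line outer ` K)"
proof -
  have fin: "finite (\<Union>K - {outer})" using trisphereD(5)[OF K] by simp
  have "tropical_line val (\<Union>K - {outer}) (pointed_line outer t)" if t: "t \<in> K" for t
  proof (cases "outer \<in> t")
    case True
    have "card (t - {outer}) = 2" using trisphereD(3,4)[OF K t] True by simp
    then show ?thesis using tropical_line_TP[OF val fin, of "t - {outer}"] t True by (auto simp: pointed_line_def)
  next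
    case False
    then show ?thesis using tropical_line_standard_line[OF val fin, of t] t trisphereD(3)[OF K t]
      by (auto simp: pointed_line_def)
  qed
  then show ?thesis using fin trisphereD(1)[OF K] unfolding arrangement_def by auto
qed

text \<open>The four triangles are the faces of one tetrahedron of labels, and
  contraction-elongation exchanges two of these faces for the other two.\<close>

lemma flip_transformation:
  assumes K: "trisphere K" and dist: "distinct [a,b,c,d]" and o: "outer \<notin> {a,b,c,d}"
    and T: "{a,b,c} \<in> K" "{a,b,d} \<in> K" and U: "\<Union>K' = \<Union>K"
    and K': "K' = (K - {{a,b,c},{a,b,d}}) \<union> {{a,c,d},{b,c,d}}"
  shows "tropical_transformation val (sphere_arrangement outer K) (sphere_arrangement outer K')"
proof -
  let ?I = "\<Union>K - {outer}" and ?L = "pointed_line outer"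
  have L: "?L s = standard_line s" if "s \<in> {{a,b,c},{a,b,d},{a,c,d},{b,c,d}}" for s
    using that o by (auto simp: pointed_line_def)
  have mem: "standard_line {a,b,c} \<in> ?L ` K" "standard_line {a,b,d} \<in> ?L ` K"
    using imageI[OF T(1), of ?L] imageI[OF T(2), of ?L] L by auto
  have union: "{a,b,c} \<union> {a,b,d} = {a,b,c,d}" by auto
  have "{D. D \<subseteq> {a,b,c} \<union> {a,b,d} \<and> card D = 3 \<and> D \<noteq> {a,b,c} \<and> D \<noteq> {a,b,d}} =
      {D. D \<subseteq> {a,b,c,d} \<and> card D = 3} - {{a,b,c},{a,b,d}}" unfolding union by blast
  also have "\<dots> = {{a,c,d},{b,c,d}}" unfolding triples_of_four[OF dist] using dist by auto
  finally have new: "{D. D \<subseteq> {a,b,c} \<union> {a,b,d} \<and> card D = 3 \<and> D \<noteq> {a,b,c} \<and> D \<noteq> {a,b,d}} =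
      {{a,c,d},{b,c,d}}" .
  have "tropical_contraction_elongation val (?I, ?L ` K)
     (?I, (?L ` K - {standard_line {a,b,c}, standard_line {a,b,d}}) \<union>
      standard_line ` {D. D \<subseteq> {a,b,c} \<union> {a,b,d} \<and> card D = 3 \<and> D \<noteq> {a,b,c} \<and> D \<noteq> {a,b,d}})"
  proof (rule tropical_contraction_elongation.intros[OF arrangement_sphere[OF K] _ _ _ _ _ mem])
    show "{a,b,c} \<subseteq> ?I" "{a,b,d} \<subseteq> ?I" using T[THEN Union_upper] o by auto
    have "{a,b,c} \<inter> {a,b,d} = {a,b}" using dist by auto
    then show "card ({a,b,c} \<inter> {a,b,d}) = 2" using dist by simp
  qed (use dist in auto)
  moreover have "?L ` K' = (?L ` K - {standard_line {a,b,c}, standard_line {a,b,d}}) \<union>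
      standard_line ` {{a,c,d},{b,c,d}}"
  proof -
    have "?L ` K' = (?L ` K - ?L ` {{a,b,c},{a,b,d}}) \<union> ?L ` {{a,c,d},{b,c,d}}"
      unfolding K' image_Un using pointed_line_image_diff[of K "{{a,b,c},{a,b,d}}" outer] trisphereD(3)[OF K] T by auto
    then show ?thesis using L by simp
  qed
  ultimately show ?thesis
    unfolding tropical_transformation_def sphere_arrangement_def U new by simp
qed

lemma subdivide_face_transformation:
  assumes K': "trisphere K'" and dist: "distinct [a,b,c,d]" and o: "outer \<notin> {a,b,c,d}"
    and T: "{b,c,d} \<in> K'" and a: "a \<notin> \<Union>K'" and U: "\<Union>K - {outer} = insert a (\<Union>K' - {outer})"
    and K: "K = (K' - {{b,c,d}}) \<union> {{a,b,c},{a,b,d},{a,c,d}}"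
  shows "tropical_Y_Delta val (sphere_arrangement outer K') (sphere_arrangement outer K)"
proof -
  let ?I = "\<Union>K' - {outer}" and ?L = "pointed_line outer"
  have L: "?L s = standard_line s" if "s \<in> {{a,b,c},{a,b,d},{a,c,d},{b,c,d}}" for s
    using that o by (auto simp: pointed_line_def)
  have mem: "standard_line {b,c,d} \<in> ?L ` K'" using imageI[OF T(1), of ?L] L by auto
  have "{D'. D' \<subseteq> insert a {b,c,d} \<and> card D' = 3 \<and> D' \<noteq> {b,c,d}} =
      {D. D \<subseteq> {a,b,c,d} \<and> card D = 3} - {{b,c,d}}" by blast
  also have "\<dots> = {{a,b,c},{a,b,d},{a,c,d}}" unfolding triples_of_four[OF dist] using dist by auto
  finally have new: "{D'. D' \<subseteq> insert a {b,c,d} \<and> card D' = 3 \<and> D' \<noteq> {b,c,d}} =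
      {{a,b,c},{a,b,d},{a,c,d}}" .
  have "tropical_Y_Delta val (?I, ?L ` K')
     (insert a ?I, (?L ` K' - {standard_line {b,c,d}}) \<union>
        standard_line ` {D'. D' \<subseteq> insert a {b,c,d} \<and> card D' = 3 \<and> D' \<noteq> {b,c,d}})"
  proof (rule tropical_Y_Delta.at_face[OF arrangement_sphere[OF K'] _ _ mem])
    show "{b,c,d} \<subseteq> ?I" using T[THEN Union_upper] o by auto
  qed (use dist a in auto)
  moreover have "?L ` K = (?L ` K' - {standard_line {b,c,d}}) \<union> standard_line ` {{a,b,c},{a,b,d},{a,c,d}}"
  proof -
    have "?L ` K = (?L ` K' - ?L ` {{b,c,d}}) \<union> ?L ` {{a,b,c},{a,b,d},{a,c,d}}"
      unfolding K image_Un using pointed_line_image_diff[of K' "{{b,c,d}}" outer] trisphereD(3)[OF K'] T by auto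
    then show ?thesis using L by simp
  qed
  ultimately show ?thesis unfolding sphere_arrangement_def U new by simp
qed

text \<open>The triangle \<open>{outer,x,y}\<close> stands for the edge \<open>{x,y}\<close>. Of the
  three triangles around \<open>a\<close>, two still contain \<open>outer\<close> and give the two
  new edges, while \<open>{a,x,y}\<close> gives the standard line.\<close>

lemma subdivide_edge_transformation:
  assumes K': "trisphere K'" and dist: "distinct [a,x,y,outer]"
    and T: "{outer,x,y} \<in> K'" and a: "a \<notin> \<Union>K'" and U: "\<Union>K - {outer} = insert a (\<Union>K' - {outer})"
    and K: "K = (K' - {{outer,x,y}}) \<union> {{a,outer,x},{a,outer,y},{a,x,y}}"
  shows "tropical_Y_Delta val (sphere_arrangement outer K') (sphere_arrangement outer K)"
proof -
  let ?I = "\<Union>K' - {outer}" and ?L = "pointed_line outer"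
  have sets: "{outer,x,y} - {outer} = {x,y}" "{a,outer,x} - {outer} = {a,x}" "{a,outer,y} - {outer} = {a,y}"
    using dist by auto
  have L: "?L {outer,x,y} = TP {x,y}" "?L {a,outer,x} = TP {a,x}" "?L {a,outer,y} = TP {a,y}"
    "?L {a,x,y} = standard_line {a,x,y}"
  proof -
    have "outer \<noteq> a" "outer \<noteq> x" "outer \<noteq> y" using dist by auto
    then show "?L {outer,x,y} = TP {x,y}" "?L {a,outer,x} = TP {a,x}" "?L {a,outer,y} = TP {a,y}"
      "?L {a,x,y} = standard_line {a,x,y}" by (simp_all add: pointed_line_def sets)
  qed
  have mem: "TP {x,y} \<in> ?L ` K'" using imageI[OF T(1), of ?L] L by simp
  have ins: "insert a {x,y} = {a,x,y}" by simp
  have "{\<xi>'. \<xi>' \<subseteq> insert a {x,y} \<and> card \<xi>' = 2 \<and> \<xi>' \<noteq> {x,y}} = {e. card e = 2 \<and> e \<subseteq> {a,x,y}} - {{x,y}}" by blast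
  also have "\<dots> = {{a,x},{a,y}}" by (subst pairs_of_triple) (use dist in \<open>auto simp: doubleton_eq_iff\<close>)
  finally have new: "{\<xi>'. \<xi>' \<subseteq> insert a {x,y} \<and> card \<xi>' = 2 \<and> \<xi>' \<noteq> {x,y}} = {{a,x},{a,y}}" .
  have "tropical_Y_Delta val (?I, ?L ` K')
     (insert a ?I, (?L ` K' - {TP {x,y}}) \<union> {standard_line (insert a {x,y})} \<union>
        TP ` {\<xi>'. \<xi>' \<subseteq> insert a {x,y} \<and> card \<xi>' = 2 \<and> \<xi>' \<noteq> {x,y}})"
  proof (rule tropical_Y_Delta.at_edge[OF arrangement_sphere[OF K'] _ _ mem])
    show "{x,y} \<subseteq> ?I" using T[THEN Union_upper] dist by auto
  qed (use dist a in auto)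
  moreover have "?L ` K = (?L ` K' - {TP {x,y}}) \<union> {standard_line (insert a {x,y})} \<union> TP ` {{a,x},{a,y}}"
  proof -
    have "?L ` K = (?L ` K' - ?L ` {{outer,x,y}}) \<union> ?L ` {{a,outer,x},{a,outer,y},{a,x,y}}"
      unfolding K image_Un using pointed_line_image_diff[of K' "{{outer,x,y}}" outer] trisphereD(3)[OF K'] T by auto
    then show ?thesis using L by (simp add: insert_commute)
  qed
  ultimately show ?thesis unfolding sphere_arrangement_def U new by simp
qed

lemma sphere_move_transformation:
  assumes "sphere_move outer K K'"
  shows "tropical_transformation val (sphere_arrangement outer K) (sphere_arrangement outer K')"
    "tropical_transformation val (sphere_arrangement outer K') (sphere_arrangement outer K)"
proof -
  have "tropical_transformation val (sphere_arrangement outer K) (sphere_arrangement outer K') \<and>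
    tropical_transformation val (sphere_arrangement outer K') (sphere_arrangement outer K)"
    using assms
  proof cases
    case (flip a b c d)
    have perm: "{c,d,a} = {a,c,d}" "{c,d,b} = {b,c,d}" "{c,a,b} = {a,b,c}" "{d,a,b} = {a,b,d}" by auto
    have ne: "{a,c,d} \<noteq> {a,b,c}" "{a,c,d} \<noteq> {a,b,d}" "{b,c,d} \<noteq> {a,b,c}" "{b,c,d} \<noteq> {a,b,d}"
      using flip(3) by auto
    \<comment> \<open>The inverse of a flip is a flip with the two diagonals exchanged.\<close>
    have "K = (K' - {{c,d,a},{c,d,b}}) \<union> {{c,a,b},{d,a,b}}"
      unfolding perm using flip(5-8,10) by blast
    then have "tropical_transformation val (sphere_arrangement outer K') (sphere_arrangement outer K)"
      by (intro flip_transformation[of K' c d a b]) (use flip perm in auto)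
    then show ?thesis using flip_transformation[of K a b c d outer K'] flip by blast
  next
    case (remove a b c d)
    have a: "a \<notin> \<Union>K'" using remove by auto
    have "a \<in> \<Union>K" using remove(5) by blast
    then have U: "\<Union>K - {outer} = insert a (\<Union>K' - {outer})" using remove(4,7) by auto
    have sub: "{{a,b,c},{a,b,d},{a,c,d}} \<subseteq> K" unfolding remove(5)[symmetric] by blast
    have K: "K = (K' - {{b,c,d}}) \<union> {{a,b,c},{a,b,d},{a,c,d}}"
      using remove(6,8) sub by blast
    have T: "{b,c,d} \<in> K'" using remove(8) by blast
    \<comment> \<open>It is enough to treat the insertion of \<open>a\<close>, which is a new label
      for \<open>K'\<close>; the removal is its inverse by the definition of
      \<open>tropical_Delta_Y\<close>.\<close>
    have "tropical_Y_Delta val (sphere_arrangement outer K') (sphere_arrangement outer K)"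
    proof (cases "outer \<in> {b,c,d}")
      case False
      show ?thesis by (rule subdivide_face_transformation[OF remove(2,3) _ T a U K]) (use False remove(4) in auto)
    next
      case True
      then consider "outer = b" | "outer = c" | "outer = d" by blast
      then show ?thesis
      proof cases
        case 1
        show ?thesis
          by (rule subdivide_edge_transformation[OF remove(2), of a c d])
             (use T a U K remove(3) 1 in \<open>auto simp: insert_commute\<close>)
      next
        case 2
        show ?thesis
          by (rule subdivide_edge_transformation[OF remove(2), of a b d])
             (use T a U K remove(3) 2 in \<open>auto simp: insert_commute\<close>)
      next
        case 3
        show ?thesis
          by (rule subdivide_edge_transformation[OF remove(2), of a b c])
             (use T a U K remove(3) 3 in \<open>auto simp: insert_commute\<close>)
      qed
    qed
    then show ?thesis by (simp add: tropical_transformation_def tropical_Delta_Y_def)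
  qed
  then show "tropical_transformation val (sphere_arrangement outer K) (sphere_arrangement outer K')"
    "tropical_transformation val (sphere_arrangement outer K') (sphere_arrangement outer K)" by blast+
qed

end

section \<open>Relabelling\<close>

lemma relabel_tp_class:
  assumes "bij \<sigma>"
  shows "(\<lambda>w. w \<circ> inv_into UNIV \<sigma>) ` tp_class w = tp_class (w \<circ> inv_into UNIV \<sigma>)"
proof -
  have "(\<lambda>i. w i + ereal c) \<circ> inv_into UNIV \<sigma> = (\<lambda>i. (w \<circ> inv_into UNIV \<sigma>) i + ereal c)" for c by auto
  then show ?thesis unfolding tp_class_def by (auto simp: image_iff) metis
qed

lemma bij_inv_mem_iff: "bij \<sigma> \<Longrightarrow> inv_into UNIV \<sigma> i \<in> A \<longleftrightarrow> i \<in> \<sigma> ` A"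
  by (metis bij_inv_eq_iff image_iff)

lemma relabel_TP:
  fixes \<sigma> :: "'i \<Rightarrow> 'i"
  assumes \<sigma>: "bij \<sigma>"
  shows "(\<lambda>p. (\<lambda>w. w \<circ> inv_into UNIV \<sigma>) ` p) ` TP \<xi> = TP (\<sigma> ` \<xi>)"
proof -
  let ?W = "\<lambda>\<xi>. {w::_ \<Rightarrow> ereal. (\<forall>i. w i \<noteq> -\<infinity>) \<and> (\<forall>i. i \<notin> \<xi> \<longrightarrow> w i = \<infinity>) \<and> (\<exists>i\<in>\<xi>. w i \<noteq> \<infinity>)}"
  have cancel: "inv_into UNIV \<sigma> (\<sigma> i) = i" "\<sigma> (inv_into UNIV \<sigma> i) = i" for i using \<sigma> by (simp_all add: bij_is_inj bij_is_surj surj_f_inv_f)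
  have "(\<lambda>w. w \<circ> inv_into UNIV \<sigma>) ` ?W \<xi> = ?W (\<sigma> ` \<xi>)"
  proof (intro equalityI subsetI)
    fix w assume "w \<in> (\<lambda>w. w \<circ> inv_into UNIV \<sigma>) ` ?W \<xi>"
    then show "w \<in> ?W (\<sigma> ` \<xi>)" using bij_inv_mem_iff[OF \<sigma>, of _ \<xi>] cancel by auto
  next
    fix w assume w: "w \<in> ?W (\<sigma> ` \<xi>)"
    have "w = (w \<circ> \<sigma>) \<circ> inv_into UNIV \<sigma>" using cancel by auto
    moreover have "w \<circ> \<sigma> \<in> ?W \<xi>" using w \<sigma> by (auto simp: bij_is_inj inj_image_mem_iff)
    ultimately show "w \<in> (\<lambda>w. w \<circ> inv_into UNIV \<sigma>) ` ?W \<xi>" by blast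
  qed
  then show ?thesis unfolding TP_def image_image relabel_tp_class[OF \<sigma>] by (metis image_image)
qed

lemma relabel_standard_line:
  fixes \<sigma> :: "'i \<Rightarrow> 'i"
  assumes \<sigma>: "bij \<sigma>"
  shows "(\<lambda>p. (\<lambda>w. w \<circ> inv_into UNIV \<sigma>) ` p) ` standard_line D = standard_line (\<sigma> ` D)"
proof -
  have ray: "(\<lambda>p. (\<lambda>w. w \<circ> inv_into UNIV \<sigma>) ` p) ` ray_to_marked_point D \<xi> = ray_to_marked_point (\<sigma> ` D) (\<sigma> ` \<xi>)" for \<xi>
  proof -
    have "(\<lambda>i. if i \<in> \<xi> then 0 else if i \<in> D then c else \<infinity>) \<circ> inv_into UNIV \<sigma> =
      (\<lambda>i. if i \<in> \<sigma> ` \<xi> then 0 else if i \<in> \<sigma> ` D then c else (\<infinity>::ereal))" for c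
      by (rule ext) (simp add: bij_inv_mem_iff[OF \<sigma>])
    then have "(\<lambda>w. w \<circ> inv_into UNIV \<sigma>) ` tp_class (\<lambda>i. if i \<in> \<xi> then 0 else if i \<in> D then c else \<infinity>) =
       tp_class (\<lambda>i. if i \<in> \<sigma> ` \<xi> then 0 else if i \<in> \<sigma> ` D then c else \<infinity>)" for c
      unfolding relabel_tp_class[OF \<sigma>] by simp
    then show ?thesis unfolding ray_to_marked_point_def by (auto simp: image_iff)
  qed
  have "{\<xi>. \<xi> \<subseteq> \<sigma> ` D \<and> card \<xi> = 2} = (`) \<sigma> ` {\<xi>. \<xi> \<subseteq> D \<and> card \<xi> = 2}"
  proof -
    have "card (\<sigma> ` \<xi>) = card \<xi>" for \<xi> using \<sigma> by (intro card_image) (auto simp: bij_def inj_on_def)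
    then show ?thesis by (auto simp: subset_image_iff)
  qed
  then have "standard_line (\<sigma> ` D) = (\<Union>\<xi>\<in>{\<xi>. \<xi> \<subseteq> D \<and> card \<xi> = 2}. ray_to_marked_point (\<sigma> ` D) (\<sigma> ` \<xi>))"
    unfolding standard_line_def by auto
  then show ?thesis unfolding standard_line_def image_UN ray[symmetric] by simp
qed

lemma relabelling_sphere_arrangement:
  assumes \<sigma>: "bij \<sigma>"
  shows "relabelling (sphere_arrangement outer K) (sphere_arrangement (\<sigma> outer) ((`) \<sigma> ` K))"
proof -
  have inj: "inj \<sigma>" using \<sigma> by (rule bij_is_inj)
  have 1: "\<Union>((`) \<sigma> ` K) - {\<sigma> outer} = \<sigma> ` (\<Union>K - {outer})"
    using inj by (auto simp: inj_eq)
  have "(\<lambda>p. (\<lambda>w. w \<circ> inv_into UNIV \<sigma>) ` p) ` pointed_line outer t = pointed_line (\<sigma> outer) (\<sigma> ` t)" for t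
  proof -
    have "\<sigma> ` t - {\<sigma> outer} = \<sigma> ` (t - {outer})" using inj by (auto simp: inj_eq)
    then show ?thesis unfolding pointed_line_def
      using relabel_TP[OF \<sigma>, of "t - {outer}"] relabel_standard_line[OF \<sigma>, of t] inj by (simp add: inj_image_mem_iff)
  qed
  then have 2: "pointed_line (\<sigma> outer) ` (`) \<sigma> ` K =
      (\<lambda>\<Lambda>. (\<lambda>p. (\<lambda>w. w \<circ> inv_into UNIV \<sigma>) ` p) ` \<Lambda>) ` pointed_line outer ` K"
    unfolding image_image by simp
  show ?thesis unfolding relabelling_def sphere_arrangement_def fst_conv snd_conv 1 2 using \<sigma> by blast
qed

text \<open>Relabellings are bijections of the whole type. As \<open>A\<close> and \<open>B\<close>
  have equal size, so have \<open>B - A\<close> and \<open>A - B\<close>; a bijection between these,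
  and the identity elsewhere, complete \<open>f\<close>.\<close>

lemma bij_extending_finite:
  fixes A B :: "'i set"
  assumes "finite A" "finite B" "bij_betw f A B"
  shows "\<exists>\<sigma>. bij \<sigma> \<and> (\<forall>x\<in>A. \<sigma> x = f x)"
proof -
  have "card A = card B" using assms by (simp add: bij_betw_same_card)
  have "card (B - A) = card (A - B)"
  proof -
    have "card (B - A) + card (A \<inter> B) = card B" "card (A - B) + card (A \<inter> B) = card A"
      using assms by (metis Int_commute card_Diff_subset_Int card_Int_Diff add.commute)+
    then show ?thesis using \<open>card A = card B\<close> by simp
  qed
  then obtain g where g: "bij_betw g (B - A) (A - B)"
    using assms finite_same_card_bij[of "B - A" "A - B"] by auto
  define \<sigma> where "\<sigma> = (\<lambda>x. if x \<in> A then f x else if x \<in> B then g x else x)"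
  have "bij_betw \<sigma> A B" using assms(3) by (rule bij_betw_cong[THEN iffD1, rotated]) (simp add: \<sigma>_def)
  moreover have "bij_betw \<sigma> (B - A) (A - B)" using g by (rule bij_betw_cong[THEN iffD1, rotated]) (simp add: \<sigma>_def)
  ultimately have "bij_betw \<sigma> (A \<union> (B - A)) (B \<union> (A - B))" by (rule bij_betw_combine) auto
  moreover have "bij_betw \<sigma> (- (A \<union> B)) (- (A \<union> B))"
    using bij_betw_id by (rule bij_betw_cong[THEN iffD1, rotated]) (simp add: \<sigma>_def)
  ultimately have "bij_betw \<sigma> ((A \<union> (B - A)) \<union> - (A \<union> B)) ((B \<union> (A - B)) \<union> - (A \<union> B))"
    by (rule bij_betw_combine) auto
  moreover have "(A \<union> (B - A)) \<union> - (A \<union> B) = UNIV" "(B \<union> (A - B)) \<union> - (A \<union> B) = UNIV" by auto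
  ultimately show ?thesis by (intro exI[of _ \<sigma>]) (simp add: \<sigma>_def)
qed

text \<open>A tetrahedron is determined by its four corners, so any bijection of the corners that
  matches the distinguished ones will do.\<close>

lemma tetrahedra_relabelling:
  assumes "is_tetrahedron outer K" "is_tetrahedron outer' K'"
  shows "relabelling (sphere_arrangement outer K) (sphere_arrangement outer' K')"
proof -
  obtain Q where Q: "card Q = 4" "outer \<in> Q" "K = {t. t \<subseteq> Q \<and> card t = 3}"
    using assms(1) unfolding is_tetrahedron_def by blast
  obtain Q' where Q': "card Q' = 4" "outer' \<in> Q'" "K' = {t. t \<subseteq> Q' \<and> card t = 3}"
    using assms(2) unfolding is_tetrahedron_def by blast
  have fin: "finite Q" "finite Q'" using Q Q' card.infinite by fastforce+
  obtain f where f: "bij_betw f (Q - {outer}) (Q' - {outer'})"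
    using finite_same_card_bij[of "Q - {outer}" "Q' - {outer'}"] fin Q Q' by auto
  have "bij_betw (f(outer := outer')) (insert outer (Q - {outer})) (insert outer' (Q' - {outer'}))"
    using f by (intro bij_betw_combine[of _ "{outer}" "{outer'}", simplified]) (auto simp: bij_betw_def inj_on_def)
  then have "bij_betw (f(outer := outer')) Q Q'" using Q(2) Q'(2) by (simp add: insert_absorb)
  from bij_extending_finite[OF fin this] obtain \<sigma> where \<sigma>: "bij \<sigma>" "\<And>x. x \<in> Q \<Longrightarrow> \<sigma> x = (f(outer := outer')) x"
    by blast
  have img: "\<sigma> ` Q = Q'" using \<sigma>(2) \<open>bij_betw (f(outer := outer')) Q Q'\<close> unfolding bij_betw_def by (metis image_cong)
  have o: "\<sigma> outer = outer'" using \<sigma>(2) Q(2) by simp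
  have "card (\<sigma> ` t) = card t" for t using \<sigma>(1) by (intro card_image) (auto simp: bij_def inj_on_def)
  then have "(`) \<sigma> ` K = K'" unfolding Q(3) Q'(3) img[symmetric] by (auto simp: subset_image_iff)
  then show ?thesis using relabelling_sphere_arrangement[OF \<sigma>(1), of outer K] o by simp
qed

theorem sphere_arrangements_transformable:
  assumes val: "field_valuation (val :: 'k::field \<Rightarrow> ereal)"
    and K: "trisphere K" "outer \<in> \<Union>K" and K': "trisphere K'" "outer' \<in> \<Union>K'"
  shows "tropically_transformable val (sphere_arrangement outer K) (sphere_arrangement outer' K')"
proof -
  let ?T = "tropically_transformable val"
  have trans: "?T A C" if "?T A B" "?T B C" for A B C :: "'a arr"
    using that unfolding tropically_transformable_def by (rule rtranclp_trans)
  have single: "?T A B" if "tropical_transformation val A B \<or> relabelling A B" for A B :: "'a arr"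
    using that unfolding tropically_transformable_def by blast
  have refl: "?T A A" for A :: "'a arr" unfolding tropically_transformable_def by blast
  \<comment> \<open>The reduction of \<open>K\<close> is followed forwards and that of
    \<open>K'\<close> backwards, hence both directions.\<close>
  have moves: "?T (sphere_arrangement x L) (sphere_arrangement x L') \<and> ?T (sphere_arrangement x L') (sphere_arrangement x L)"
    if "(sphere_move x)\<^sup>*\<^sup>* L L'" for x :: 'a and L L'
    using that
  proof (induction rule: rtranclp_induct)
    case base then show ?case using refl by blast
  next
    case (step y z)
    have "?T (sphere_arrangement x y) (sphere_arrangement x z)" "?T (sphere_arrangement x z) (sphere_arrangement x y)"
      using sphere_move_transformation[OF val step.hyps(2)] single by blast+
    then show ?case using step.IH trans by blast
  qed
  obtain L where L: "(sphere_move outer)\<^sup>*\<^sup>* K L" "is_tetrahedron outer L"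
    using trisphere_reduces_to_tetrahedron[OF K] by blast
  obtain L' where L': "(sphere_move outer')\<^sup>*\<^sup>* K' L'" "is_tetrahedron outer' L'"
    using trisphere_reduces_to_tetrahedron[OF K'] by blast
  have "?T (sphere_arrangement outer L) (sphere_arrangement outer' L')"
    using single tetrahedra_relabelling[OF L(2) L'(2)] by blast
  then show ?thesis using moves[OF L(1)] moves[OF L'(1)] trans by blast
qed

section \<open>Faces of planar drawings near a point\<close>

definition dir :: "real \<Rightarrow> real^2" where "dir \<theta> = vector [cos \<theta>, sin \<theta>]"

definition faces_at :: "(real^2) set \<Rightarrow> real^2 \<Rightarrow> (real^2) set set" where
  "faces_at \<Gamma> x = {C \<in> components (- \<Gamma>). x \<in> closure C}"

text \<open>Angles are real numbers rather than residues, so a sector can be shifted by a full turn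
  to lie next to another one. The apex is excluded.\<close>

definition sector :: "real^2 \<Rightarrow> real \<Rightarrow> real \<Rightarrow> real \<Rightarrow> (real^2) set" where
  "sector p R \<alpha> \<beta> = (\<lambda>(r,\<phi>). p + r *\<^sub>R dir \<phi>) ` ({0<..<R} \<times> {\<alpha><..<\<beta>})"

lemma dir_nth [simp]: "dir \<theta> $ 1 = cos \<theta>" "dir \<theta> $ 2 = sin \<theta>"
  by (simp_all add: dir_def)

lemma norm_dir [simp]: "norm (dir \<theta>) = 1"
  by (simp add: norm_vec_def L2_set_def sum_2 )

lemma continuous_on_polar: "continuous_on A (\<lambda>(r,\<phi>). p + r *\<^sub>R dir \<phi>)"
proof -
  have "dir = (\<lambda>\<theta>. cos \<theta> *\<^sub>R axis 1 1 + sin \<theta> *\<^sub>R axis 2 1)"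
    by (rule ext) (simp add: vec_eq_iff forall_2 axis_def)
  moreover have "continuous_on UNIV (\<lambda>\<theta>. cos \<theta> *\<^sub>R axis 1 1 + sin \<theta> *\<^sub>R axis 2 1 :: real^2)"
    by (intro continuous_intros)
  ultimately have "continuous_on UNIV dir" by (simp only:)
  then have "continuous_on A (\<lambda>x. dir (snd x))"
    by (intro continuous_on_compose2[of UNIV dir A snd] continuous_intros) auto
  then show ?thesis unfolding split_def by (intro continuous_intros)
qed

lemma dir_eq_iff:
  assumes "\<bar>\<theta> - \<phi>\<bar> < 2 * pi"
  shows "dir \<theta> = dir \<phi> \<longleftrightarrow> \<theta> = \<phi>"
proof
  assume "dir \<theta> = dir \<phi>"
  then have "sin \<theta> = sin \<phi> \<and> cos \<theta> = cos \<phi>" by (metis dir_nth)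
  then obtain n :: int where n: "\<theta> = \<phi> + 2 * pi * n" using sin_cos_eq_iff by blast
  then have "\<bar>2 * pi * n\<bar> < 2 * pi * 1" using assms by simp
  then have "\<bar>real_of_int n\<bar> < 1" by (simp add: abs_mult)
  then have "n = 0" by linarith
  then show "\<theta> = \<phi>" using n by simp
qed simp

lemma dir_periodic: "dir (\<theta> + 2 * pi) = dir \<theta>" "dir (\<theta> - 2 * pi) = dir \<theta>"
  by (simp_all add: dir_def cos_diff sin_diff)

lemma dir_pi: "dir (\<theta> + pi) = - dir \<theta>"
  by (simp add: vec_eq_iff forall_2)

lemma polar_unique:
  assumes "r > 0" "s > 0" "p + r *\<^sub>R dir \<theta> = p + s *\<^sub>R dir \<phi>"
  shows "r = s" "dir \<theta> = dir \<phi>"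
proof -
  have eq: "r *\<^sub>R dir \<theta> = s *\<^sub>R dir \<phi>" using assms by simp
  then have "norm (r *\<^sub>R dir \<theta>) = norm (s *\<^sub>R dir \<phi>)" by simp
  then show "r = s" using assms by simp
  then show "dir \<theta> = dir \<phi>" using eq assms by simp
qed

text \<open>The start \<open>\<alpha>\<close> of the angular interval is free, so that the branch
  cut can be put on a ray of the drawing.\<close>

lemma polar_exists:
  fixes p y :: "real^2"
  assumes "y \<noteq> p"
  obtains \<phi> where "\<alpha> \<le> \<phi>" "\<phi> < \<alpha> + 2 * pi" "y = p + dist p y *\<^sub>R dir \<phi>"
proof -
  define r where "r = norm (y - p)"
  have r: "r > 0" using assms by (simp add: r_def)
  have "(y - p) $ 1 ^ 2 + (y - p) $ 2 ^ 2 = r ^ 2"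
    unfolding r_def norm_vec_def L2_set_def by (simp add: sum_2)
  then have "((y - p) $ 1 / r) ^ 2 + ((y - p) $ 2 / r) ^ 2 = 1"
    using r by (simp add: power_divide add_divide_distrib[symmetric])
  then obtain t where t: "(y - p) $ 1 / r = cos t" "(y - p) $ 2 / r = sin t" by (rule sincos_total_2pi)
  \<comment> \<open>The number of full turns that moves \<open>t\<close> into the half-open interval
    starting at \<open>\<alpha>\<close>.\<close>
  define n where "n = \<lceil>(\<alpha> - t) / (2 * pi)\<rceil>"
  define \<phi> where "\<phi> = t + 2 * pi * of_int n"
  have n: "(\<alpha> - t) / (2 * pi) \<le> of_int n" "of_int n < (\<alpha> - t) / (2 * pi) + 1"
    unfolding n_def by linarith+
  have p1: "\<alpha> \<le> \<phi>" using n(1) by (simp add: \<phi>_def field_simps)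
  have p2: "\<phi> < \<alpha> + 2 * pi" using n(2) by (simp add: \<phi>_def field_simps)
  have "dir \<phi> = dir t"
  proof -
    have "sin \<phi> = sin t \<and> cos \<phi> = cos t" unfolding sin_cos_eq_iff \<phi>_def by blast
    then show ?thesis by (simp add: dir_def)
  qed
  then have "y = p + r *\<^sub>R dir \<phi>" using t r by (simp add: vec_eq_iff forall_2 field_simps)
  moreover have "r = dist p y" by (simp add: r_def dist_norm norm_minus_commute)
  ultimately have "y = p + dist p y *\<^sub>R dir \<phi>" by simp
  with p1 p2 show ?thesis by (rule that)
qed

lemma connected_sector: "connected (sector p R \<alpha> \<beta>)"
  unfolding sector_def
  by (rule connected_continuous_image[OF continuous_on_polar]) (intro connected_Times connected_Ioo)

lemma sector_mem: "0 < r \<Longrightarrow> r < R \<Longrightarrow> \<alpha> < \<phi> \<Longrightarrow> \<phi> < \<beta> \<Longrightarrow> p + r *\<^sub>R dir \<phi> \<in> sector p R \<alpha> \<beta>"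
  unfolding sector_def by (auto intro!: image_eqI[of _ _ "(r,\<phi>)"])

lemma sector_shift: "sector p R (\<alpha> + 2 * pi) (\<beta> + 2 * pi) = sector p R \<alpha> \<beta>"
proof (intro equalityI subsetI)
  fix x assume "x \<in> sector p R (\<alpha> + 2 * pi) (\<beta> + 2 * pi)"
  then obtain r \<phi> where "0 < r" "r < R" "\<alpha> + 2 * pi < \<phi>" "\<phi> < \<beta> + 2 * pi" "x = p + r *\<^sub>R dir \<phi>"
    by (auto simp: sector_def)
  then show "x \<in> sector p R \<alpha> \<beta>" using sector_mem[of r R \<alpha> "\<phi> - 2 * pi" \<beta> p] by (simp add: dir_periodic)
next
  fix x assume "x \<in> sector p R \<alpha> \<beta>"
  then obtain r \<phi> where "0 < r" "r < R" "\<alpha> < \<phi>" "\<phi> < \<beta>" "x = p + r *\<^sub>R dir \<phi>"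
    by (auto simp: sector_def)
  then show "x \<in> sector p R (\<alpha> + 2 * pi) (\<beta> + 2 * pi)"
    using sector_mem[of r R "\<alpha> + 2 * pi" "\<phi> + 2 * pi" "\<beta> + 2 * pi" p] by (simp add: dir_periodic)
qed

lemma sector_nonempty: "0 < R \<Longrightarrow> \<alpha> < \<beta> \<Longrightarrow> sector p R \<alpha> \<beta> \<noteq> {}"
  using sector_mem[of "R/2" R \<alpha> "(\<alpha> + \<beta>)/2" \<beta> p] by (auto simp: field_simps)

lemma polar_tendsto: "((\<lambda>\<phi>. p + r *\<^sub>R dir \<phi>) \<longlongrightarrow> p + r *\<^sub>R dir \<beta>) (at \<beta>)"
proof -
  have "continuous_on UNIV (\<lambda>\<phi>. (\<lambda>(r,\<phi>). p + r *\<^sub>R dir \<phi>) (r, \<phi>))"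
    by (rule continuous_on_compose2[OF continuous_on_polar[of UNIV p]]) (auto intro: continuous_intros)
  then show ?thesis by (simp add: continuous_on_def)
qed

lemma ray_in_closure_sector:
  assumes "0 < r" "r < R" "\<alpha> < \<beta>"
  shows "p + r *\<^sub>R dir \<alpha> \<in> closure (sector p R \<alpha> \<beta>)" "p + r *\<^sub>R dir \<beta> \<in> closure (sector p R \<alpha> \<beta>)"
proof -
  have lim: "((\<lambda>\<phi>. p + r *\<^sub>R dir \<phi>) \<longlongrightarrow> p + r *\<^sub>R dir \<alpha>) (at_right \<alpha>)"
    by (rule tendsto_mono[OF at_le polar_tendsto]) simp
  have ev: "eventually (\<lambda>\<phi>. p + r *\<^sub>R dir \<phi> \<in> closure (sector p R \<alpha> \<beta>)) (at_right \<alpha>)"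
    unfolding eventually_at_right_field
    using assms sector_mem[of r R \<alpha> _ \<beta> p] closure_subset[of "sector p R \<alpha> \<beta>"] by (intro exI[of _ \<beta>]) auto
  show "p + r *\<^sub>R dir \<alpha> \<in> closure (sector p R \<alpha> \<beta>)"
    by (rule Lim_in_closed_set[OF closed_closure ev trivial_limit_at_right_real lim])
next
  have lim: "((\<lambda>\<phi>. p + r *\<^sub>R dir \<phi>) \<longlongrightarrow> p + r *\<^sub>R dir \<beta>) (at_left \<beta>)"
    by (rule tendsto_mono[OF at_le polar_tendsto]) simp
  have ev: "eventually (\<lambda>\<phi>. p + r *\<^sub>R dir \<phi> \<in> closure (sector p R \<alpha> \<beta>)) (at_left \<beta>)"
    unfolding eventually_at_left_field
    using assms sector_mem[of r R \<alpha> _ \<beta> p] closure_subset[of "sector p R \<alpha> \<beta>"] by (intro exI[of _ \<alpha>]) auto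
  show "p + r *\<^sub>R dir \<beta> \<in> closure (sector p R \<alpha> \<beta>)"
    by (rule Lim_in_closed_set[OF closed_closure ev trivial_limit_at_left_real lim])
qed

lemma center_in_closure_sector:
  assumes "0 < R" "\<alpha> < \<beta>"
  shows "p \<in> closure (sector p R \<alpha> \<beta>)"
proof -
  define \<phi> where "\<phi> = (\<alpha> + \<beta>) / 2"
  have \<phi>: "\<alpha> < \<phi>" "\<phi> < \<beta>" using assms by (auto simp: \<phi>_def)
  have lim: "((\<lambda>r. p + r *\<^sub>R dir \<phi>) \<longlongrightarrow> p + 0 *\<^sub>R dir \<phi>) (at_right 0)"
    by (intro tendsto_intros)
  have ev: "eventually (\<lambda>r. p + r *\<^sub>R dir \<phi> \<in> closure (sector p R \<alpha> \<beta>)) (at_right 0)"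
    unfolding eventually_at_right_field
    using assms sector_mem[OF _ _ \<phi>, of _ R p] closure_subset[of "sector p R \<alpha> \<beta>"] by (intro exI[of _ R]) auto
  show ?thesis
    using Lim_in_closed_set[OF closed_closure ev trivial_limit_at_right_real lim] by simp
qed

lemma component_unique:
  assumes "C \<in> components S" "C' \<in> components S" "y \<in> C" "y \<in> C'"
  shows "C = C'"
  using components_eq[OF assms(1,2)] assms(3,4) by auto

text \<open>Off the ray, a point of the ball lies in one of the two adjacent sectors or in the
  closed rest of the disc. The rest is compact and misses the given point, so a small neighbourhood
  of that point sees only \<open>C1\<close> and \<open>C2\<close>. For
  \<open>\<gamma> = \<alpha> + 2 * pi\<close> the rest is a single radius.\<close>

lemma faces_at_ray:
  assumes ang: "\<alpha> < \<beta>" "\<beta> < \<gamma>" "\<gamma> \<le> \<alpha> + 2 * pi" and r: "0 < r" "r < R"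
    and C: "C1 \<in> components (- \<Gamma>)" "sector p R \<alpha> \<beta> \<subseteq> C1" "C2 \<in> components (- \<Gamma>)" "sector p R \<beta> \<gamma> \<subseteq> C2"
    and ray: "\<And>s. 0 < s \<Longrightarrow> s < R \<Longrightarrow> p + s *\<^sub>R dir \<beta> \<in> \<Gamma>"
  shows "faces_at \<Gamma> (p + r *\<^sub>R dir \<beta>) = {C1, C2}"
proof
  let ?x = "p + r *\<^sub>R dir \<beta>"
  have "?x \<in> closure C1" "?x \<in> closure C2"
    using ray_in_closure_sector(2)[OF r ang(1)] ray_in_closure_sector(1)[OF r ang(2)]
      closure_mono[OF C(2)] closure_mono[OF C(4)] by auto
  then show "{C1, C2} \<subseteq> faces_at \<Gamma> ?x" using C by (auto simp: faces_at_def)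
  \<comment> \<open>the closed sector complementary to the two sectors next to the ray\<close>
  define T where "T = (\<lambda>(\<rho>,\<phi>). p + \<rho> *\<^sub>R dir \<phi>) ` ({0..R} \<times> {\<gamma>..\<alpha> + 2 * pi})"
  have "compact T" unfolding T_def
    by (rule compact_continuous_image[OF continuous_on_polar]) (intro compact_Times compact_Icc)
  then have opT: "open (- T)" by (simp add: compact_imp_closed open_Compl)
  have xT: "?x \<notin> T"
  proof
    assume "?x \<in> T"
    then obtain \<rho> \<phi> where \<rho>: "0 \<le> \<rho>" "\<gamma> \<le> \<phi>" "\<phi> \<le> \<alpha> + 2 * pi" "?x = p + \<rho> *\<^sub>R dir \<phi>" by (auto simp: T_def)
    have "r *\<^sub>R dir \<beta> \<noteq> 0" using r by (metis norm_dir norm_zero scaleR_eq_0_iff zero_neq_one less_irrefl)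
    then have "\<rho> \<noteq> 0" using \<rho>(4) by auto
    then have "dir \<beta> = dir \<phi>" using polar_unique[OF r(1) _ \<rho>(4)] \<rho>(1) by simp
    then show False using dir_eq_iff[of \<beta> \<phi>] \<rho> ang by auto
  qed
  show "faces_at \<Gamma> ?x \<subseteq> {C1, C2}"
  proof
    fix C assume "C \<in> faces_at \<Gamma> ?x"
    then have C0: "C \<in> components (- \<Gamma>)" "?x \<in> closure C" by (auto simp: faces_at_def)
    have "open (- T \<inter> ball p R)" using opT by (intro open_Int) auto
    moreover have "?x \<in> - T \<inter> ball p R" using xT r by (simp add: dist_norm)
    then have "(- T \<inter> ball p R) \<inter> closure C \<noteq> {}" using C0(2) by auto
    ultimately have "(- T \<inter> ball p R) \<inter> C \<noteq> {}" by (simp add: open_Int_closure_eq_empty)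
    then obtain y where y: "y \<in> C" "y \<notin> T" "dist p y < R" by auto
    have y\<Gamma>: "y \<notin> \<Gamma>" using in_components_subset[OF C0(1)] y(1) by auto
    have "y \<noteq> p"
    proof
      assume "y = p"
      have "(\<lambda>(\<rho>,\<phi>). p + \<rho> *\<^sub>R dir \<phi>) (0, \<gamma>) \<in> T"
        unfolding T_def by (rule imageI) (use ang r in auto)
      then show False using y(2) \<open>y = p\<close> by simp
    qed
    then obtain \<phi> where \<phi>: "\<beta> \<le> \<phi>" "\<phi> < \<beta> + 2 * pi" "y = p + dist p y *\<^sub>R dir \<phi>" by (rule polar_exists)
    have d: "0 < dist p y" using \<open>y \<noteq> p\<close> by auto
    have "\<phi> \<noteq> \<beta>" using ray[OF d y(3)] y\<Gamma> \<phi>(3) by auto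
    have "\<not> (\<gamma> \<le> \<phi> \<and> \<phi> \<le> \<alpha> + 2 * pi)"
    proof
      assume "\<gamma> \<le> \<phi> \<and> \<phi> \<le> \<alpha> + 2 * pi"
      then have "(dist p y, \<phi>) \<in> {0..R} \<times> {\<gamma>..\<alpha> + 2 * pi}" using y(3) by auto
      then have "(\<lambda>(\<rho>,\<phi>). p + \<rho> *\<^sub>R dir \<phi>) (dist p y, \<phi>) \<in> T" unfolding T_def by (rule imageI)
      then show False using y(2) \<phi>(3) by simp
    qed
    then consider "\<phi> < \<gamma>" | "\<alpha> + 2 * pi < \<phi>" by linarith
    then have "y \<in> C1 \<or> y \<in> C2"
    proof cases
      case 1
      have "p + dist p y *\<^sub>R dir \<phi> \<in> sector p R \<beta> \<gamma>" by (rule sector_mem) (use 1 d y(3) \<phi>(1) \<open>\<phi> \<noteq> \<beta>\<close> in auto)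
      then show ?thesis using C(4) \<phi>(3) by auto
    next
      case 2
      have "p + dist p y *\<^sub>R dir (\<phi> - 2 * pi) \<in> sector p R \<alpha> \<beta>" by (rule sector_mem) (use 2 d y(3) \<phi>(2) in auto)
      then show ?thesis using C(2) \<phi>(3) by (auto simp: dir_periodic)
    qed
    then show "C \<in> {C1, C2}"
      using component_unique[OF C0(1) C(1) y(1)] component_unique[OF C0(1) C(3) y(1)] by auto
  qed
qed

lemma faces_at_center:
  assumes R: "0 < R"
    and cov: "\<And>y. y \<in> ball p R - \<Gamma> \<Longrightarrow> \<exists>C\<in>CC. y \<in> C"
    and CC: "\<And>C. C \<in> CC \<Longrightarrow> C \<in> components (- \<Gamma>) \<and> (\<exists>\<alpha> \<beta>. \<alpha> < \<beta> \<and> sector p R \<alpha> \<beta> \<subseteq> C)"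
  shows "faces_at \<Gamma> p = CC"
proof
  show "CC \<subseteq> faces_at \<Gamma> p"
  proof
    fix C assume "C \<in> CC"
    then obtain \<alpha> \<beta> where *: "C \<in> components (- \<Gamma>)" "\<alpha> < \<beta>" "sector p R \<alpha> \<beta> \<subseteq> C" using CC by blast
    show "C \<in> faces_at \<Gamma> p" unfolding faces_at_def
      using center_in_closure_sector[OF R *(2), of p] closure_mono[OF *(3)] *(1) by auto
  qed
  show "faces_at \<Gamma> p \<subseteq> CC"
  proof
    fix C assume "C \<in> faces_at \<Gamma> p"
    then have C0: "C \<in> components (- \<Gamma>)" "p \<in> closure C" by (auto simp: faces_at_def)
    then obtain y where y: "y \<in> C" "dist y p < R" using R unfolding closure_approachable by blast
    have "y \<notin> \<Gamma>" using in_components_subset[OF C0(1)] y(1) by auto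
    then obtain C' where C': "C' \<in> CC" "y \<in> C'" using cov[of y] y(2) by (auto simp: dist_commute)
    then have "C' \<in> components (- \<Gamma>)" using CC by blast
    then have "C = C'" using component_unique[OF C0(1) _ y(1) C'(2)] by simp
    then show "C \<in> CC" using C'(1) by simp
  qed
qed

lemma sector_component:
  assumes "sector p R \<alpha> \<beta> \<inter> \<Gamma> = {}" "0 < R" "\<alpha> < \<beta>"
  obtains C where "C \<in> components (- \<Gamma>)" "sector p R \<alpha> \<beta> \<subseteq> C"
proof -
  have "sector p R \<alpha> \<beta> \<subseteq> - \<Gamma>" using assms by auto
  moreover have "- \<Gamma> \<noteq> {}" using calculation sector_nonempty[OF assms(2,3)] by fastforce
  ultimately obtain C where "C \<in> components (- \<Gamma>)" "sector p R \<alpha> \<beta> \<subseteq> C"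
    using exists_component_superset[OF _ _ connected_sector] by meson
  then show ?thesis by (rule that)
qed

text \<open>The line cuts the ball into two half discs. Their components may coincide at this stage;
  that an edge has different faces on its two sides comes later from cycles.\<close>

lemma faces_near_smooth_point:
  assumes R: "0 < R" and \<Gamma>: "\<Gamma> \<inter> ball p R = {p + r *\<^sub>R dir \<theta> | r. \<bar>r\<bar> < R}"
  obtains C1 C2 where "C1 \<in> components (- \<Gamma>)" "C2 \<in> components (- \<Gamma>)"
    "\<And>r. \<bar>r\<bar> < R \<Longrightarrow> faces_at \<Gamma> (p + r *\<^sub>R dir \<theta>) = {C1, C2}"
proof -
  have on: "p + r *\<^sub>R dir \<theta> \<in> \<Gamma>" if "\<bar>r\<bar> < R" for r using \<Gamma> that by blast
  have off: "sector p R \<alpha> \<beta> \<inter> \<Gamma> = {}" if "(\<alpha> = \<theta> \<and> \<beta> = \<theta> + pi) \<or> (\<alpha> = \<theta> + pi \<and> \<beta> = \<theta> + 2 * pi)" for \<alpha> \<beta>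
  proof (rule ccontr)
    assume "sector p R \<alpha> \<beta> \<inter> \<Gamma> \<noteq> {}"
    then obtain s \<phi> where s: "0 < s" "s < R" "\<alpha> < \<phi>" "\<phi> < \<beta>" "p + s *\<^sub>R dir \<phi> \<in> \<Gamma>"
      by (auto simp: sector_def)
    then have "p + s *\<^sub>R dir \<phi> \<in> \<Gamma> \<inter> ball p R" by (simp add: dist_norm)
    then obtain r where r: "\<bar>r\<bar> < R" "p + s *\<^sub>R dir \<phi> = p + r *\<^sub>R dir \<theta>" unfolding \<Gamma> by blast
    have "r \<noteq> 0"
    proof
      assume "r = 0"
      then have "s *\<^sub>R dir \<phi> = 0" using r by simp
      then show False using s by (metis norm_dir norm_zero scaleR_eq_0_iff zero_neq_one less_irrefl)
    qed
    then consider "r > 0" | "r < 0" by linarith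
    then show False
    proof cases
      case 1
      then have "dir \<phi> = dir \<theta>" using polar_unique[OF s(1) _ r(2)] by simp
      then show False using dir_eq_iff[of \<phi> \<theta>] s that by auto
    next
      case 2
      have eq: "p + s *\<^sub>R dir \<phi> = p + (- r) *\<^sub>R dir (\<theta> + pi)" using r(2) by (simp add: dir_pi)
      have "dir \<phi> = dir (\<theta> + pi)" by (rule polar_unique(2)[OF s(1) _ eq]) (use 2 in simp)
      then show False using dir_eq_iff[of \<phi> "\<theta> + pi"] s that by auto
    qed
  qed
  obtain C1 where C1: "C1 \<in> components (- \<Gamma>)" "sector p R \<theta> (\<theta> + pi) \<subseteq> C1"
    by (rule sector_component[OF off[of "\<theta>" "\<theta> + pi"] R]) auto
  obtain C2 where C2: "C2 \<in> components (- \<Gamma>)" "sector p R (\<theta> + pi) (\<theta> + 2 * pi) \<subseteq> C2"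
    by (rule sector_component[OF off[of "\<theta> + pi" "\<theta> + 2 * pi"] R]) auto
  \<comment> \<open>Shifted back by a full turn, the sector borders the ray at
    \<open>\<theta>\<close> from below.\<close>
  have C2': "sector p R (\<theta> - pi) \<theta> \<subseteq> C2"
    using C2(2) sector_shift[of p R "\<theta> - pi" \<theta>] by (simp add: add.commute)
  have pos: "faces_at \<Gamma> (p + r *\<^sub>R dir \<theta>) = {C2, C1}" if "0 < r" "r < R" for r
    by (rule faces_at_ray[OF _ _ _ that C2(1) C2' C1]) (use on in auto)
  have neg: "faces_at \<Gamma> (p + r *\<^sub>R dir (\<theta> + pi)) = {C1, C2}" if "0 < r" "r < R" for r
    by (rule faces_at_ray[OF _ _ _ that C1 C2]) (use on[of "- _"] in \<open>auto simp: dir_pi\<close>)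
  have zero: "faces_at \<Gamma> p = {C1, C2}"
  proof (rule faces_at_center[OF R])
    fix y assume y: "y \<in> ball p R - \<Gamma>"
    then have "y \<noteq> p" using on[of 0] R by auto
    then obtain \<phi> where \<phi>: "\<theta> \<le> \<phi>" "\<phi> < \<theta> + 2 * pi" "y = p + dist p y *\<^sub>R dir \<phi>" by (rule polar_exists)
    have d: "0 < dist p y" "dist p y < R" using \<open>y \<noteq> p\<close> y by auto
    have "\<phi> \<noteq> \<theta>" using on[of "dist p y"] d y \<phi>(3) by auto
    have "\<phi> \<noteq> \<theta> + pi" using on[of "- dist p y"] d y \<phi>(3) by (auto simp: dir_pi)
    consider "\<phi> < \<theta> + pi" | "\<theta> + pi < \<phi>" using \<open>\<phi> \<noteq> \<theta> + pi\<close> by linarith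
    then show "\<exists>C\<in>{C1, C2}. y \<in> C"
    proof cases
      case 1
      have "p + dist p y *\<^sub>R dir \<phi> \<in> sector p R \<theta> (\<theta> + pi)" by (rule sector_mem) (use 1 d \<phi>(1) \<open>\<phi> \<noteq> \<theta>\<close> in auto)
      then show ?thesis using C1(2) \<phi>(3) by auto
    next
      case 2
      have "p + dist p y *\<^sub>R dir \<phi> \<in> sector p R (\<theta> + pi) (\<theta> + 2 * pi)" by (rule sector_mem) (use 2 d \<phi>(2) in auto)
      then show ?thesis using C2(2) \<phi>(3) by auto
    qed
  next
    fix C assume "C \<in> {C1, C2}"
    moreover have "\<theta> < \<theta> + pi" "\<theta> + pi < \<theta> + 2 * pi" using pi_gt_zero by auto
    ultimately show "C \<in> components (- \<Gamma>) \<and> (\<exists>\<alpha> \<beta>. \<alpha> < \<beta> \<and> sector p R \<alpha> \<beta> \<subseteq> C)"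
      using C1 C2 by blast
  qed
  have "faces_at \<Gamma> (p + r *\<^sub>R dir \<theta>) = {C1, C2}" if "\<bar>r\<bar> < R" for r
  proof -
    consider "r > 0" | "r = 0" | "r < 0" by linarith
    then show ?thesis
    proof cases
      case 1 then show ?thesis using pos[of r] that by auto
    next
      case 2 then show ?thesis using zero by simp
    next
      case 3 then show ?thesis using neg[of "- r"] that by (simp add: dir_pi)
    qed
  qed
  then show ?thesis using that C1(1) C2(1) by blast
qed

text \<open>Three rays cut the ball into three sectors, and the cyclic order of the angles decides
  which two of them a ray borders. The three components may still coincide.\<close>

lemma faces_near_triple_point:
  assumes R: "0 < R" and ang: "\<theta>1 < \<theta>2" "\<theta>2 < \<theta>3" "\<theta>3 < \<theta>1 + 2 * pi"
    and \<Gamma>: "\<Gamma> \<inter> ball p R = {p + r *\<^sub>R dir \<theta> | r \<theta>. 0 \<le> r \<and> r < R \<and> \<theta> \<in> {\<theta>1, \<theta>2, \<theta>3}}"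
  obtains C1 C2 C3 where "faces_at \<Gamma> p = {C1, C2, C3}"
    "\<And>r. 0 < r \<Longrightarrow> r < R \<Longrightarrow> faces_at \<Gamma> (p + r *\<^sub>R dir \<theta>1) = {C3, C1}"
    "\<And>r. 0 < r \<Longrightarrow> r < R \<Longrightarrow> faces_at \<Gamma> (p + r *\<^sub>R dir \<theta>2) = {C1, C2}"
    "\<And>r. 0 < r \<Longrightarrow> r < R \<Longrightarrow> faces_at \<Gamma> (p + r *\<^sub>R dir \<theta>3) = {C2, C3}"
proof -
  have on: "p + r *\<^sub>R dir \<theta> \<in> \<Gamma>" if "0 \<le> r" "r < R" "\<theta> \<in> {\<theta>1, \<theta>2, \<theta>3}" for r \<theta> using \<Gamma> that by blast
  have off: "sector p R \<alpha> \<beta> \<inter> \<Gamma> = {}"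
    if h: "(\<alpha> = \<theta>1 \<and> \<beta> = \<theta>2) \<or> (\<alpha> = \<theta>2 \<and> \<beta> = \<theta>3) \<or> (\<alpha> = \<theta>3 \<and> \<beta> = \<theta>1 + 2 * pi)" for \<alpha> \<beta>
  proof (rule ccontr)
    assume "sector p R \<alpha> \<beta> \<inter> \<Gamma> \<noteq> {}"
    then obtain s \<phi> where s: "0 < s" "s < R" "\<alpha> < \<phi>" "\<phi> < \<beta>" "p + s *\<^sub>R dir \<phi> \<in> \<Gamma>"
      by (auto simp: sector_def)
    then have "p + s *\<^sub>R dir \<phi> \<in> \<Gamma> \<inter> ball p R" by (simp add: dist_norm)
    then obtain r \<theta> where r: "0 \<le> r" "r < R" "p + s *\<^sub>R dir \<phi> = p + r *\<^sub>R dir \<theta>" "\<theta> \<in> {\<theta>1, \<theta>2, \<theta>3}"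
      unfolding \<Gamma> by blast
    have "r \<noteq> 0"
    proof
      assume "r = 0"
      then have "s *\<^sub>R dir \<phi> = 0" using r by simp
      then show False using s by (metis norm_dir norm_zero scaleR_eq_0_iff zero_neq_one less_irrefl)
    qed
    then have "dir \<phi> = dir \<theta>" using polar_unique[OF s(1) _ r(3)] r(1) by simp
    then have "\<phi> = \<theta>" using dir_eq_iff[of \<phi> \<theta>] s h ang r(4) by auto
    then show False using s h ang r(4) by auto
  qed
  obtain C1 where C1: "C1 \<in> components (- \<Gamma>)" "sector p R \<theta>1 \<theta>2 \<subseteq> C1"
    by (rule sector_component[OF off[of "\<theta>1" "\<theta>2"] R]) (use ang in auto)
  obtain C2 where C2: "C2 \<in> components (- \<Gamma>)" "sector p R \<theta>2 \<theta>3 \<subseteq> C2"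
    by (rule sector_component[OF off[of "\<theta>2" "\<theta>3"] R]) (use ang in auto)
  obtain C3 where C3: "C3 \<in> components (- \<Gamma>)" "sector p R \<theta>3 (\<theta>1 + 2 * pi) \<subseteq> C3"
    by (rule sector_component[OF off[of "\<theta>3" "\<theta>1 + 2 * pi"] R]) (use ang in auto)
  have C3': "sector p R (\<theta>3 - 2 * pi) \<theta>1 \<subseteq> C3"
    using C3(2) sector_shift[of p R "\<theta>3 - 2 * pi" \<theta>1] by simp
  have 1: "faces_at \<Gamma> (p + r *\<^sub>R dir \<theta>1) = {C3, C1}" if "0 < r" "r < R" for r
    by (rule faces_at_ray[OF _ _ _ that C3(1) C3' C1]) (use ang on in auto)
  have 2: "faces_at \<Gamma> (p + r *\<^sub>R dir \<theta>2) = {C1, C2}" if "0 < r" "r < R" for r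
    by (rule faces_at_ray[OF _ _ _ that C1 C2]) (use ang on in auto)
  have 3: "faces_at \<Gamma> (p + r *\<^sub>R dir \<theta>3) = {C2, C3}" if "0 < r" "r < R" for r
    by (rule faces_at_ray[OF _ _ _ that C2 C3]) (use ang on in auto)
  have "faces_at \<Gamma> p = {C1, C2, C3}"
  proof (rule faces_at_center[OF R])
    fix y assume y: "y \<in> ball p R - \<Gamma>"
    then have "y \<noteq> p" using on[of 0 \<theta>1] R by auto
    then obtain \<phi> where \<phi>: "\<theta>1 \<le> \<phi>" "\<phi> < \<theta>1 + 2 * pi" "y = p + dist p y *\<^sub>R dir \<phi>" by (rule polar_exists)
    have d: "0 < dist p y" "dist p y < R" using \<open>y \<noteq> p\<close> y by auto
    have ne: "\<phi> \<noteq> \<theta>1" "\<phi> \<noteq> \<theta>2" "\<phi> \<noteq> \<theta>3" using on[of "dist p y" \<phi>] d y \<phi>(3) by auto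
    consider "\<phi> < \<theta>2" | "\<theta>2 < \<phi>" "\<phi> < \<theta>3" | "\<theta>3 < \<phi>" using ne by linarith
    then show "\<exists>C\<in>{C1, C2, C3}. y \<in> C"
    proof cases
      case 1
      have "p + dist p y *\<^sub>R dir \<phi> \<in> sector p R \<theta>1 \<theta>2" by (rule sector_mem) (use 1 d \<phi>(1) ne in auto)
      then show ?thesis using C1(2) \<phi>(3) by auto
    next
      case 2
      have "p + dist p y *\<^sub>R dir \<phi> \<in> sector p R \<theta>2 \<theta>3" by (rule sector_mem) (use 2 d in auto)
      then show ?thesis using C2(2) \<phi>(3) by auto
    next
      case 3
      have "p + dist p y *\<^sub>R dir \<phi> \<in> sector p R \<theta>3 (\<theta>1 + 2 * pi)" by (rule sector_mem) (use 3 d \<phi>(2) in auto)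
      then show ?thesis using C3(2) \<phi>(3) by auto
    qed
  next
    fix C assume "C \<in> {C1, C2, C3}"
    then show "C \<in> components (- \<Gamma>) \<and> (\<exists>\<alpha> \<beta>. \<alpha> < \<beta> \<and> sector p R \<alpha> \<beta> \<subseteq> C)"
      using C1 C2 C3 ang by blast
  qed
  then show ?thesis by (rule that[OF _ 1 2 3])
qed

text \<open>The Jordan curve theorem for \<open>complex\<close>, carried over along the linear
  isomorphism \<open>f\<close> with inverse \<open>g\<close>.\<close>

lemma real2_Jordan:
  fixes c :: "real \<Rightarrow> real^2"
  assumes "simple_path c" "pathfinish c = pathstart c"
  obtains I J where "open I" "open J" "I \<inter> J = {}" "I \<union> J = - path_image c"
    "path_image c \<subseteq> closure I" "path_image c \<subseteq> closure J"
proof -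
  define f where "f = (\<lambda>x::real^2. Complex (x $ 1) (x $ 2))"
  define g where "g = (\<lambda>z. vector [Re z, Im z] :: real^2)"
  have gf: "g (f x) = x" for x by (simp add: f_def g_def vec_eq_iff forall_2)
  have fg: "f (g z) = z" for z by (simp add: f_def g_def)
  have "linear f" by (rule linearI) (simp_all add: f_def complex_eq_iff)
  have "linear g" by (rule linearI) (simp_all add: g_def vec_eq_iff forall_2)
  have cf: "continuous_on A f" for A using \<open>linear f\<close> by (rule linear_continuous_on[OF linear_conv_bounded_linear[THEN iffD1]])
  have cg: "continuous_on A g" for A using \<open>linear g\<close> by (rule linear_continuous_on[OF linear_conv_bounded_linear[THEN iffD1]])
  have injf: "inj f" using gf by (metis injI)
  define d where "d = f \<circ> c"
  have "simple_path d" unfolding d_def using simple_path_linear_image_eq[OF \<open>linear f\<close> injf] assms(1) by blast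
  moreover have "pathfinish d = pathstart d" using assms(2) by (simp add: d_def pathfinish_def pathstart_def)
  ultimately have J: "open (inside (path_image d))" "open (outside (path_image d))"
    "frontier (inside (path_image d)) = path_image d" "frontier (outside (path_image d)) = path_image d"
    "inside (path_image d) \<inter> outside (path_image d) = {}"
    using Jordan_inside_outside[of d] by auto
  have im: "path_image d = f ` path_image c" by (simp add: d_def path_image_compose)
  have cl: "path_image c \<subseteq> closure (f -` A)" if "frontier A = path_image d" for A
  proof
    fix x assume "x \<in> path_image c"
    then have "f x \<in> closure A" using that im by (auto simp: frontier_def)
    then have "g (f x) \<in> closure (g ` A)"
      using image_closure_subset[OF cg closed_closure closure_subset, of A] by blast
    moreover have "g ` A \<subseteq> f -` A" using fg by auto
    from closure_mono[OF this] have "closure (g ` A) \<subseteq> closure (f -` A)" .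
    ultimately show "x \<in> closure (f -` A)" using gf[of x] by auto
  qed
  show ?thesis
  proof (rule that[of "f -` inside (path_image d)" "f -` outside (path_image d)"])
    show "open (f -` inside (path_image d))" "open (f -` outside (path_image d))"
      using open_vimage[OF _ cf] J by auto
    show "f -` inside (path_image d) \<inter> f -` outside (path_image d) = {}" using J(5) by blast
    have "f -` inside (path_image d) \<union> f -` outside (path_image d) = f -` (- path_image d)"
      by (simp only: inside_Un_outside vimage_Un[symmetric])
    also have "\<dots> = - path_image c" unfolding im using injf by (auto simp: inj_image_mem_iff)
    finally show "f -` inside (path_image d) \<union> f -` outside (path_image d) = - path_image c" .
  qed (use cl J in auto)
qed

section \<open>Straight-line drawings of cubic graphs\<close>

locale plane_drawing =
  fixes G :: "'v graph" and pos :: "'v \<Rightarrow> real^2"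
  assumes simple: "finite_simple_graph G" and cubic: "three_regular G"
    and pos_inj: "inj_on pos (verts G)"
    and crossing: "\<And>e e'. e \<in> edges G \<Longrightarrow> e' \<in> edges G \<Longrightarrow> e \<noteq> e' \<Longrightarrow>
       convex hull (pos ` e) \<inter> convex hull (pos ` e') \<subseteq> pos ` (e \<inter> e')"
begin

definition drawing :: "(real^2) set" where
  "drawing = (\<Union>e\<in>edges G. convex hull (pos ` e))"

text \<open>The faces at the midpoint of \<open>e\<close> are those at any other interior point of \<open>e\<close>.\<close>

definition edge_faces :: "'v set \<Rightarrow> (real^2) set set" where
  "edge_faces e = faces_at drawing ((1/2) *\<^sub>R (\<Sum>v\<in>e. pos v))"

definition vertex_faces :: "'v \<Rightarrow> (real^2) set set" where
  "vertex_faces v = faces_at drawing (pos v)"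

lemma finite_verts: "finite (verts G)" and edge_verts: "e \<in> edges G \<Longrightarrow> e \<subseteq> verts G"
  and card_edge: "e \<in> edges G \<Longrightarrow> card e = 2"
  using simple by (auto simp: finite_simple_graph_def)

lemma finite_edges: "finite (edges G)"
  by (rule finite_subset[of _ "Pow (verts G)"]) (use edge_verts finite_verts in auto)

lemma edgeE:
  assumes "e \<in> edges G" "v \<in> e"
  obtains u where "e = {v,u}" "u \<noteq> v" "u \<in> verts G" "v \<in> verts G"
proof -
  have c: "card (e - {v}) = 1" using card_edge[OF assms(1)] assms(2) by (simp add: card.infinite)
  then obtain u where u: "e - {v} = {u}" by (meson card_1_singletonE)
  then have "e = {v,u}" "u \<noteq> v" using assms(2) by auto
  then show ?thesis using that edge_verts[OF assms(1)] by auto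
qed

lemma pos_eq_iff: "u \<in> verts G \<Longrightarrow> v \<in> verts G \<Longrightarrow> pos u = pos v \<longleftrightarrow> u = v"
  using pos_inj by (auto simp: inj_on_def)

lemma hull_edge: "convex hull (pos ` {u,v}) = closed_segment (pos u) (pos v)"
  by (simp add: segment_convex_hull)

lemma closed_hull_edge: "e \<in> edges G \<Longrightarrow> closed (convex hull (pos ` e))"
  using edge_verts finite_verts by (intro compact_imp_closed finite_imp_compact_convex_hull finite_imageI) (rule finite_subset)

lemma closed_hulls: "A \<subseteq> edges G \<Longrightarrow> closed (\<Union>e\<in>A. convex hull (pos ` e))"
  by (rule closed_UN) (use finite_edges finite_subset closed_hull_edge in auto)

lemma closed_drawing: "closed drawing"
  unfolding drawing_def by (rule closed_hulls) simp

lemma vertex_edge: "v \<in> verts G \<Longrightarrow> \<exists>e\<in>edges G. v \<in> e"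
proof -
  assume "v \<in> verts G"
  then have "card {e \<in> edges G. v \<in> e} = 3" using cubic by (simp add: three_regular_def)
  then have "{e \<in> edges G. v \<in> e} \<noteq> {}" by (metis card.empty zero_neq_numeral)
  then show ?thesis by blast
qed

text \<open>The crossing condition speaks of pairs of edges, so the vertex is first placed on an
  edge of its own.\<close>

lemma vertex_not_on_edge:
  assumes "v \<in> verts G" "e \<in> edges G" "v \<notin> e"
  shows "pos v \<notin> convex hull (pos ` e)"
proof
  assume a: "pos v \<in> convex hull (pos ` e)"
  obtain e' where e': "e' \<in> edges G" "v \<in> e'" using vertex_edge assms by blast
  have "pos v \<in> convex hull (pos ` e')" using e' by (simp add: hull_inc)
  then have "pos v \<in> pos ` (e \<inter> e')" using crossing[OF assms(2) e'(1)] a e' assms(3) by blast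
  then obtain w where w: "w \<in> e" "pos v = pos w" by auto
  then have "w \<in> verts G" using edge_verts assms by blast
  then show False using pos_eq_iff[OF assms(1)] w assms(3) by auto
qed

lemma neighbours:
  assumes "v \<in> verts G"
  obtains N where "card N = 3" "\<And>u. u \<in> N \<Longrightarrow> u \<in> verts G \<and> u \<noteq> v"
    "{e \<in> edges G. v \<in> e} = (\<lambda>u. {v,u}) ` N"
proof -
  define N where "N = {u. {v,u} \<in> edges G}"
  have ne: "u \<noteq> v" if "u \<in> N" for u
    using that card_edge[of "{v,u}"] by (auto simp: N_def)
  have eq: "{e \<in> edges G. v \<in> e} = (\<lambda>u. {v,u}) ` N"
  proof (intro equalityI subsetI)
    fix e assume "e \<in> {e \<in> edges G. v \<in> e}"
    then have e: "e \<in> edges G" "v \<in> e" by auto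
    then obtain u where "e = {v,u}" by (rule edgeE)
    then show "e \<in> (\<lambda>u. {v,u}) ` N" using e by (auto simp: N_def)
  qed (auto simp: N_def)
  have "inj_on (\<lambda>u. {v,u}) N" by (auto simp: inj_on_def doubleton_eq_iff)
  then have "card N = card {e \<in> edges G. v \<in> e}" unfolding eq by (rule card_image[symmetric])
  then have "card N = 3" using cubic assms by (simp add: three_regular_def)
  moreover have "u \<in> verts G" if "u \<in> N" for u using that edge_verts by (auto simp: N_def)
  ultimately show ?thesis using that eq ne by blast
qed

lemma isolating_ball:
  assumes "A \<subseteq> edges G" "\<And>e. e \<in> A \<Longrightarrow> x \<notin> convex hull (pos ` e)"
  obtains R where "R > 0" "ball x R \<inter> (\<Union>e\<in>A. convex hull (pos ` e)) = {}"
proof -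
  have "x \<in> - (\<Union>e\<in>A. convex hull (pos ` e))" using assms(2) by auto
  moreover have "open (- (\<Union>e\<in>A. convex hull (pos ` e)))" by (rule open_Compl[OF closed_hulls[OF assms(1)]])
  ultimately obtain R where "R > 0" "ball x R \<subseteq> - (\<Union>e\<in>A. convex hull (pos ` e))"
    using open_contains_ball by blast
  then show ?thesis using that by blast
qed

lemma segment_from_point:
  assumes "q = p + d *\<^sub>R dir \<theta>" "0 < d"
  shows "closed_segment p q = {p + r *\<^sub>R dir \<theta> | r. 0 \<le> r \<and> r \<le> d}"
proof (intro equalityI subsetI)
  fix x assume "x \<in> closed_segment p q"
  then obtain t where t: "0 \<le> t" "t \<le> 1" "x = (1 - t) *\<^sub>R p + t *\<^sub>R q" by (auto simp: closed_segment_def)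
  then have "x = p + (t * d) *\<^sub>R dir \<theta>" by (simp add: assms(1) algebra_simps)
  moreover have "0 \<le> t * d" "t * d \<le> d" using t assms(2) by (auto simp: mult_left_le_one_le)
  ultimately show "x \<in> {p + r *\<^sub>R dir \<theta> | r. 0 \<le> r \<and> r \<le> d}" by blast
next
  fix x assume "x \<in> {p + r *\<^sub>R dir \<theta> | r. 0 \<le> r \<and> r \<le> d}"
  then obtain r where r: "x = p + r *\<^sub>R dir \<theta>" "0 \<le> r" "r \<le> d" by blast
  have "x = (1 - r / d) *\<^sub>R p + (r / d) *\<^sub>R q" using assms r(1) by (simp add: algebra_simps)
  moreover have "0 \<le> r / d" "r / d \<le> 1" using r assms(2) by auto
  ultimately show "x \<in> closed_segment p q" unfolding closed_segment_def by blast
qed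

lemma faces_near_edge_point:
  assumes e: "e \<in> edges G" and x: "x \<in> convex hull (pos ` e) - pos ` e"
  obtains R C1 C2 where "R > 0" "C1 \<in> components (- drawing)" "C2 \<in> components (- drawing)"
    "\<And>y. y \<in> (convex hull (pos ` e) - pos ` e) \<inter> ball x R \<Longrightarrow> faces_at drawing y = {C1, C2}"
proof -
  obtain u v where uv: "e = {u,v}" "u \<noteq> v" "u \<in> verts G" "v \<in> verts G"
    using card_edge[OF e] edge_verts[OF e] by (auto simp: card_2_iff)
  have out: "x \<notin> convex hull (pos ` e')" if "e' \<in> edges G - {e}" for e'
    using crossing[OF e, of e'] that x by auto
  obtain R0 where R0: "R0 > 0" "ball x R0 \<inter> (\<Union>e\<in>edges G - {e}. convex hull (pos ` e)) = {}"
    by (rule isolating_ball[of "edges G - {e}" x]) (use out in auto)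
  define p where "p = pos u"
  define d where "d = dist p (pos v)"
  have "pos v \<noteq> p" using uv pos_eq_iff by (auto simp: p_def)
  then obtain \<theta> where \<theta>: "pos v = p + d *\<^sub>R dir \<theta>" unfolding d_def by (rule polar_exists)
  have d: "d > 0" using \<open>pos v \<noteq> p\<close> by (simp add: d_def)
  have seg: "convex hull (pos ` e) = {p + r *\<^sub>R dir \<theta> | r. 0 \<le> r \<and> r \<le> d}"
    unfolding uv(1) hull_edge p_def[symmetric] by (rule segment_from_point[OF \<theta> d])
  obtain t where t: "x = p + t *\<^sub>R dir \<theta>" "0 \<le> t" "t \<le> d" using x seg by auto
  have "t \<noteq> 0" using x t(1) by (auto simp: uv(1) p_def)
  have "t \<noteq> d" using x t(1) \<theta> by (auto simp: uv(1))
  \<comment> \<open>Small enough to avoid the other edges and both ends of \<open>e\<close>, which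
    are at distances \<open>t\<close> and \<open>d - t\<close> from \<open>x\<close>.\<close>
  define R where "R = min R0 (min t (d - t))"
  have R: "R > 0" "R \<le> R0" "R \<le> t" "R \<le> d - t" using R0(1) t \<open>t \<noteq> 0\<close> \<open>t \<noteq> d\<close> by (auto simp: R_def)
  have hull_ball: "convex hull (pos ` e) \<inter> ball x R = {x + r *\<^sub>R dir \<theta> | r. \<bar>r\<bar> < R}"
  proof (intro equalityI subsetI)
    fix y assume y: "y \<in> convex hull (pos ` e) \<inter> ball x R"
    then obtain r where r: "y = p + r *\<^sub>R dir \<theta>" using seg by auto
    have "y = x + (r - t) *\<^sub>R dir \<theta>" by (simp add: r t algebra_simps)
    moreover from this have "\<bar>r - t\<bar> < R" using y by (simp add: dist_norm)
    ultimately show "y \<in> {x + r *\<^sub>R dir \<theta> | r. \<bar>r\<bar> < R}" by blast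
  next
    fix y assume "y \<in> {x + r *\<^sub>R dir \<theta> | r. \<bar>r\<bar> < R}"
    then obtain r where r: "y = x + r *\<^sub>R dir \<theta>" "\<bar>r\<bar> < R" by blast
    have "y = p + (t + r) *\<^sub>R dir \<theta>" by (simp add: r t algebra_simps)
    moreover have "0 \<le> t + r" "t + r \<le> d" using r(2) R by linarith+
    ultimately have "y \<in> convex hull (pos ` e)" using seg by blast
    moreover have "y \<in> ball x R" using r by (simp add: dist_norm)
    ultimately show "y \<in> convex hull (pos ` e) \<inter> ball x R" by blast
  qed
  have "drawing \<inter> ball x R = convex hull (pos ` e) \<inter> ball x R"
  proof -
    have "ball x R \<subseteq> ball x R0" using R by auto
    then have "y \<in> convex hull (pos ` e)" if "y \<in> drawing" "y \<in> ball x R" for y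
      using that R0(2) unfolding drawing_def by blast
    moreover have "convex hull (pos ` e) \<subseteq> drawing" using e unfolding drawing_def by blast
    ultimately show ?thesis by blast
  qed
  then have "drawing \<inter> ball x R = {x + r *\<^sub>R dir \<theta> | r. \<bar>r\<bar> < R}" using hull_ball by simp
  then obtain C1 C2 where C: "C1 \<in> components (- drawing)" "C2 \<in> components (- drawing)"
    "\<And>r. \<bar>r\<bar> < R \<Longrightarrow> faces_at drawing (x + r *\<^sub>R dir \<theta>) = {C1, C2}"
    by (rule faces_near_smooth_point[OF R(1)]) (rule that; simp)
  show ?thesis
  proof (rule that[OF R(1) C(1,2)])
    fix y assume "y \<in> (convex hull (pos ` e) - pos ` e) \<inter> ball x R"
    then have "y \<in> {x + r *\<^sub>R dir \<theta> | r. \<bar>r\<bar> < R}" using hull_ball by blast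
    then show "faces_at drawing y = {C1, C2}" using C(3) by blast
  qed
qed

text \<open>The set of faces is locally constant along the open segment, which is connected.\<close>

lemma faces_at_edge_point:
  assumes e: "e \<in> edges G" and x: "x \<in> convex hull (pos ` e) - pos ` e"
  shows "faces_at drawing x = edge_faces e"
proof -
  obtain u v where uv: "e = {u,v}" "u \<noteq> v" "u \<in> verts G" "v \<in> verts G"
    using card_edge[OF e] edge_verts[OF e] by (auto simp: card_2_iff)
  let ?S = "convex hull (pos ` e) - pos ` e"
  have S: "?S = open_segment (pos u) (pos v)"
    unfolding uv(1) hull_edge open_segment_def by simp
  have conn: "connected ?S" unfolding S by (rule convex_connected[OF convex_open_segment])
  have const: "\<forall>a\<in>?S. eventually (\<lambda>b. faces_at drawing a = faces_at drawing b) (at a within ?S)"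
  proof
    fix a assume a: "a \<in> ?S"
    obtain R C1 C2 where R: "R > 0" "C1 \<in> components (- drawing)" "C2 \<in> components (- drawing)"
      "\<And>y. y \<in> ?S \<inter> ball a R \<Longrightarrow> faces_at drawing y = {C1, C2}"
      by (rule faces_near_edge_point[OF e a]) (rule that; simp)
    have fa: "faces_at drawing a = {C1, C2}" by (rule R(4)) (use a R(1) in simp)
    show "eventually (\<lambda>b. faces_at drawing a = faces_at drawing b) (at a within ?S)"
      unfolding eventually_at
    proof (intro exI[of _ R] conjI ballI impI)
      fix b assume b: "b \<in> ?S" "b \<noteq> a \<and> dist b a < R"
      have "faces_at drawing b = {C1, C2}" by (rule R(4)) (use b in \<open>simp add: dist_commute\<close>)
      then show "faces_at drawing a = faces_at drawing b" using fa by simp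
    qed (rule R(1))
  qed
  have mid: "(1/2) *\<^sub>R (\<Sum>v\<in>e. pos v) \<in> ?S"
  proof -
    have "(1/2) *\<^sub>R (\<Sum>v\<in>e. pos v) = midpoint (pos u) (pos v)" using uv by (simp add: midpoint_def)
    then show ?thesis unfolding S using uv pos_eq_iff by simp
  qed
  show ?thesis unfolding edge_faces_def by (rule connected_local_const[OF conn x mid const])
qed

lemma edge_faces_pair:
  assumes e: "e \<in> edges G"
  obtains C1 C2 where "C1 \<in> components (- drawing)" "C2 \<in> components (- drawing)" "edge_faces e = {C1, C2}"
proof -
  obtain u v where uv: "e = {u,v}" "u \<noteq> v" "u \<in> verts G" "v \<in> verts G"
    using card_edge[OF e] edge_verts[OF e] by (auto simp: card_2_iff)
  have "midpoint (pos u) (pos v) \<in> open_segment (pos u) (pos v)" using uv pos_eq_iff by simp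
  then have x: "midpoint (pos u) (pos v) \<in> convex hull (pos ` e) - pos ` e"
    unfolding uv(1) hull_edge open_segment_def by simp
  obtain R C1 C2 where R: "R > 0" "C1 \<in> components (- drawing)" "C2 \<in> components (- drawing)"
    "\<And>y. y \<in> (convex hull (pos ` e) - pos ` e) \<inter> ball (midpoint (pos u) (pos v)) R \<Longrightarrow> faces_at drawing y = {C1, C2}"
    by (rule faces_near_edge_point[OF e x]) (rule that; simp)
  have "faces_at drawing (midpoint (pos u) (pos v)) = {C1, C2}" by (rule R(4)) (use x R(1) in simp)
  then show ?thesis using that R(2,3) faces_at_edge_point[OF e x] by simp
qed

lemma sort_three:
  fixes f :: "'b \<Rightarrow> real"
  assumes "card N = 3" "inj_on f N"
  obtains a b c where "N = {a,b,c}" "f a < f b" "f b < f c"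
proof -
  obtain x y z where xyz: "N = {x,y,z}" "x \<noteq> y" "y \<noteq> z" "x \<noteq> z" using assms(1) by (auto simp: card_3_iff)
  have ne: "f x \<noteq> f y" "f y \<noteq> f z" "f x \<noteq> f z" using assms(2) xyz by (auto simp: inj_on_def)
  consider "f x < f y" "f y < f z" | "f x < f z" "f z < f y" | "f y < f x" "f x < f z"
    | "f y < f z" "f z < f x" | "f z < f x" "f x < f y" | "f z < f y" "f y < f x"
    using ne by linarith
  then show ?thesis
    by cases (use that xyz(1) in \<open>blast+\<close>)
qed

text \<open>Sorting the three neighbours by angle puts the edges at \<open>v\<close> in cyclic
  order. Consecutive edges bound a common sector, and the faces of an edge can be read off at a
  point of it close to \<open>v\<close>.\<close>

lemma vertex_faces_structure:
  assumes v: "v \<in> verts G"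
  obtains C1 C2 C3 where "vertex_faces v = {C1, C2, C3}"
    "edge_faces ` {e \<in> edges G. v \<in> e} = {{C1,C2}, {C2,C3}, {C3,C1}}"
proof -
  obtain N where N: "card N = 3" "\<And>u. u \<in> N \<Longrightarrow> u \<in> verts G \<and> u \<noteq> v"
    "{e \<in> edges G. v \<in> e} = (\<lambda>u. {v,u}) ` N" by (rule neighbours[OF v]) (rule that; simp)
  have finN: "finite N" "N \<noteq> {}" using N(1) card.infinite by fastforce+
  have edge: "{v,u} \<in> edges G" if "u \<in> N" for u using N(3) that by blast
  define p where "p = pos v"
  have ne: "pos u \<noteq> p" if "u \<in> N" for u using N(2)[OF that] v pos_eq_iff by (auto simp: p_def)
  define \<theta> where "\<theta> u = (SOME \<phi>. 0 \<le> \<phi> \<and> \<phi> < 2 * pi \<and> pos u = p + dist p (pos u) *\<^sub>R dir \<phi>)" for u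
  have \<theta>: "0 \<le> \<theta> u" "\<theta> u < 2 * pi" "pos u = p + dist p (pos u) *\<^sub>R dir (\<theta> u)" if u: "u \<in> N" for u
  proof -
    obtain \<phi> where "0 \<le> \<phi>" "\<phi> < 0 + 2 * pi" "pos u = p + dist p (pos u) *\<^sub>R dir \<phi>"
      using ne[OF u] by (rule polar_exists)
    then have "\<exists>\<phi>. 0 \<le> \<phi> \<and> \<phi> < 2 * pi \<and> pos u = p + dist p (pos u) *\<^sub>R dir \<phi>" by auto
    from someI_ex[OF this] show "0 \<le> \<theta> u" "\<theta> u < 2 * pi" "pos u = p + dist p (pos u) *\<^sub>R dir (\<theta> u)"
      unfolding \<theta>_def by blast+
  qed
  have d: "0 < dist p (pos u)" if "u \<in> N" for u using ne[OF that] by auto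
  have seg: "convex hull (pos ` {v,u}) = {p + r *\<^sub>R dir (\<theta> u) | r. 0 \<le> r \<and> r \<le> dist p (pos u)}" if "u \<in> N" for u
    unfolding hull_edge p_def[symmetric] by (rule segment_from_point[OF \<theta>(3)[OF that] d[OF that]])
  define A where "A = {e \<in> edges G. v \<notin> e}"
  obtain R0 where R0: "R0 > 0" "ball p R0 \<inter> (\<Union>e\<in>A. convex hull (pos ` e)) = {}"
    by (rule isolating_ball[of A p]) (use vertex_not_on_edge[OF v] in \<open>auto simp: A_def p_def\<close>)
  define R where "R = min R0 (Min ((\<lambda>u. dist p (pos u)) ` N))"
  have R: "R > 0" "R \<le> R0" using R0(1) finN d by (auto simp: R_def)
  have Rd: "R \<le> dist p (pos u)" if "u \<in> N" for u
  proof -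
    have "Min ((\<lambda>u. dist p (pos u)) ` N) \<le> dist p (pos u)" using finN that by (intro Min_le) auto
    then show ?thesis by (simp add: R_def)
  qed
  \<comment> \<open>Two edges leaving \<open>v\<close> in the same direction would share the point
    at distance \<open>R/2\<close>.\<close>
  have inj: "inj_on \<theta> N"
  proof (rule inj_onI, rule ccontr)
    fix u w assume u: "u \<in> N" "w \<in> N" "\<theta> u = \<theta> w" "u \<noteq> w"
    define y where "y = p + (R/2) *\<^sub>R dir (\<theta> u)"
    have "y \<in> convex hull (pos ` {v,x})" if "x \<in> {u, w}" for x
    proof -
      have x: "x \<in> N" "\<theta> x = \<theta> u" using that u by auto
      show ?thesis unfolding seg[OF x(1)] x(2) y_def
        by (rule CollectI, rule exI[of _ "R/2"]) (use Rd[OF x(1)] R(1) in auto)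
    qed
    then have "y \<in> convex hull (pos ` {v,u})" "y \<in> convex hull (pos ` {v,w})" by simp_all
    moreover have "{v,u} \<noteq> {v,w}" using u(4) by (auto simp: doubleton_eq_iff)
    ultimately have "y \<in> pos ` ({v,u} \<inter> {v,w})" using crossing[OF edge[OF u(1)] edge[OF u(2)]] by blast
    moreover have one: "{v,u} \<inter> {v,w} = {v}" using u(4) N(2)[OF u(1)] N(2)[OF u(2)] by auto
    ultimately have "y = pos v" unfolding one by simp
    then have "(R/2) *\<^sub>R dir (\<theta> u) = 0" by (simp add: y_def p_def)
    then show False using R(1) by (metis half_gt_zero_iff less_irrefl norm_dir norm_zero scaleR_eq_0_iff zero_neq_one)
  qed
  obtain a b c where abc: "N = {a,b,c}" "\<theta> a < \<theta> b" "\<theta> b < \<theta> c" by (rule sort_three[OF N(1) inj])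
  have ang: "\<theta> c < \<theta> a + 2 * pi" using \<theta>(1)[of a] \<theta>(2)[of c] abc(1) by auto
  have draw: "drawing \<inter> ball p R = {p + r *\<^sub>R dir \<theta>' | r \<theta>'. 0 \<le> r \<and> r < R \<and> \<theta>' \<in> {\<theta> a, \<theta> b, \<theta> c}}"
  proof (intro equalityI subsetI)
    fix y assume y: "y \<in> drawing \<inter> ball p R"
    then obtain e where e: "e \<in> edges G" "y \<in> convex hull (pos ` e)" unfolding drawing_def by blast
    have "y \<in> ball p R0" using y R(2) by auto
    then have "v \<in> e" using e R0(2) unfolding A_def by blast
    then obtain u where u: "u \<in> N" "e = {v,u}" using N(3) e(1) by blast
    then obtain r where r: "y = p + r *\<^sub>R dir (\<theta> u)" "0 \<le> r" using e(2) seg by blast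
    have "r < R" using y r by (simp add: dist_norm)
    moreover have "\<theta> u \<in> {\<theta> a, \<theta> b, \<theta> c}" using u(1) abc(1) by blast
    ultimately show "y \<in> {p + r *\<^sub>R dir \<theta>' | r \<theta>'. 0 \<le> r \<and> r < R \<and> \<theta>' \<in> {\<theta> a, \<theta> b, \<theta> c}}"
      using r by blast
  next
    fix y assume "y \<in> {p + r *\<^sub>R dir \<theta>' | r \<theta>'. 0 \<le> r \<and> r < R \<and> \<theta>' \<in> {\<theta> a, \<theta> b, \<theta> c}}"
    then obtain r \<theta>' where r: "y = p + r *\<^sub>R dir \<theta>'" "0 \<le> r" "r < R" "\<theta>' \<in> {\<theta> a, \<theta> b, \<theta> c}" by blast
    then obtain u where u: "u \<in> N" "\<theta>' = \<theta> u" using abc(1) by blast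
    have "y \<in> convex hull (pos ` {v,u})" unfolding seg[OF u(1)] using r u(2) Rd[OF u(1)] by force
    then have "y \<in> drawing" unfolding drawing_def using edge[OF u(1)] by blast
    moreover have "y \<in> ball p R" using r by (simp add: dist_norm)
    ultimately show "y \<in> drawing \<inter> ball p R" by blast
  qed
  obtain C1 C2 C3 where C: "faces_at drawing p = {C1, C2, C3}"
    "\<And>r. 0 < r \<Longrightarrow> r < R \<Longrightarrow> faces_at drawing (p + r *\<^sub>R dir (\<theta> a)) = {C3, C1}"
    "\<And>r. 0 < r \<Longrightarrow> r < R \<Longrightarrow> faces_at drawing (p + r *\<^sub>R dir (\<theta> b)) = {C1, C2}"
    "\<And>r. 0 < r \<Longrightarrow> r < R \<Longrightarrow> faces_at drawing (p + r *\<^sub>R dir (\<theta> c)) = {C2, C3}"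
    by (rule faces_near_triple_point[OF R(1) abc(2,3) ang draw]) (rule that; simp)
  have ef: "edge_faces {v,u} = faces_at drawing (p + (R/2) *\<^sub>R dir (\<theta> u))" if u: "u \<in> N" for u
  proof (rule faces_at_edge_point[OF edge[OF u], symmetric])
    let ?y = "p + (R/2) *\<^sub>R dir (\<theta> u)"
    have "?y \<in> convex hull (pos ` {v,u})" unfolding seg[OF u]
      by (rule CollectI, rule exI[of _ "R/2"]) (use Rd[OF u] R(1) in auto)
    moreover have "dist p ?y = R/2" using R(1) by (simp add: dist_norm)
    then have "?y \<noteq> pos v" "?y \<noteq> pos u" using R(1) Rd[OF u] by (auto simp: p_def)
    ultimately show "?y \<in> convex hull (pos ` {v,u}) - pos ` {v,u}" by blast
  qed
  have half: "0 < R/2" "R/2 < R" using R(1) by auto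
  have "edge_faces {v,a} = {C3,C1}" "edge_faces {v,b} = {C1,C2}" "edge_faces {v,c} = {C2,C3}"
    using ef[of a] ef[of b] ef[of c] C(2-4)[OF half] abc(1) by auto
  then have im: "edge_faces ` {e \<in> edges G. v \<in> e} = {{C1,C2}, {C2,C3}, {C3,C1}}"
    unfolding N(3) abc(1) by auto
  have "vertex_faces v = {C1, C2, C3}" using C(1) by (simp add: vertex_faces_def p_def)
  from this im show ?thesis by (rule that)
qed

end

section \<open>Walks and cycles\<close>

fun path_edges :: "'a list \<Rightarrow> 'a set set" where
  "path_edges (x # y # zs) = insert {x,y} (path_edges (y # zs))"
| "path_edges _ = {}"

text \<open>Edges are counted with multiplicity, which makes the parity additive under
  concatenation; the set \<open>path_edges\<close> forgets multiplicity. The two agree for walks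
  without repeated vertices.\<close>

fun odd_walk :: "'a set set \<Rightarrow> 'a list \<Rightarrow> bool" where
  "odd_walk z (x # y # zs) \<longleftrightarrow> ({x,y} \<in> z) \<noteq> odd_walk z (y # zs)"
| "odd_walk z _ \<longleftrightarrow> False"

abbreviation walk_in :: "'a set set \<Rightarrow> 'a list \<Rightarrow> bool" where
  "walk_in E xs \<equiv> successively (\<lambda>x y. {x,y} \<in> E) xs"

lemma path_edges_subset: "e \<in> path_edges xs \<Longrightarrow> e \<subseteq> set xs"
  by (induction xs rule: path_edges.induct) auto

lemma path_edges_walk: "walk_in E xs \<Longrightarrow> path_edges xs \<subseteq> E"
  by (induction xs rule: path_edges.induct) auto

lemma finite_path_edges: "finite (path_edges xs)"
  by (induction xs rule: path_edges.induct) auto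

lemma path_edges_cover: "2 \<le> length xs \<Longrightarrow> x \<in> set xs \<Longrightarrow> \<exists>e\<in>path_edges xs. x \<in> e"
proof (induction xs rule: path_edges.induct)
  case (1 a b zs)
  show ?case
  proof (cases "x = a \<or> zs = []")
    case True
    then show ?thesis using 1(3) by (intro bexI[of _ "{a,b}"]) auto
  next
    case False
    then have "2 \<le> length (b # zs)" "x \<in> set (b # zs)" using 1(3) by (cases zs; auto)+
    then show ?thesis using 1(1) by auto
  qed
qed auto

lemma odd_walk_append: "odd_walk z (xs @ y # ys) \<longleftrightarrow> odd_walk z (xs @ [y]) \<noteq> odd_walk z (y # ys)"
proof (induction xs)
  case (Cons a xs)
  then show ?case by (cases xs) auto
qed simp

lemma odd_walk_rev: "odd_walk z (rev xs) \<longleftrightarrow> odd_walk z xs"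
proof (induction xs rule: path_edges.induct)
  case (1 x y zs)
  have "odd_walk z (rev (x # y # zs)) \<longleftrightarrow> odd_walk z (rev zs @ y # [x])" by simp
  also have "\<dots> \<longleftrightarrow> odd_walk z (rev (y # zs)) \<noteq> odd_walk z [y,x]" by (subst odd_walk_append) simp
  finally show ?case using 1 by (auto simp: insert_commute)
qed auto

lemma odd_walk_card: "distinct xs \<Longrightarrow> odd_walk z xs \<longleftrightarrow> odd (card (z \<inter> path_edges xs))"
proof (induction xs rule: path_edges.induct)
  case (1 x y zs)
  have new: "{x,y} \<notin> path_edges (y # zs)" using path_edges_subset[of "{x,y}" "y # zs"] 1(2) by auto
  have "z \<inter> path_edges (x # y # zs) =
    (if {x,y} \<in> z then insert {x,y} (z \<inter> path_edges (y # zs)) else z \<inter> path_edges (y # zs))" by auto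
  then have "card (z \<inter> path_edges (x # y # zs)) = (if {x,y} \<in> z then 1 else 0) + card (z \<inter> path_edges (y # zs))"
    using new finite_subset[OF Int_lower2 finite_path_edges, of z "y # zs"] by simp
  then show ?case using 1 by auto
qed auto

text \<open>The edge of the path at \<open>hd xs\<close> leads to the second vertex, which differs
  from the last one as soon as there are three vertices.\<close>

lemma closing_edge_new:
  assumes "distinct xs" "3 \<le> length xs"
  shows "{last xs, hd xs} \<notin> path_edges xs"
proof -
  obtain x y z zs where xs: "xs = x # y # z # zs"
    using assms(2) by (metis Suc_le_length_iff numeral_3_eq_3)
  have l: "last xs \<in> set (z # zs)" unfolding xs by (metis last_ConsR last_in_set list.distinct(1))
  have "x \<notin> set (y # z # zs)" "y \<notin> set (z # zs)" using assms(1) xs by auto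
  then have "{last xs, x} \<noteq> {x,y}" using l by (auto simp: doubleton_eq_iff)
  moreover have "{last xs, x} \<notin> path_edges (y # z # zs)"
    using path_edges_subset[of "{last xs, x}" "y # z # zs"] \<open>x \<notin> set (y # z # zs)\<close> by blast
  ultimately have "{last xs, x} \<notin> insert {x,y} (path_edges (y # z # zs))" by blast
  then show ?thesis unfolding xs by simp
qed

lemma reachable_distinct_walk:
  assumes "(a, b) \<in> {(x, y). {x,y} \<in> E}\<^sup>*"
  shows "\<exists>xs. xs \<noteq> [] \<and> hd xs = a \<and> last xs = b \<and> distinct xs \<and> walk_in E xs"
  using assms
proof (induction rule: converse_rtrancl_induct)
  case base
  show ?case by (intro exI[of _ "[b]"]) simp
next
  case (step a y)
  then obtain xs where xs: "xs \<noteq> []" "hd xs = y" "last xs = b" "distinct xs" "walk_in E xs" by blast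
  show ?case
  proof (cases "a \<in> set xs")
    case True
    \<comment> \<open>The walk returns to \<open>a\<close>, so only its part from \<open>a\<close>
      on is kept.\<close>
    then obtain ps qs where pq: "xs = ps @ a # qs" by (meson split_list)
    then have "distinct (a # qs)" "walk_in E (a # qs)" "last (a # qs) = b"
      using xs by (auto simp: successively_append_iff)
    then show ?thesis by (intro exI[of _ "a # qs"]) auto
  next
    case False
    obtain ys where ys: "xs = y # ys" using xs(1,2) by (cases xs) auto
    show ?thesis by (rule exI[of _ "a # xs"]) (use xs False step.hyps(1) ys in auto)
  qed
qed

text \<open>A closed walk with a repeated vertex splits into two shorter ones, one of which is odd.\<close>

lemma no_odd_closed_walk:
  assumes cyc: "\<And>xs. distinct xs \<Longrightarrow> 3 \<le> length xs \<Longrightarrow> walk_in E xs \<Longrightarrow> {last xs, hd xs} \<in> E \<Longrightarrow>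
      \<not> odd_walk z (xs @ [hd xs])"
    and E: "\<And>e. e \<in> E \<Longrightarrow> card e = 2"
    and w: "xs \<noteq> []" "walk_in E xs" "hd xs = last xs"
  shows "\<not> odd_walk z xs"
  using w
proof (induction "length xs" arbitrary: xs rule: less_induct)
  case less
  show ?case
  proof (cases "tl xs = []")
    case True
    then have "xs = [hd xs]" using less.prems(1) by (cases xs) auto
    then show ?thesis by (metis odd_walk.simps(3))
  next
    case False
    define ys where "ys = butlast xs"
    have xs: "xs = ys @ [hd xs]" using less.prems by (simp add: ys_def)
    have ys: "ys \<noteq> []" using False less.prems(1) unfolding ys_def by (cases xs) auto
    then have hd: "hd ys = hd xs" using xs by (metis hd_append)
    have walk: "walk_in E ys" "{last ys, hd xs} \<in> E"
    proof -
      have "walk_in E (ys @ [hd xs])" using less.prems(2) xs by simp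
      then show "walk_in E ys" "{last ys, hd xs} \<in> E" using ys by (auto simp: successively_append_iff)
    qed
    show ?thesis
    proof (cases "distinct ys")
      case True
      \<comment> \<open>One vertex would need a loop, and two vertices give an edge traversed back
        and forth, which counts twice; longer walks are genuine cycles.\<close>
      consider "length ys = 1" | "length ys = 2" | "3 \<le> length ys" using ys by (cases "length ys") force+
      then show ?thesis
      proof cases
        case 1
        then obtain a where "ys = [a]" by (metis One_nat_def length_0_conv length_Suc_conv)
        then have "{a} \<in> E" using walk(2) hd by simp
        then show ?thesis using E[of "{a}"] by simp
      next
        case 2
        then obtain a b where "ys = [a,b]" by (metis One_nat_def Suc_1 length_0_conv length_Suc_conv)
        then have "xs = [a,b,a]" using xs hd by simp
        then show ?thesis by (auto simp: insert_commute)
      next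
        case 3
        then show ?thesis using cyc[OF True 3 walk(1)] walk(2) hd xs by simp
      qed
    next
      case False
      then obtain as bs cs y where y: "ys = as @ [y] @ bs @ [y] @ cs" using not_distinct_decomp by blast
      \<comment> \<open>The loop between the two visits of \<open>y\<close>, and the walk with this
        loop cut out; their parities add up.\<close>
      define u where "u = y # bs @ [y]"
      define v where "v = as @ y # cs @ [hd xs]"
      have xs3: "xs = as @ y # bs @ y # cs @ [hd xs]" using xs y by simp
      have "walk_in E (as @ y # bs @ y # cs @ [hd xs])" using less.prems(2) xs3 by simp
      then have "walk_in E u" "walk_in E v"
        unfolding u_def v_def by (auto simp: successively_append_iff successively_Cons hd_append split: if_splits)
      moreover have "hd u = last u" by (simp add: u_def)
      moreover have "hd v = last v"
      proof -
        have "hd v = hd ys" unfolding v_def y by (cases as) auto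
        then show ?thesis using hd by (simp add: v_def)
      qed
      moreover have "length u < length xs" "length v < length xs"
        unfolding u_def v_def by (subst xs3, simp)+
      moreover have "u \<noteq> []" "v \<noteq> []" by (simp_all add: u_def v_def)
      ultimately have "\<not> odd_walk z u" "\<not> odd_walk z v" using less.hyps by blast+
      moreover have "odd_walk z xs \<longleftrightarrow> (odd_walk z (as @ [y]) \<noteq> odd_walk z u) \<noteq> odd_walk z (y # cs @ [hd xs])"
      proof -
        have "odd_walk z xs \<longleftrightarrow> odd_walk z (as @ [y]) \<noteq> odd_walk z (y # bs @ y # cs @ [hd xs])"
          by (subst xs3) (rule odd_walk_append)
        moreover have "odd_walk z ((y # bs) @ y # cs @ [hd xs]) \<longleftrightarrow> odd_walk z ((y # bs) @ [y]) \<noteq> odd_walk z (y # cs @ [hd xs])"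
          by (rule odd_walk_append)
        ultimately show ?thesis by (auto simp: u_def)
      qed
      moreover have "odd_walk z v \<longleftrightarrow> odd_walk z (as @ [y]) \<noteq> odd_walk z (y # cs @ [hd xs])"
        unfolding v_def by (rule odd_walk_append)
      ultimately show ?thesis by blast
    qed
  qed
qed

text \<open>The potential is the parity of a walk from a root. Two walks to the same vertex have
  equal parity because one followed by the reverse of the other is closed.\<close>

lemma vertex_potential:
  fixes E :: "'a set set"
  assumes cyc: "\<And>xs. xs \<noteq> [] \<Longrightarrow> walk_in E xs \<Longrightarrow> hd xs = last xs \<Longrightarrow> \<not> odd_walk z xs"
    and conn: "\<And>u v. u \<in> V \<Longrightarrow> v \<in> V \<Longrightarrow> (u, v) \<in> {(x, y). {x,y} \<in> E}\<^sup>*"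
    and EV: "\<And>e. e \<in> E \<Longrightarrow> e \<subseteq> V"
  shows "\<exists>p :: 'a \<Rightarrow> bool. \<forall>u v. {u,v} \<in> E \<longrightarrow> ((p u \<noteq> p v) \<longleftrightarrow> {u,v} \<in> z)"
proof (cases "V = {}")
  case True
  then have "{u,v} \<notin> E" for u v using EV[of "{u,v}"] by auto
  then show ?thesis by simp
next
  case False
  then obtain r where r: "r \<in> V" by auto
  define W where "W v xs \<longleftrightarrow> xs \<noteq> [] \<and> hd xs = r \<and> last xs = v \<and> walk_in E xs" for v xs
  have snoc: "\<exists>ps. xs = ps @ [v]" if "W v xs" for v xs
    using that append_butlast_last_id[of xs] unfolding W_def by (intro exI[of _ "butlast xs"]) auto
  have uniq: "odd_walk z xs \<longleftrightarrow> odd_walk z ys" if WW: "W v xs" "W v ys" for v xs ys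
  proof -
    obtain ps where ps: "xs = ps @ [v]" using snoc[OF WW(1)] by blast
    obtain qs where qs: "ys = qs @ [v]" using snoc[OF WW(2)] by blast
    define c where "c = ps @ v # rev qs"
    have "walk_in E (rev ys)" using that(2) unfolding W_def
      by (subst successively_rev) (simp add: insert_commute)
    then have "walk_in E (v # rev qs)" by (simp add: qs)
    moreover have "walk_in E (ps @ [v])" using that(1) ps by (simp add: W_def)
    ultimately have "walk_in E c" unfolding c_def by (auto simp: successively_append_iff)
    moreover have "hd c = r" using that(1) ps unfolding W_def c_def by (cases ps) auto
    moreover have "last c = r"
    proof (cases qs)
      case Nil then show ?thesis using that(2) qs unfolding W_def c_def by auto
    next
      case (Cons a as) then show ?thesis using that(2) qs unfolding W_def c_def by (auto simp: last_rev)
    qed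
    moreover have "c \<noteq> []" by (simp add: c_def)
    ultimately have "\<not> odd_walk z c" using cyc by metis
    moreover have "odd_walk z c \<longleftrightarrow> odd_walk z xs \<noteq> odd_walk z (v # rev qs)"
      unfolding c_def ps by (rule odd_walk_append)
    moreover have "odd_walk z (v # rev qs) \<longleftrightarrow> odd_walk z ys" using odd_walk_rev[of z ys] by (simp add: qs)
    ultimately show ?thesis by blast
  qed
  have ex: "\<exists>xs. W v xs" if "v \<in> V" for v
    using reachable_distinct_walk[OF conn[OF r that]] unfolding W_def by blast
  define p where "p v = (\<exists>xs. W v xs \<and> odd_walk z xs)" for v
  have p: "p v \<longleftrightarrow> odd_walk z xs" if "W v xs" for v xs using uniq that unfolding p_def by blast
  have pot: "(p u \<noteq> p v) \<longleftrightarrow> {u,v} \<in> z" if uv: "{u,v} \<in> E" for u v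
  proof -
    have "u \<in> V" using EV[OF uv] by simp
    then obtain xs where xs: "W u xs" using ex by blast
    obtain ps where ps: "xs = ps @ [u]" using snoc[OF xs] by blast
    have "W v (xs @ [v])" using xs uv unfolding W_def by (auto simp: successively_append_iff)
    then have "p v \<longleftrightarrow> odd_walk z (ps @ u # [v])" using p ps by simp
    also have "\<dots> \<longleftrightarrow> odd_walk z xs \<noteq> ({u,v} \<in> z)" unfolding ps by (subst odd_walk_append) simp
    finally show ?thesis using p[OF xs] by blast
  qed
  show ?thesis by (intro exI[of _ p] allI impI) (rule pot)
qed

section \<open>The dual of a three-connected drawing\<close>

locale three_connected_drawing = plane_drawing +
  assumes conn3: "three_connected G" and finite_faces: "finite (components (- drawing))"
begin

definition is_cycle :: "'a list \<Rightarrow> bool" where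
  "is_cycle xs \<longleftrightarrow> distinct xs \<and> 3 \<le> length xs \<and> walk_in (edges G) xs \<and> {last xs, hd xs} \<in> edges G"

definition cycle_edges :: "'a list \<Rightarrow> 'a set set" where
  "cycle_edges xs = insert {last xs, hd xs} (path_edges xs)"

lemma cycle_edges_subset: "is_cycle xs \<Longrightarrow> cycle_edges xs \<subseteq> edges G"
  using path_edges_walk unfolding is_cycle_def cycle_edges_def by auto

lemma arc_along_path:
  assumes "distinct xs" "2 \<le> length xs" "walk_in (edges G) xs"
  shows "\<exists>c. arc c \<and> pathstart c = pos (hd xs) \<and> pathfinish c = pos (last xs) \<and>
     path_image c = (\<Union>e\<in>path_edges xs. convex hull (pos ` e))"
  using assms
proof (induction xs rule: path_edges.induct)
  case (1 x y zs)
  have e: "{x,y} \<in> edges G" using 1(4) by simp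
  then have xy: "x \<in> verts G" "y \<in> verts G" "x \<noteq> y" using edge_verts[OF e] card_edge[OF e] by auto
  then have ne: "pos x \<noteq> pos y" using pos_eq_iff by simp
  show ?case
  proof (cases "zs = []")
    case True
    show ?thesis
      by (rule exI[of _ "linepath (pos x) (pos y)"]) (use True ne in \<open>simp add: segment_convex_hull\<close>)
  next
    case False
    have "2 \<le> length (y # zs)" using False by (cases zs) auto
    then obtain c where c: "arc c" "pathstart c = pos y" "pathfinish c = pos (last (y # zs))"
      "path_image c = (\<Union>e\<in>path_edges (y # zs). convex hull (pos ` e))"
      using 1 by auto
    \<comment> \<open>By the crossing condition the new segment meets the rest of the path only in
      the vertex \<open>y\<close>.\<close>
    have "path_image (linepath (pos x) (pos y)) \<inter> path_image c \<subseteq> {pathstart c}"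
    proof
      fix q assume "q \<in> path_image (linepath (pos x) (pos y)) \<inter> path_image c"
      then obtain e' where e': "e' \<in> path_edges (y # zs)" "q \<in> convex hull (pos ` e')"
        "q \<in> convex hull (pos ` {x,y})" using c(4) by (auto simp: segment_convex_hull)
      have sub: "e' \<subseteq> set (y # zs)" using path_edges_subset[OF e'(1)] .
      then have x: "x \<notin> e'" using 1(2) by auto
      have "walk_in (edges G) (y # zs)" using 1(4) by simp
      then have "e' \<in> edges G" using path_edges_walk e'(1) by blast
      moreover have "{x,y} \<noteq> e'" using x by blast
      ultimately have "q \<in> pos ` ({x,y} \<inter> e')" using crossing[OF e, of e'] e' by blast
      then show "q \<in> {pathstart c}" using x c(2) by auto
    qed
    then have "arc (linepath (pos x) (pos y) +++ c)" using c ne by (intro arc_join) auto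
    moreover have "path_image (linepath (pos x) (pos y) +++ c) =
        (\<Union>e\<in>path_edges (x # y # zs). convex hull (pos ` e))"
      using c by (simp add: path_image_join segment_convex_hull)
    ultimately show ?thesis using c(3) False
      by (intro exI[of _ "linepath (pos x) (pos y) +++ c"]) simp
  qed
qed auto

lemma loop_along_cycle:
  assumes "is_cycle xs"
  obtains c where "simple_path c" "pathfinish c = pathstart c"
    "path_image c = (\<Union>e\<in>cycle_edges xs. convex hull (pos ` e))"
proof -
  have xs: "distinct xs" "3 \<le> length xs" "walk_in (edges G) xs" and e: "{last xs, hd xs} \<in> edges G"
    using assms by (auto simp: is_cycle_def)
  have "2 \<le> length xs" using xs(2) by simp
  from arc_along_path[OF xs(1) this xs(3)] obtain c where c: "arc c" "pathstart c = pos (hd xs)"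
    "pathfinish c = pos (last xs)" "path_image c = (\<Union>e\<in>path_edges xs. convex hull (pos ` e))" by blast
  let ?l = "linepath (pos (last xs)) (pos (hd xs))"
  have "last xs \<in> verts G" "hd xs \<in> verts G" "last xs \<noteq> hd xs" using edge_verts[OF e] card_edge[OF e] by auto
  then have l: "arc ?l" using pos_eq_iff by simp
  have "path_image c \<inter> path_image ?l \<subseteq> {pathstart c, pathstart ?l}"
  proof
    fix q assume "q \<in> path_image c \<inter> path_image ?l"
    then obtain e' where e': "e' \<in> path_edges xs" "q \<in> convex hull (pos ` e')"
      "q \<in> convex hull (pos ` {last xs, hd xs})" using c(4) by (auto simp: segment_convex_hull)
    have "e' \<in> edges G" using path_edges_walk[OF xs(3)] e'(1) by blast
    moreover have "{last xs, hd xs} \<noteq> e'" using closing_edge_new[OF xs(1,2)] e'(1) by blast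
    ultimately have "q \<in> pos ` ({last xs, hd xs} \<inter> e')" using crossing[OF e, of e'] e' by blast
    then show "q \<in> {pathstart c, pathstart ?l}" using c(2) by auto
  qed
  then have "simple_path (c +++ ?l)" using c l by (intro simple_path_join_loop) auto
  moreover have "path_image (c +++ ?l) = (\<Union>e\<in>cycle_edges xs. convex hull (pos ` e))"
    using c by (auto simp: path_image_join cycle_edges_def segment_convex_hull)
  ultimately show ?thesis using c by (intro that[of "c +++ ?l"]) simp_all
qed

lemma interior_drawing: "interior drawing = {}"
proof -
  have "interior (\<Union>e\<in>A. convex hull (pos ` e)) = {}" if "A \<subseteq> edges G" for A
  proof -
    have "finite A" using that finite_edges finite_subset by blast
    then show ?thesis using that
    proof (induction A)
      case (insert e A)
      then have e: "e \<in> edges G" and A: "A \<subseteq> edges G" by auto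
      obtain u v where uv: "e = {u,v}" using card_edge[OF e] by (auto simp: card_2_iff)
      have "interior (convex hull (pos ` e)) = {}"
        unfolding uv hull_edge by (rule interior_closed_segment_ge2) simp
      then have "interior (convex hull (pos ` e) \<union> (\<Union>e\<in>A. convex hull (pos ` e))) = interior (\<Union>e\<in>A. convex hull (pos ` e))"
        using interior_closed_Un_empty_interior[of "\<Union>e\<in>A. convex hull (pos ` e)" "convex hull (pos ` e)"]
          closed_hulls[OF A] by (simp add: Un_commute)
      then show ?case using insert.IH A by simp
    qed simp
  qed
  then show ?thesis unfolding drawing_def by simp
qed

text \<open>The drawing has empty interior, so the faces inside \<open>I\<close> are dense in
  \<open>I\<close>. As there are finitely many, the closure of their union is the union of their
  closures, one of which contains \<open>x\<close>.\<close>

lemma face_in_open_set: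
  assumes I: "open I" and x: "x \<in> closure I"
    and dec: "\<And>C. C \<in> components (- drawing) \<Longrightarrow> C \<subseteq> I \<or> C \<inter> I = {}"
  obtains C where "C \<in> faces_at drawing x" "C \<subseteq> I"
proof -
  let ?S = "\<Union>{C \<in> components (- drawing). C \<subseteq> I}"
  have "I \<inter> - drawing \<subseteq> ?S"
  proof
    fix y assume y: "y \<in> I \<inter> - drawing"
    then obtain C where C: "C \<in> components (- drawing)" "y \<in> C" using Union_components[of "- drawing"] by blast
    then have "C \<subseteq> I" using dec[OF C(1)] y by blast
    then show "y \<in> ?S" using C by blast
  qed
  moreover have "I \<subseteq> closure (I \<inter> - drawing)"
    using open_Int_closure_subset[OF I, of "- drawing"] by (simp add: closure_complement interior_drawing)
  ultimately have "I \<subseteq> closure ?S" using closure_mono by blast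
  then have "closure I \<subseteq> closure ?S" by (simp add: closure_minimal)
  moreover have "closure ?S \<subseteq> \<Union>(closure ` {C \<in> components (- drawing). C \<subseteq> I})"
  proof (rule closure_minimal)
    show "?S \<subseteq> \<Union>(closure ` {C \<in> components (- drawing). C \<subseteq> I})" using closure_subset by fast
    show "closed (\<Union>(closure ` {C \<in> components (- drawing). C \<subseteq> I}))"
      using finite_faces by (intro closed_Union) auto
  qed
  ultimately obtain C where "C \<in> components (- drawing)" "C \<subseteq> I" "x \<in> closure C" using x by blast
  then show ?thesis by (intro that[of C]) (auto simp: faces_at_def)
qed

lemma edge_interior_point:
  assumes "e \<in> edges G"
  obtains x where "x \<in> convex hull (pos ` e) - pos ` e" "faces_at drawing x = edge_faces e"
proof -
  obtain u v where uv: "e = {u,v}" "u \<noteq> v" "u \<in> verts G" "v \<in> verts G"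
    using card_edge[OF assms] edge_verts[OF assms] by (auto simp: card_2_iff)
  have "midpoint (pos u) (pos v) \<in> open_segment (pos u) (pos v)" using uv pos_eq_iff by simp
  then have x: "midpoint (pos u) (pos v) \<in> convex hull (pos ` e) - pos ` e"
    unfolding uv(1) hull_edge open_segment_def by simp
  then show ?thesis using that faces_at_edge_point[OF assms x] by blast
qed

text \<open>\<open>Y\<close> collects the faces on one side of the Jordan curve along the cycle: a
  face is connected and avoids the curve. A point of the curve lies in the closures of both sides,
  whereas a point off it has a neighbourhood within its own side.\<close>

lemma cycle_separates_faces:
  assumes cyc: "is_cycle xs"
  obtains Y where
    "\<forall>e\<in>cycle_edges xs. edge_faces e \<inter> Y \<noteq> {} \<and> edge_faces e - Y \<noteq> {}"
    "\<forall>e\<in>edges G - cycle_edges xs. edge_faces e \<subseteq> Y \<or> edge_faces e \<inter> Y = {}"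
proof -
  obtain c where c: "simple_path c" "pathfinish c = pathstart c"
    "path_image c = (\<Union>e\<in>cycle_edges xs. convex hull (pos ` e))" by (rule loop_along_cycle[OF cyc])
  obtain I J where IJ: "open I" "open J" "I \<inter> J = {}" "I \<union> J = - path_image c"
    "path_image c \<subseteq> closure I" "path_image c \<subseteq> closure J" by (rule real2_Jordan[OF c(1,2)])
  have img: "path_image c \<subseteq> drawing"
    unfolding c(3) drawing_def using cycle_edges_subset[OF cyc] by blast
  have dec: "(C \<subseteq> I \<and> C \<inter> J = {}) \<or> (C \<subseteq> J \<and> C \<inter> I = {})" if C: "C \<in> components (- drawing)" for C
  proof -
    have "C \<subseteq> I \<union> J" using in_components_subset[OF C] img IJ(4) by blast
    then have "C \<inter> I = {} \<or> C \<inter> J = {}"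
      using connectedD[OF in_components_connected[OF C] IJ(1,2)] IJ(3) by blast
    then show ?thesis using \<open>C \<subseteq> I \<union> J\<close> by blast
  qed
  define Y where "Y = {C. C \<subseteq> I}"
  have comp: "C \<in> components (- drawing)" "C \<noteq> {}" if "C \<in> faces_at drawing x" for C x
    using that in_components_nonempty by (auto simp: faces_at_def)
  show ?thesis
  proof (rule that[of Y]; intro ballI)
    fix e assume e: "e \<in> cycle_edges xs"
    then have eG: "e \<in> edges G" using cycle_edges_subset[OF cyc] by blast
    obtain x where x: "x \<in> convex hull (pos ` e) - pos ` e" "faces_at drawing x = edge_faces e"
      by (rule edge_interior_point[OF eG])
    have xc: "x \<in> path_image c" unfolding c(3) using e x(1) by blast
    obtain C where C: "C \<in> faces_at drawing x" "C \<subseteq> I"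
      by (rule face_in_open_set[OF IJ(1), of x]) (use IJ(5) xc dec in blast)+
    obtain C' where C': "C' \<in> faces_at drawing x" "C' \<subseteq> J"
      by (rule face_in_open_set[OF IJ(2), of x]) (use IJ(6) xc dec in blast)+
    have "\<not> C' \<subseteq> I" using C'(2) comp(2)[OF C'(1)] IJ(3) by blast
    then show "edge_faces e \<inter> Y \<noteq> {} \<and> edge_faces e - Y \<noteq> {}"
      using C C'(1) x(2) unfolding Y_def by blast
  next
    fix e assume e: "e \<in> edges G - cycle_edges xs"
    then have eG: "e \<in> edges G" by blast
    obtain x where x: "x \<in> convex hull (pos ` e) - pos ` e" "faces_at drawing x = edge_faces e"
      by (rule edge_interior_point[OF eG])
    have "x \<notin> path_image c"
    proof
      assume "x \<in> path_image c"
      then obtain e' where e': "e' \<in> cycle_edges xs" "x \<in> convex hull (pos ` e')" unfolding c(3) by blast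
      have "e' \<in> edges G" "e' \<noteq> e" using e'(1) e cycle_edges_subset[OF cyc] by blast+
      then have "x \<in> pos ` (e \<inter> e')" using crossing[OF eG, of e'] e'(2) x(1) by blast
      then show False using x(1) by blast
    qed
    then consider "x \<in> I" | "x \<in> J" using IJ(4) by blast
    then show "edge_faces e \<subseteq> Y \<or> edge_faces e \<inter> Y = {}"
    proof cases
      case 1
      have "C \<subseteq> I" if C: "C \<in> faces_at drawing x" for C
      proof -
        have "x \<in> closure C" using C by (simp add: faces_at_def)
        then have "C \<inter> I \<noteq> {}" using 1 open_Int_closure_eq_empty[OF IJ(1), of C] by blast
        then show ?thesis using dec[OF comp(1)[OF C]] by blast
      qed
      then show ?thesis unfolding x(2)[symmetric] Y_def by blast
    next
      case 2
      have "\<not> C \<subseteq> I" if C: "C \<in> faces_at drawing x" for C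
      proof -
        have "x \<in> closure C" using C by (simp add: faces_at_def)
        then have "C \<inter> J \<noteq> {}" using 2 open_Int_closure_eq_empty[OF IJ(2), of C] by blast
        then show ?thesis using IJ(3) by blast
      qed
      then show ?thesis unfolding x(2)[symmetric] Y_def by blast
    qed
  qed
qed

lemma card_verts: "3 < card (verts G)"
  and connected_delete: "X \<subseteq> verts G \<Longrightarrow> card X < 3 \<Longrightarrow> graph_connected (delete_verts G X)"
  using conn3 by (auto simp: three_connected_def)

lemma reachable_avoiding:
  assumes "X \<subseteq> verts G" "card X < 3" "u \<in> verts G - X" "v \<in> verts G - X"
  shows "(u, v) \<in> {(x, y). {x,y} \<in> {e \<in> edges G. e \<inter> X = {}}}\<^sup>*"
  using connected_delete[OF assms(1,2)] assms(3,4) unfolding graph_connected_def delete_verts_def by simp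

text \<open>Deleting the end \<open>v\<close> leaves the graph connected, so another neighbour
  \<open>w\<close> of \<open>v\<close> is joined to \<open>u\<close> by a walk without
  \<open>v\<close>.\<close>

lemma edge_on_cycle:
  assumes e: "e \<in> edges G"
  obtains xs where "is_cycle xs" "e \<in> cycle_edges xs"
proof -
  obtain u v where uv: "e = {u,v}" "u \<noteq> v" "u \<in> verts G" "v \<in> verts G"
    using card_edge[OF e] edge_verts[OF e] by (auto simp: card_2_iff)
  obtain N where N: "card N = 3" "\<forall>u. u \<in> N \<longrightarrow> u \<in> verts G \<and> u \<noteq> v"
    "{e \<in> edges G. v \<in> e} = (\<lambda>u. {v,u}) ` N" by (rule neighbours[OF uv(4)]) (rule that; simp)
  have "\<not> N \<subseteq> {u}" using N(1) card_mono[of "{u}" N] by auto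
  then obtain w where w: "w \<in> N" "w \<noteq> u" by blast
  have vw: "{v,w} \<in> edges G" "w \<in> verts G" "w \<noteq> v" using w(1) N(2,3) by blast+
  let ?E = "{e \<in> edges G. e \<inter> {v} = {}}"
  have "(w, u) \<in> {(x, y). {x,y} \<in> ?E}\<^sup>*"
    by (rule reachable_avoiding) (use uv vw in auto)
  from reachable_distinct_walk[OF this] obtain xs where
    xs: "xs \<noteq> []" "hd xs = w" "last xs = u" "distinct xs" "walk_in ?E xs" by blast
  have len: "2 \<le> length xs"
  proof (cases xs)
    case (Cons a ys) then show ?thesis using xs w(2) by (cases ys) auto
  qed (use xs in simp)
  have vxs: "v \<notin> set xs"
  proof
    assume "v \<in> set xs"
    then obtain e' where "e' \<in> path_edges xs" "v \<in> e'" using path_edges_cover[OF len] by blast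
    then show False using path_edges_walk[OF xs(5)] by blast
  qed
  have wE: "walk_in (edges G) xs" by (rule successively_mono[OF xs(5)]) auto
  have "is_cycle (v # xs)"
    unfolding is_cycle_def using xs len vxs wE vw uv e
    by (cases xs) (auto simp: insert_commute)
  moreover have "e \<in> cycle_edges (v # xs)" using xs(1,3) uv(1) by (simp add: cycle_edges_def)
  ultimately show ?thesis by (rule that)
qed

text \<open>A cycle through the edge has a face of this edge on either side.\<close>

lemma card_edge_faces:
  assumes "e \<in> edges G"
  shows "card (edge_faces e) = 2"
proof -
  obtain C1 C2 where C: "edge_faces e = {C1, C2}" by (rule edge_faces_pair[OF assms])
  obtain xs where xs: "is_cycle xs" "e \<in> cycle_edges xs" by (rule edge_on_cycle[OF assms])
  obtain Y where "\<forall>e\<in>cycle_edges xs. edge_faces e \<inter> Y \<noteq> {} \<and> edge_faces e - Y \<noteq> {}"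
    by (rule cycle_separates_faces[OF xs(1)])
  then have "edge_faces e \<inter> Y \<noteq> {}" "edge_faces e - Y \<noteq> {}" using xs(2) by blast+
  then have "C1 \<noteq> C2" unfolding C by blast
  then show ?thesis by (simp add: C)
qed

text \<open>A cycle meets an edge set as often as the faces inside the cycle do, modulo 2: every edge
  off the cycle is counted for none or both of its faces.\<close>

lemma even_cycle_intersection:
  assumes z: "z \<subseteq> edges G" "\<And>C. even (card {e \<in> z. C \<in> edge_faces e})" and cyc: "is_cycle xs"
  shows "even (card (z \<inter> cycle_edges xs))"
proof -
  obtain Y where Y:
    "\<forall>e\<in>cycle_edges xs. edge_faces e \<inter> Y \<noteq> {} \<and> edge_faces e - Y \<noteq> {}"
    "\<forall>e\<in>edges G - cycle_edges xs. edge_faces e \<subseteq> Y \<or> edge_faces e \<inter> Y = {}"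
    by (rule cycle_separates_faces[OF cyc])
  have fz: "finite z" using z(1) finite_edges finite_subset by blast
  have fin2: "finite (edge_faces e)" if "e \<in> z" for e
    using card_edge_faces[of e] z(1) that card.infinite by fastforce
  \<comment> \<open>Restricting \<open>Y\<close> to the faces of edges in \<open>z\<close> makes the
    double count finite.\<close>
  define U where "U = (\<Union>e\<in>z. edge_faces e) \<inter> Y"
  have fU: "finite U" using fz fin2 by (auto simp: U_def)
  have "(\<Sum>e\<in>z. card {C \<in> U. C \<in> edge_faces e}) = (\<Sum>e\<in>z. \<Sum>C\<in>U. if C \<in> edge_faces e then 1 else 0)"
    by (simp only: card_eq_sum sum.inter_filter[OF fU])
  also have "\<dots> = (\<Sum>C\<in>U. \<Sum>e\<in>z. if C \<in> edge_faces e then 1 else 0)" by (rule sum.swap)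
  also have "\<dots> = (\<Sum>C\<in>U. card {e \<in> z. C \<in> edge_faces e})"
    by (simp only: card_eq_sum sum.inter_filter[OF fz])
  also have "even \<dots>" by (rule dvd_sum) (rule z(2))
  finally have "even (card {e \<in> z. odd (card {C \<in> U. C \<in> edge_faces e})})"
    by (simp only: even_sum_iff[OF fz])
  moreover have "odd (card {C \<in> U. C \<in> edge_faces e}) \<longleftrightarrow> e \<in> cycle_edges xs" if e: "e \<in> z" for e
  proof -
    have eG: "e \<in> edges G" using e z(1) by blast
    have eq: "{C \<in> U. C \<in> edge_faces e} = edge_faces e \<inter> Y" using e unfolding U_def by blast
    obtain C1 C2 where C: "edge_faces e = {C1, C2}" by (rule edge_faces_pair[OF eG])
    have C12: "C1 \<noteq> C2" using card_edge_faces[OF eG] C by auto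
    show ?thesis
    proof (cases "e \<in> cycle_edges xs")
      case True
      then have "edge_faces e \<inter> Y \<noteq> {}" "edge_faces e - Y \<noteq> {}" using Y(1) by blast+
      then have "edge_faces e \<inter> Y = {C1} \<or> edge_faces e \<inter> Y = {C2}" unfolding C by blast
      then have "card (edge_faces e \<inter> Y) = 1" by auto
      then show ?thesis using True unfolding eq by simp
    next
      case False
      then have "edge_faces e \<subseteq> Y \<or> edge_faces e \<inter> Y = {}" using Y(2) eG by blast
      then have "edge_faces e \<inter> Y = edge_faces e \<or> edge_faces e \<inter> Y = {}" by blast
      then have "card (edge_faces e \<inter> Y) = 2 \<or> card (edge_faces e \<inter> Y) = 0" using card_edge_faces[OF eG] by auto
      then show ?thesis using False unfolding eq by auto
    qed
  qed
  then have "{e \<in> z. odd (card {C \<in> U. C \<in> edge_faces e})} = z \<inter> cycle_edges xs" by blast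
  ultimately show ?thesis by simp
qed

text \<open>Closed walks reduce to cycles, and these meet \<open>z\<close> evenly; so the parity of
  walks from a root is a well-defined two-colouring of the vertices, and \<open>z\<close> consists
  of the edges joining different colours.\<close>

lemma even_on_faces_is_cut:
  assumes z: "z \<subseteq> edges G" "\<And>C. even (card {e \<in> z. C \<in> edge_faces e})"
  shows "\<exists>p :: 'a \<Rightarrow> bool. \<forall>u v. {u,v} \<in> edges G \<longrightarrow> ((p u \<noteq> p v) \<longleftrightarrow> {u,v} \<in> z)"
proof (rule vertex_potential)
  fix xs assume "xs \<noteq> []" "walk_in (edges G) xs" "hd xs = last xs"
  then show "\<not> odd_walk z xs"
  proof (rule no_odd_closed_walk[rotated 2])
    fix ys assume ys: "distinct ys" "3 \<le> length ys" "walk_in (edges G) ys" "{last ys, hd ys} \<in> edges G"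
    then have cyc: "is_cycle ys" by (simp add: is_cycle_def)
    have new: "{last ys, hd ys} \<notin> path_edges ys" by (rule closing_edge_new[OF ys(1,2)])
    have "z \<inter> cycle_edges ys = (if {last ys, hd ys} \<in> z then insert {last ys, hd ys} (z \<inter> path_edges ys) else z \<inter> path_edges ys)"
      unfolding cycle_edges_def by auto
    then have "card (z \<inter> cycle_edges ys) = (if {last ys, hd ys} \<in> z then 1 else 0) + card (z \<inter> path_edges ys)"
      using new finite_subset[OF Int_lower2 finite_path_edges, of z ys] by simp
    moreover have "even (card (z \<inter> cycle_edges ys))" by (rule even_cycle_intersection[OF z cyc])
    moreover have "odd_walk z ys \<longleftrightarrow> odd (card (z \<inter> path_edges ys))" by (rule odd_walk_card[OF ys(1)])
    moreover have "odd_walk z (ys @ [hd ys]) \<longleftrightarrow> odd_walk z ys \<noteq> ({last ys, hd ys} \<in> z)"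
    proof -
      have "ys \<noteq> []" using ys(2) by auto
      then have ys': "ys = butlast ys @ [last ys]" by simp
      have "odd_walk z (butlast ys @ last ys # [hd ys]) \<longleftrightarrow>
          odd_walk z (butlast ys @ [last ys]) \<noteq> odd_walk z (last ys # [hd ys])" by (rule odd_walk_append)
      moreover have "butlast ys @ last ys # [hd ys] = ys @ [hd ys]"
        using ys' by (metis append.assoc append_Cons append_Nil)
      ultimately show ?thesis using ys' by simp
    qed
    ultimately show "\<not> odd_walk z (ys @ [hd ys])" by (auto split: if_splits)
  qed (rule card_edge)
next
  fix u v assume "u \<in> verts G" "v \<in> verts G"
  then show "(u, v) \<in> {(x, y). {x,y} \<in> edges G}\<^sup>*"
    using reachable_avoiding[of "{}" u v] by simp
qed (rule edge_verts)

text \<open>Two edges with the same faces meet every face evenly, so they form a cut. Deleting their ends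
  \<open>u\<close>, \<open>u'\<close> on one side would then disconnect the graph, as \<open>u\<close> has a further neighbour \<open>w\<close> on this
  side.\<close>

lemma edge_faces_inj: "inj_on edge_faces (edges G)"
proof (rule inj_onI, rule ccontr)
  fix e e' assume e: "e \<in> edges G" "e' \<in> edges G" "edge_faces e = edge_faces e'" "e \<noteq> e'"
  have "even (card {\<epsilon> \<in> {e,e'}. C \<in> edge_faces \<epsilon>})" for C
    using card_filter_pair[OF e(4), of "\<lambda>\<epsilon>. C \<in> edge_faces \<epsilon>"] e(3) by auto
  then obtain p :: "'a \<Rightarrow> bool" where p: "\<forall>u v. {u,v} \<in> edges G \<longrightarrow> ((p u \<noteq> p v) \<longleftrightarrow> {u,v} \<in> {e,e'})"
    using even_on_faces_is_cut[of "{e,e'}"] e(1,2) by blast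
  have ends: "\<exists>u v. \<epsilon> = {u,v} \<and> p u \<and> \<not> p v \<and> u \<in> verts G \<and> v \<in> verts G" if \<epsilon>: "\<epsilon> \<in> {e,e'}" for \<epsilon>
  proof -
    have "\<epsilon> \<in> edges G" using \<epsilon> e by blast
    then obtain a b where ab: "\<epsilon> = {a,b}" "a \<in> verts G" "b \<in> verts G"
      using card_edge[of \<epsilon>] edge_verts[of \<epsilon>] by (auto simp: card_2_iff)
    then have "p a \<noteq> p b" using p \<epsilon> \<open>\<epsilon> \<in> edges G\<close> by blast
    then consider "p a" "\<not> p b" | "p b" "\<not> p a" by blast
    then show ?thesis
    proof cases
      case 1 then show ?thesis using ab by blast
    next
      case 2 then show ?thesis using ab by (intro exI[of _ b] exI[of _ a]) auto
    qed
  qed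
  obtain u v where uv: "e = {u,v}" "p u" "\<not> p v" "u \<in> verts G" "v \<in> verts G" using ends[of e] by auto
  obtain u' v' where uv': "e' = {u',v'}" "p u'" "\<not> p v'" "u' \<in> verts G" "v' \<in> verts G" using ends[of e'] by auto
  obtain N where N: "card N = 3" "\<forall>w. w \<in> N \<longrightarrow> w \<in> verts G \<and> w \<noteq> u"
    "{e \<in> edges G. u \<in> e} = (\<lambda>w. {u,w}) ` N" by (rule neighbours[OF uv(4)]) (rule that; simp)
  \<comment> \<open>A third edge at \<open>u\<close> is wanted, different from \<open>e\<close> and
    \<open>e'\<close>. Excluding \<open>x\<close> also keeps its end \<open>w\<close> away from
    \<open>u'\<close>, whether or not \<open>e\<close> and \<open>e'\<close> share the end
    \<open>u\<close>.\<close>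
  define x where "x = (if u = u' then v' else u')"
  have "\<not> N \<subseteq> {v,x}"
  proof
    assume "N \<subseteq> {v,x}"
    then have "card N \<le> card {v,x}" by (intro card_mono) auto
    also have "\<dots> \<le> 2" by (simp add: card_insert_if)
    finally show False using N(1) by simp
  qed
  then obtain w where w: "w \<in> N" "w \<noteq> v" "w \<noteq> x" by blast
  have uw: "{u,w} \<in> edges G" "w \<in> verts G" "w \<noteq> u" using w(1) N(2,3) by blast+
  have "u \<noteq> v'" using uv(2) uv'(3) by auto
  have "{u,w} \<noteq> e" using uv(1) w(2) uw(3) by (auto simp: doubleton_eq_iff)
  moreover have "{u,w} \<noteq> e'"
    using uv'(1) w(3) uw(3) \<open>u \<noteq> v'\<close> by (auto simp: doubleton_eq_iff x_def split: if_splits)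
  ultimately have pw: "p w" using p uw(1) uv(2) by blast
  have "w \<noteq> u'" using w(3) uw(3) by (auto simp: x_def split: if_splits)
  let ?X = "{u,u'}" let ?E = "{e \<in> edges G. e \<inter> {u,u'} = {}}"
  \<comment> \<open>A walk avoiding \<open>u\<close> and \<open>u'\<close> uses neither edge of the
    cut, so it would carry the colour of \<open>w\<close> to \<open>v\<close>.\<close>
  have "(w, v) \<in> {(x, y). {x,y} \<in> ?E}\<^sup>*"
    by (rule reachable_avoiding)
       (use uv uv' uw \<open>w \<noteq> u'\<close> in \<open>auto simp: card_insert_if\<close>)
  then have "p v"
  proof (induction rule: rtrancl_induct)
    case base show ?case by (rule pw)
  next
    case (step y y')
    then have "{y,y'} \<in> edges G" "{y,y'} \<notin> {e,e'}" using uv(1) uv'(1) by auto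
    then show ?case using p step.IH by blast
  qed
  then show False using uv(3) by simp
qed

section \<open>Incidence of vertices, edges and faces\<close>

lemma vertex_faces_card: "v \<in> verts G \<Longrightarrow> card (vertex_faces v) = 3"
  and vertex_faces_pairs: "v \<in> verts G \<Longrightarrow>
    edge_faces ` {e \<in> edges G. v \<in> e} = {s. card s = 2 \<and> s \<subseteq> vertex_faces v}"
proof -
  assume v: "v \<in> verts G"
  obtain C1 C2 C3 where C: "vertex_faces v = {C1, C2, C3}"
    "edge_faces ` {e \<in> edges G. v \<in> e} = {{C1,C2}, {C2,C3}, {C3,C1}}" by (rule vertex_faces_structure[OF v])
  \<comment> \<open>As each edge has two different faces, no two of \<open>C1\<close>,
    \<open>C2\<close>, \<open>C3\<close> coincide.\<close>
  have card2: "card s = 2" if "s \<in> {{C1,C2}, {C2,C3}, {C3,C1}}" for s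
    using that card_edge_faces unfolding C(2)[symmetric] by auto
  have ne: "C1 \<noteq> C2" "C2 \<noteq> C3" "C1 \<noteq> C3"
    using card2[of "{C1,C2}"] card2[of "{C2,C3}"] card2[of "{C3,C1}"] by auto
  then show "card (vertex_faces v) = 3" by (simp add: C(1))
  have "{C3,C1} = {C1,C3}" by auto
  then show "edge_faces ` {e \<in> edges G. v \<in> e} = {s. card s = 2 \<and> s \<subseteq> vertex_faces v}"
    unfolding C using pairs_of_triple[OF ne(1,2,3)] by simp
qed

lemma edge_faces_subset: "e \<in> edges G \<Longrightarrow> v \<in> e \<Longrightarrow> edge_faces e \<subseteq> vertex_faces v"
proof -
  assume e: "e \<in> edges G" "v \<in> e"
  then have "edge_faces e \<in> edge_faces ` {e \<in> edges G. v \<in> e}" by blast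
  then show ?thesis using vertex_faces_pairs[of v] edge_verts[OF e(1)] e(2) by auto
qed

lemma pair_is_edge:
  assumes "v \<in> verts G" "card s = 2" "s \<subseteq> vertex_faces v"
  obtains e where "e \<in> edges G" "v \<in> e" "edge_faces e = s"
proof -
  have "s \<in> edge_faces ` {e \<in> edges G. v \<in> e}" using vertex_faces_pairs[OF assms(1)] assms(2,3) by auto
  then show ?thesis using that by blast
qed

text \<open>The pairs of faces at a vertex determine its edges, so two vertices with the same faces
  would share all three of them, which a simple graph forbids.\<close>

lemma vertex_faces_inj: "inj_on vertex_faces (verts G)"
proof (rule inj_onI, rule ccontr)
  fix u v assume uv: "u \<in> verts G" "v \<in> verts G" "vertex_faces u = vertex_faces v" "u \<noteq> v"
  have "edge_faces ` {e \<in> edges G. u \<in> e} = edge_faces ` {e \<in> edges G. v \<in> e}"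
    using vertex_faces_pairs[OF uv(1)] vertex_faces_pairs[OF uv(2)] uv(3) by simp
  then have eq: "{e \<in> edges G. u \<in> e} = {e \<in> edges G. v \<in> e}"
    by (rule inj_on_image_eq_iff[OF edge_faces_inj, THEN iffD1, rotated 2]) auto
  have "{e \<in> edges G. u \<in> e} \<subseteq> {{u,v}}"
  proof
    fix e assume e: "e \<in> {e \<in> edges G. u \<in> e}"
    then have "v \<in> e" "u \<in> e" "e \<in> edges G" using eq by auto
    then obtain w where "e = {u,w}" by (elim edgeE[of e u])
    then show "e \<in> {{u,v}}" using \<open>v \<in> e\<close> uv(4) by auto
  qed
  then have "card {e \<in> edges G. u \<in> e} \<le> card {{u,v}}" by (intro card_mono) auto
  moreover have "card {e \<in> edges G. u \<in> e} = 3" using cubic uv(1) by (simp add: three_regular_def)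
  ultimately show False by simp
qed

text \<open>A vertex incident to both faces of an edge has an edge with exactly these faces, and by
  \<open>edge_faces_inj\<close> it is the same edge.\<close>

lemma cofaces_vertex_faces:
  assumes e: "{u,v} \<in> edges G"
  shows "{t \<in> vertex_faces ` verts G. edge_faces {u,v} \<subseteq> t} = {vertex_faces u, vertex_faces v}"
proof (intro equalityI subsetI)
  fix t assume "t \<in> {t \<in> vertex_faces ` verts G. edge_faces {u,v} \<subseteq> t}"
  then obtain w where w: "w \<in> verts G" "t = vertex_faces w" "edge_faces {u,v} \<subseteq> vertex_faces w" by blast
  obtain e' where e': "e' \<in> edges G" "w \<in> e'" "edge_faces e' = edge_faces {u,v}"
    by (rule pair_is_edge[OF w(1) card_edge_faces[OF e] w(3)])
  then have "e' = {u,v}" using inj_onD[OF edge_faces_inj e'(3) e'(1) e] by simp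
  then show "t \<in> {vertex_faces u, vertex_faces v}" using e'(2) w(2) by auto
next
  fix t assume "t \<in> {vertex_faces u, vertex_faces v}"
  then show "t \<in> {t \<in> vertex_faces ` verts G. edge_faces {u,v} \<subseteq> t}"
    using edge_faces_subset[OF e, of u] edge_faces_subset[OF e, of v] edge_verts[OF e] by auto
qed

lemma adjacent_vertex_faces:
  assumes e: "{u,v} \<in> edges G"
  shows "vertex_faces u \<inter> vertex_faces v = edge_faces {u,v}"
proof (rule card3_inter_eq)
  have uv: "u \<in> verts G" "v \<in> verts G" "u \<noteq> v" using edge_verts[OF e] card_edge[OF e] by auto
  then show "card (vertex_faces u) = 3" "card (vertex_faces v) = 3" "vertex_faces u \<noteq> vertex_faces v"
    using vertex_faces_card inj_onD[OF vertex_faces_inj] by blast+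
  show "card (edge_faces {u,v}) = 2" by (rule card_edge_faces[OF e])
  show "edge_faces {u,v} \<subseteq> vertex_faces u" "edge_faces {u,v} \<subseteq> vertex_faces v"
    using edge_faces_subset[OF e] by auto
qed

lemma shared_pair_adjacent:
  assumes u: "u \<in> verts G" and v: "v \<in> verts G" and c: "card (vertex_faces u \<inter> vertex_faces v) = 2"
  shows "{u,v} \<in> edges G"
proof -
  let ?s = "vertex_faces u \<inter> vertex_faces v"
  obtain e where e: "e \<in> edges G" "u \<in> e" "edge_faces e = ?s" by (rule pair_is_edge[OF u c]) auto
  obtain e' where e': "e' \<in> edges G" "v \<in> e'" "edge_faces e' = ?s" by (rule pair_is_edge[OF v c]) auto
  have "e = e'" using inj_onD[OF edge_faces_inj _ e(1) e'(1)] e(3) e'(3) by simp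
  have "u \<noteq> v" using c vertex_faces_card[OF u] by auto
  obtain w where "e = {u,w}" using e(1,2) by (rule edgeE)
  then show ?thesis using \<open>e = e'\<close> \<open>u \<noteq> v\<close> e'(2) e(1) by auto
qed

text \<open>In the dual, triangles are vertices of the graph, sides of triangles its edges and
  corners its faces. An even chain is an edge set meeting every face evenly, and the two-colouring
  of its cut is the potential. Constancy of the potentials of the empty chain is connectedness of
  the graph.\<close>

theorem trisphere_vertex_faces: "trisphere (vertex_faces ` verts G)"
proof -
  let ?K = "vertex_faces ` verts G"
  have E: "card {t \<in> ?K. s \<subseteq> t} = 0 \<or> card {t \<in> ?K. s \<subseteq> t} = 2" if s: "card s = 2" for s
  proof (cases "{t \<in> ?K. s \<subseteq> t} = {}")
    case False
    then obtain v where v: "v \<in> verts G" "s \<subseteq> vertex_faces v" by blast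
    obtain e where e: "e \<in> edges G" "v \<in> e" "edge_faces e = s" by (rule pair_is_edge[OF v(1) s v(2)])
    obtain u where u: "e = {v,u}" "u \<noteq> v" "u \<in> verts G" using e(1,2) by (rule edgeE)
    have vu: "{v,u} \<in> edges G" using e(1) u(1) by simp
    have "{t \<in> ?K. s \<subseteq> t} = {vertex_faces v, vertex_faces u}"
      using cofaces_vertex_faces[OF vu] e(3) u(1) by simp
    moreover have "vertex_faces v \<noteq> vertex_faces u" using inj_onD[OF vertex_faces_inj _ v(1) u(3)] u(2) by blast
    ultimately show ?thesis by (simp only:) simp
  qed (simp only: card.empty, simp)
  have conn: "p t = p t'" if pot: "potential ?K {} p" and t: "t \<in> ?K" "t' \<in> ?K" for p t t'
  proof -
    obtain u v where uv: "u \<in> verts G" "v \<in> verts G" "t = vertex_faces u" "t' = vertex_faces v" using t by blast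
    have "(u, v) \<in> {(x, y). {x,y} \<in> edges G}\<^sup>*" using reachable_avoiding[of "{}" u v] uv by simp
    then have "p (vertex_faces u) = p (vertex_faces v)"
    proof (induction rule: rtrancl_induct)
      case (step x y)
      then have e: "{x,y} \<in> edges G" by simp
      have "(p (vertex_faces x) \<noteq> p (vertex_faces y)) \<longleftrightarrow> edge_faces {x,y} \<in> {}"
        by (rule potentialD[OF pot _ _ adjacent_vertex_faces[OF e] card_edge_faces[OF e]])
           (use edge_verts[OF e] in auto)
      then show ?case using step.IH by simp
    qed simp
    then show ?thesis using uv by simp
  qed
  have H: "\<exists>p. potential ?K z p" if z: "z \<subseteq> skeleton ?K" "even_chain z" for z
  proof -
    define z' where "z' = {e \<in> edges G. edge_faces e \<in> z}"
    have "even (card {e \<in> z'. C \<in> edge_faces e})" for C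
    proof -
      have im: "edge_faces ` {e \<in> z'. C \<in> edge_faces e} = {s \<in> z. C \<in> s}"
      proof (intro equalityI subsetI)
        fix s assume s: "s \<in> {s \<in> z. C \<in> s}"
        then have "s \<in> skeleton ?K" using z(1) by blast
        then obtain v where v: "v \<in> verts G" "card s = 2" "s \<subseteq> vertex_faces v" unfolding skeleton_def by blast
        obtain e where e: "e \<in> edges G" "edge_faces e = s" by (rule pair_is_edge[OF v])
        then have "e \<in> {e \<in> z'. C \<in> edge_faces e}" using s by (simp add: z'_def)
        then show "s \<in> edge_faces ` {e \<in> z'. C \<in> edge_faces e}" using e(2) by blast
      qed (auto simp: z'_def)
      have "inj_on edge_faces {e \<in> z'. C \<in> edge_faces e}"
        by (rule inj_on_subset[OF edge_faces_inj]) (auto simp: z'_def)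
      from card_image[OF this] have "card {e \<in> z'. C \<in> edge_faces e} = card {s \<in> z. C \<in> s}" unfolding im ..
      then show ?thesis using z(2) by (simp add: even_chain_def)
    qed
    moreover have "z' \<subseteq> edges G" by (auto simp: z'_def)
    ultimately obtain p :: "'a \<Rightarrow> bool" where p: "\<forall>u v. {u,v} \<in> edges G \<longrightarrow> ((p u \<noteq> p v) \<longleftrightarrow> {u,v} \<in> z')"
      using even_on_faces_is_cut[of z'] by blast
    \<comment> \<open>Triangles correspond to vertices bijectively, so the colouring of the vertices
      carries over.\<close>
    define q where "q t = p (inv_into (verts G) vertex_faces t)" for t
    have q: "q (vertex_faces v) = p v" if "v \<in> verts G" for v
      using that vertex_faces_inj by (simp add: q_def)
    have "potential ?K z q"
      unfolding potential_def
    proof (intro ballI impI)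
      fix t t' assume t: "t \<in> ?K" "t' \<in> ?K" "card (t \<inter> t') = 2"
      then obtain u v where uv: "u \<in> verts G" "v \<in> verts G" "t = vertex_faces u" "t' = vertex_faces v" by blast
      have e: "{u,v} \<in> edges G" by (rule shared_pair_adjacent[OF uv(1,2)]) (use t(3) uv in simp)
      have "(q t \<noteq> q t') \<longleftrightarrow> {u,v} \<in> z'" using p e q uv by simp
      also have "\<dots> \<longleftrightarrow> t \<inter> t' \<in> z" using e adjacent_vertex_faces[OF e] uv by (simp add: z'_def)
      finally show "(q t \<noteq> q t') \<longleftrightarrow> t \<inter> t' \<in> z" .
    qed
    then show ?thesis by blast
  qed
  have "?K \<noteq> {}" using card_verts by auto
  moreover have "finite ?K" using finite_verts by simp
  moreover have "\<forall>t\<in>?K. card t = 3" using vertex_faces_card by blast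
  ultimately show ?thesis unfolding trisphere_def using E conn H by blast
qed

text \<open>The frontier of a face is not empty and lies in the drawing. A point of it is a vertex
  or lies inside an edge, whose faces are also faces at its ends.\<close>

lemma Union_vertex_faces: "\<Union>(vertex_faces ` verts G) = components (- drawing)"
proof (intro equalityI subsetI)
  fix C assume "C \<in> \<Union>(vertex_faces ` verts G)"
  then show "C \<in> components (- drawing)" by (auto simp: vertex_faces_def faces_at_def)
next
  fix C assume C: "C \<in> components (- drawing)"
  obtain v where v: "v \<in> verts G" using card_verts by (metis card.empty equals0I not_less_zero)
  obtain e where e: "e \<in> edges G" "v \<in> e" using vertex_edge[OF v] by blast
  have "pos v \<in> drawing" unfolding drawing_def using e by (auto intro: hull_inc)
  then have "C \<noteq> UNIV" using in_components_subset[OF C] by blast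
  then have "frontier C \<noteq> {}" using in_components_nonempty[OF C] by (simp add: frontier_eq_empty)
  then obtain x where x: "x \<in> frontier C" by blast
  have "frontier C \<subseteq> frontier drawing"
    using frontier_of_components_subset[OF C] by (simp add: frontier_complement)
  then have "x \<in> drawing" using x closed_drawing frontier_subset_closed by blast
  then obtain e where e: "e \<in> edges G" "x \<in> convex hull (pos ` e)" unfolding drawing_def by blast
  have C': "C \<in> faces_at drawing x" using C x by (auto simp: faces_at_def frontier_def)
  show "C \<in> \<Union>(vertex_faces ` verts G)"
  proof (cases "x \<in> pos ` e")
    case True
    then obtain w where "w \<in> e" "x = pos w" by blast
    then show ?thesis using C' edge_verts[OF e(1)] unfolding vertex_faces_def by blast
  next
    case False
    then have "C \<in> edge_faces e" using faces_at_edge_point[OF e(1)] e(2) C' by blast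
    moreover obtain w where "w \<in> e" using card_edge[OF e(1)] by fastforce
    ultimately show ?thesis using edge_faces_subset[OF e(1)] edge_verts[OF e(1)] by blast
  qed
qed

end

section \<open>From planar embeddings to triangulated spheres\<close>

definition closed_edge :: "'v set \<Rightarrow> ('v \<Rightarrow> real) set" where
  "closed_edge e = vertex_point ` e \<union> open_edge e"

lemma vertex_point_eq_iff: "vertex_point u = vertex_point v \<longleftrightarrow> u = v"
  by (auto simp: vertex_point_def fun_eq_iff)

text \<open>The support of the barycentric coordinates identifies the cell of a point, so different
  closed edges can share only vertices.\<close>

lemma closed_edge_inter:
  assumes "card e = 2" "card e' = 2" "e \<noteq> e'"
  shows "closed_edge e \<inter> closed_edge e' \<subseteq> vertex_point ` (e \<inter> e')"
proof
  fix y assume y: "y \<in> closed_edge e \<inter> closed_edge e'"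
  have open_supp: "{w. y w > 0} = s" if "y \<in> open_edge s" for s
    using that unfolding open_edge_def by (auto simp: less_le)
  have vertex_supp: "{w. y w > 0} = {x}" if "y = vertex_point x" for x
    using that by (auto simp: vertex_point_def)
  have "y \<notin> open_edge s" if "y \<in> closed_edge s'" "card s = 2" "card s' = 2" "s \<noteq> s'" for s s'
  proof
    assume "y \<in> open_edge s"
    then have s: "{w. y w > 0} = s" by (rule open_supp)
    have "y \<in> vertex_point ` s' \<or> y \<in> open_edge s'" using that(1) by (auto simp: closed_edge_def)
    then show False
    proof
      assume "y \<in> vertex_point ` s'"
      then obtain x where "y = vertex_point x" by blast
      then have "s = {x}" using vertex_supp s by simp
      then show False using that(2) by simp
    next
      assume "y \<in> open_edge s'"
      then show False using open_supp[of s'] s that(4) by simp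
    qed
  qed
  then have "y \<notin> open_edge e" "y \<notin> open_edge e'" using y assms by blast+
  then have "y \<in> vertex_point ` e" "y \<in> vertex_point ` e'" using y by (auto simp: closed_edge_def)
  then show "y \<in> vertex_point ` (e \<inter> e')" by (auto simp: vertex_point_eq_iff)
qed

text \<open>The closed edge is the image of the unit interval under linear interpolation, whose
  continuity in the product topology is checked coordinatewise.\<close>

lemma compact_closed_edge:
  assumes "u \<noteq> v"
  shows "compact (closed_edge {u,v})"
proof -
  define f where "f t = (\<lambda>w. if w = u then 1 - t else if w = v then t else (0::real))" for t
  have "continuous_on {0..1} f"
  proof (rule continuous_on_coordinatewise_then_product)
    fix w show "continuous_on {0..1} (\<lambda>t. f t w)"
      unfolding f_def by (cases "w = u"; cases "w = v") (auto intro!: continuous_intros)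
  qed
  then have "compact (f ` {0..1})" by (rule compact_continuous_image) simp
  moreover have "f ` {0..1} = closed_edge {u,v}"
  proof (intro equalityI subsetI)
    fix y assume "y \<in> f ` {0..1}"
    then obtain t where t: "0 \<le> t" "t \<le> 1" "y = f t" by auto
    consider "t = 0" | "t = 1" | "0 < t" "t < 1" using t by linarith
    then show "y \<in> closed_edge {u,v}"
    proof cases
      case 1
      then have "y = vertex_point u" using t assms by (auto simp: f_def vertex_point_def fun_eq_iff)
      then show ?thesis by (simp add: closed_edge_def)
    next
      case 2
      then have "y = vertex_point v" using t assms by (auto simp: f_def vertex_point_def fun_eq_iff)
      then show ?thesis by (simp add: closed_edge_def)
    next
      case 3
      then have "y \<in> open_edge {u,v}" using t assms by (auto simp: f_def open_edge_def)
      then show ?thesis by (simp add: closed_edge_def)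
    qed
  next
    fix y assume "y \<in> closed_edge {u,v}"
    then consider "y = vertex_point u" | "y = vertex_point v" | "y \<in> open_edge {u,v}"
      by (auto simp: closed_edge_def)
    then show "y \<in> f ` {0..1}"
    proof cases
      case 1
      then have "y = f 0" using assms by (auto simp: f_def vertex_point_def fun_eq_iff)
      then show ?thesis by auto
    next
      case 2
      then have "y = f 1" using assms by (auto simp: f_def vertex_point_def fun_eq_iff)
      then show ?thesis by auto
    next
      case 3
      then have y: "y u > 0" "y v > 0" "\<And>w. w \<notin> {u,v} \<Longrightarrow> y w = 0" "y u + y v = 1"
        using assms by (auto simp: open_edge_def)
      have "y = f (y v)"
      proof
        fix w show "y w = f (y v) w" using y(3)[of w] y(4) by (auto simp: f_def)
      qed
      then show ?thesis using y by (intro image_eqI[of _ _ "y v"]) auto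
    qed
  qed
  ultimately show ?thesis by simp
qed

locale embedded_graph =
  fixes G :: "'v graph" and \<tau> :: "('v \<Rightarrow> real) \<Rightarrow> real^2"
  assumes simple: "finite_simple_graph G" and cubic: "three_regular G" and conn3: "three_connected G"
    and emb: "planar_embedding G \<tau>"
begin

definition pos :: "'v \<Rightarrow> real^2" where "pos v = \<tau> (vertex_point v)"

lemmas emb_unfolded = emb[unfolded planar_embedding_def]
lemmas emb_cont = emb_unfolded[THEN conjunct1]
  and emb_inj = emb_unfolded[THEN conjunct2, THEN conjunct1]
  and emb_edges = emb_unfolded[THEN conjunct2, THEN conjunct2, THEN conjunct1]
  and emb_finite = emb_unfolded[THEN conjunct2, THEN conjunct2, THEN conjunct2, THEN conjunct1]
  and emb_unbounded =
    emb_unfolded[THEN conjunct2, THEN conjunct2, THEN conjunct2, THEN conjunct2, THEN conjunct1]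

lemma closed_edge_subset:
  assumes "e \<in> edges G"
  shows "closed_edge e \<subseteq> graph_top G"
  using assms simple by (auto simp: closed_edge_def graph_top_def finite_simple_graph_def)

text \<open>The embedding is known to map the open edge onto some open segment. The image of the
  closed edge is compact and consists of this segment and the images of two vertices, which must
  therefore be its ends.\<close>

lemma image_closed_edge:
  assumes e: "e \<in> edges G"
  shows "\<tau> ` closed_edge e = convex hull (pos ` e)"
proof -
  obtain u v where uv: "e = {u,v}" "u \<noteq> v"
    using e simple by (auto simp: finite_simple_graph_def card_2_iff)
  obtain a b where ab: "a \<noteq> b" "\<tau> ` open_edge e = open_segment a b"
    using bspec[OF emb_edges e] by blast
  have img: "\<tau> ` closed_edge e = {pos u, pos v} \<union> open_segment a b"
    unfolding closed_edge_def image_Un ab(2) by (simp add: uv(1) pos_def image_image)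
  have "compact (\<tau> ` closed_edge e)"
    using continuous_on_subset[OF emb_cont closed_edge_subset[OF e]] compact_closed_edge[OF uv(2)]
    unfolding uv(1) by (rule compact_continuous_image)
  then have "closed ({pos u, pos v} \<union> open_segment a b)" unfolding img by (rule compact_imp_closed)
  then have "closure (open_segment a b) \<subseteq> {pos u, pos v} \<union> open_segment a b"
    by (intro closure_minimal) auto
  then have "closed_segment a b \<subseteq> {pos u, pos v} \<union> open_segment a b" using ab(1) by simp
  then have "a \<in> {pos u, pos v}" "b \<in> {pos u, pos v}"
    using ends_in_segment[of a b] by (auto simp: open_segment_def)
  then have "{a,b} = {pos u, pos v}" using ab(1) by auto
  then have "\<tau> ` closed_edge e = {a,b} \<union> open_segment a b" using img by simp
  also have "\<dots> = closed_segment a b" using closed_segment_eq_open[of a b] by auto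
  also have "\<dots> = convex hull {a,b}" by (rule segment_convex_hull)
  also have "{a,b} = pos ` e" using \<open>{a,b} = {pos u, pos v}\<close> uv(1) by simp
  finally show ?thesis .
qed

lemma plane_drawing: "plane_drawing G pos"
proof
  show "finite_simple_graph G" "three_regular G" by (rule simple cubic)+
  show "inj_on pos (verts G)"
  proof (rule inj_onI)
    fix u v assume "u \<in> verts G" "v \<in> verts G" "pos u = pos v"
    then have "vertex_point u = vertex_point v"
      using inj_onD[OF emb_inj, of "vertex_point u" "vertex_point v"] by (auto simp: pos_def graph_top_def)
    then show "u = v" by (simp add: vertex_point_eq_iff)
  qed
  fix e e' assume e: "e \<in> edges G" "e' \<in> edges G" "e \<noteq> e'"
  have c: "card e = 2" "card e' = 2" using e simple by (auto simp: finite_simple_graph_def)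
  have "convex hull (pos ` e) \<inter> convex hull (pos ` e') = \<tau> ` (closed_edge e \<inter> closed_edge e')"
    unfolding image_closed_edge[OF e(1), symmetric] image_closed_edge[OF e(2), symmetric]
    by (rule inj_on_image_Int[OF emb_inj closed_edge_subset[OF e(1)] closed_edge_subset[OF e(2)], symmetric])
  also have "\<dots> \<subseteq> \<tau> ` vertex_point ` (e \<inter> e')" by (rule image_mono) (rule closed_edge_inter[OF c e(3)])
  also have "\<dots> = pos ` (e \<inter> e')" by (simp add: pos_def image_image)
  finally show "convex hull (pos ` e) \<inter> convex hull (pos ` e') \<subseteq> pos ` (e \<inter> e')" .
qed

sublocale plane_drawing G pos by (rule plane_drawing)

text \<open>Every vertex lies on an edge, so the closed edges cover the graph.\<close>

lemma drawing_eq: "drawing = \<tau> ` graph_top G"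
proof -
  have "graph_top G = (\<Union>e\<in>edges G. closed_edge e)"
  proof (intro equalityI subsetI)
    fix y assume "y \<in> graph_top G"
    then consider v where "v \<in> verts G" "y = vertex_point v" | e where "e \<in> edges G" "y \<in> open_edge e"
      by (auto simp: graph_top_def)
    then show "y \<in> (\<Union>e\<in>edges G. closed_edge e)"
    proof cases
      case (1 v)
      then obtain e where "e \<in> edges G" "v \<in> e" using vertex_edge by blast
      then show ?thesis using 1 by (auto simp: closed_edge_def)
    qed (auto simp: closed_edge_def)
  qed (use closed_edge_subset in blast)
  then show ?thesis unfolding drawing_def by (simp add: image_UN image_closed_edge)
qed

lemma components_eq_embedding: "components (- drawing) = embedding_components G \<tau>"
  by (simp add: drawing_eq embedding_components_def)

sublocale three_connected_drawing G pos
proof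
  show "three_connected G" by (rule conn3)
  show "finite (components (- drawing))"
    unfolding components_eq_embedding by (rule emb_finite)
qed

definition outer :: "(real^2) set" where
  "outer = (THE C. C \<in> embedding_components G \<tau> \<and> \<not> bounded C)"

lemma outer: "outer \<in> components (- drawing)" "\<not> bounded outer"
  and bounded_iff: "C \<in> components (- drawing) \<Longrightarrow> bounded C \<longleftrightarrow> C \<noteq> outer"
proof -
  have "outer \<in> embedding_components G \<tau> \<and> \<not> bounded outer"
    unfolding outer_def by (rule theI'[OF emb_unbounded])
  then show o: "outer \<in> components (- drawing)" "\<not> bounded outer"
    unfolding components_eq_embedding by simp_all
  show "C \<in> components (- drawing) \<Longrightarrow> bounded C \<longleftrightarrow> C \<noteq> outer"
    using ex1E[OF emb_unbounded, of "bounded C \<longleftrightarrow> C \<noteq> outer"] o unfolding components_eq_embedding by metis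
qed

text \<open>Coordinates are labelled by closed faces, while the sphere is built from the open ones.
  An open set that meets the closure of a component meets the component itself.\<close>

lemma closure_inj: "inj_on closure (components (- drawing))"
proof (rule inj_onI)
  fix C C' assume C: "C \<in> components (- drawing)" "C' \<in> components (- drawing)" "closure C = closure C'"
  have "open C'" by (rule open_components[OF _ C(2)]) (simp add: closed_drawing open_Compl)
  moreover have "C' \<inter> closure C \<noteq> {}"
    using C(3) closure_subset[of C'] in_components_nonempty[OF C(2)] by auto
  ultimately have "C' \<inter> C \<noteq> {}" by (simp add: open_Int_closure_eq_empty)
  then show "C = C'" using components_eq[OF C(1,2)] by blast
qed

lemma closure_components_minus: "S \<subseteq> components (- drawing) \<Longrightarrow> closure ` S - {closure outer} = closure ` (S - {outer})"
  using inj_onD[OF closure_inj] outer(1) by blast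

lemma interior_faces_eq: "interior_faces G \<tau> = closure ` (components (- drawing) - {outer})"
proof -
  have "{C \<in> embedding_components G \<tau>. bounded C} = components (- drawing) - {outer}"
    unfolding components_eq_embedding[symmetric] using bounded_iff outer by blast
  then show ?thesis by (simp add: interior_faces_def)
qed

lemma vertex_faces_subset: "vertex_faces v \<subseteq> components (- drawing)"
  by (auto simp: vertex_faces_def faces_at_def)

lemma exterior_vertex_iff: "exterior_vertex G \<tau> v \<longleftrightarrow> outer \<in> vertex_faces v"
  using outer(1)
  by (simp add: exterior_vertex_def exterior_face_def incident_def outer_def[symmetric] vertex_faces_def faces_at_def pos_def)

lemma incident_faces: "{F \<in> interior_faces G \<tau>. incident \<tau> v F} = closure ` (vertex_faces v - {outer})"
  unfolding interior_faces_eq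
  by (auto simp: incident_def vertex_faces_def faces_at_def pos_def[symmetric])

text \<open>Of the three faces at an exterior vertex one is \<open>outer\<close>, which is no
  coordinate, so the two remaining coordinates are free; at an interior vertex all three are
  coordinates, bound by the vanishing of their sum.\<close>

lemma tropproj_schoen_ideal:
  fixes val :: "'k::field \<Rightarrow> ereal"
  assumes val: "field_valuation val" and v: "v \<in> verts G"
  shows "tropproj val (interior_faces G \<tau>) (schoen_ideal G \<tau> v) =
     pointed_line (closure outer) (closure ` vertex_faces v)"
proof -
  define I where "I = interior_faces G \<tau>"
  define S where "S = closure ` (vertex_faces v - {outer})"
  have fin: "finite I" unfolding I_def interior_faces_eq using finite_faces by simp
  have SI: "S \<subseteq> I" unfolding S_def I_def interior_faces_eq using vertex_faces_subset by blast
  have inc: "{F \<in> I. incident \<tau> v F} = S" unfolding I_def S_def by (rule incident_faces)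
  then have out: "{F \<in> I. \<not> incident \<tau> v F} = I - S" by blast
  have cardS: "card S = card (vertex_faces v - {outer})"
    unfolding S_def by (rule card_image) (rule inj_on_subset[OF closure_inj], use vertex_faces_subset in blast)
  have finvf: "finite (vertex_faces v)" using vertex_faces_subset finite_faces finite_subset by blast
  have sum_single: "linear_form I (\<lambda>i. if i \<in> A then 1 else 0) = (\<Sum>F\<in>A. pvar F :: (_, 'k) mpoly)" if "A \<subseteq> I" for A
  proof -
    have "linear_form I (\<lambda>i. if i \<in> A then 1 else 0) = (\<Sum>i\<in>I. if i \<in> A then pvar i else 0 :: (_, 'k) mpoly)"
      unfolding linear_form_def pvar_def by (rule sum.cong) auto
    also have "\<dots> = (\<Sum>i\<in>{i \<in> I. i \<in> A}. pvar i)" by (rule sum.inter_filter[symmetric, OF fin])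
    also have "{i \<in> I. i \<in> A} = A" using that by blast
    finally show ?thesis .
  qed
  have pv: "pvar l = (linear_form I (\<lambda>i. if i = l then 1 else 0) :: (_, 'k) mpoly)" if "l \<in> I" for l
    using sum_single[of "{l}"] that by simp
  have mem_iff: "closure outer \<in> closure ` vertex_faces v \<longleftrightarrow> outer \<in> vertex_faces v"
    using inj_on_image_mem_iff[OF closure_inj outer(1) vertex_faces_subset] .
  show ?thesis
  proof (cases "outer \<in> vertex_faces v")
    case True
    have "closure ` vertex_faces v - {closure outer} = S"
      unfolding S_def by (rule closure_components_minus[OF vertex_faces_subset])
    moreover have "tropproj val I (Idl\<^bsub>poly_ring I\<^esub> (pvar ` (I - S))) = TP S"
    proof (rule tropproj_edge[OF val fin SI])
      fix s :: "(_, 'k) mpoly" assume "s \<in> pvar ` (I - S)"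
      then obtain l where "l \<in> I" "l \<notin> S" "s = pvar l" by blast
      then show "\<exists>c. s = linear_form I c \<and> (\<forall>i\<in>S. c i = 0)"
        using pv[of l] by (intro exI[of _ "\<lambda>i. if i = l then 1 else 0"]) auto
    qed (use pv in auto)
    ultimately show ?thesis
      unfolding schoen_ideal_def Let_def I_def[symmetric] out pointed_line_def
      using True mem_iff exterior_vertex_iff by simp
  next
    case False
    then have S: "S = closure ` vertex_faces v" by (simp add: S_def)
    have "card S = 3" using cardS False vertex_faces_card[OF v] by simp
    have "tropproj val I (Idl\<^bsub>poly_ring I\<^esub> (insert (\<Sum>F\<in>S. pvar F) (pvar ` (I - S)))) = standard_line S"
    proof (rule tropproj_face[OF val fin SI \<open>card S = 3\<close>])
      fix s :: "(_, 'k) mpoly" assume "s \<in> insert (\<Sum>F\<in>S. pvar F) (pvar ` (I - S))"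
      then consider "s = (\<Sum>F\<in>S. pvar F)" | l where "l \<in> I" "l \<notin> S" "s = pvar l" by blast
      then show "\<exists>c r. s = linear_form I c \<and> (\<forall>i\<in>S. c i = r)"
      proof cases
        case 1
        then show ?thesis using sum_single[OF SI] by (intro exI[of _ "\<lambda>i. if i \<in> S then 1 else 0"] exI[of _ 1]) simp
      next
        case (2 l)
        then show ?thesis using pv[of l] by (intro exI[of _ "\<lambda>i. if i = l then 1 else 0"] exI[of _ 0]) auto
      qed
    qed (use pv sum_single[OF SI] in auto)
    then show ?thesis
      unfolding schoen_ideal_def Let_def I_def[symmetric] out inc pointed_line_def S[symmetric]
      using False mem_iff S exterior_vertex_iff by simp
  qed
qed

lemma schoen_tropicalisation_eq:
  fixes val :: "'k::field \<Rightarrow> ereal"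
  assumes val: "field_valuation val"
  shows "schoen_tropicalisation val G \<tau> =
     sphere_arrangement (closure outer) ((`) closure ` vertex_faces ` verts G)"
proof -
  have "\<Union>((`) closure ` vertex_faces ` verts G) = closure ` components (- drawing)"
    unfolding Union_vertex_faces[symmetric] by blast
  then have "\<Union>((`) closure ` vertex_faces ` verts G) - {closure outer} = interior_faces G \<tau>"
    unfolding interior_faces_eq using closure_components_minus[of "components (- drawing)"] by simp
  moreover have "(\<lambda>v. tropproj val (interior_faces G \<tau>) (schoen_ideal G \<tau> v)) ` verts G =
     pointed_line (closure outer) ` (`) closure ` vertex_faces ` verts G"
    unfolding image_image by (rule image_cong) (auto simp: tropproj_schoen_ideal[OF val])
  ultimately show ?thesis unfolding schoen_tropicalisation_def sphere_arrangement_def by simp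
qed

text \<open>Taking closures is injective on the finitely many components, so it extends to a
  relabelling of the whole type. Both directions are stated because the sequence starts at one graph
  and ends at the other.\<close>

lemma schoen_tropicalisation_sphere:
  fixes val :: "'k::field \<Rightarrow> ereal"
  assumes val: "field_valuation val"
  obtains K C where "trisphere K" "C \<in> \<Union>K"
    "relabelling (schoen_tropicalisation val G \<tau>) (sphere_arrangement C K)"
    "relabelling (sphere_arrangement C K) (schoen_tropicalisation val G \<tau>)"
proof -
  let ?K = "vertex_faces ` verts G"
  obtain \<sigma> where \<sigma>: "bij \<sigma>" "\<forall>C\<in>components (- drawing). \<sigma> C = closure C"
    using bij_extending_finite[OF finite_faces finite_imageI[OF finite_faces] inj_on_imp_bij_betw[OF closure_inj]] by blast
  have st: "\<sigma> ` t = closure ` t" if "t \<in> ?K" for t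
    using that \<sigma>(2) vertex_faces_subset by (intro image_cong) blast+
  have img: "(`) \<sigma> ` ?K = (`) closure ` ?K" by (rule image_cong[OF refl st])
  have o: "\<sigma> outer = closure outer" using \<sigma>(2) outer(1) by blast
  have eq: "schoen_tropicalisation val G \<tau> = sphere_arrangement (\<sigma> outer) ((`) \<sigma> ` ?K)"
    unfolding schoen_tropicalisation_eq[OF val] img o ..
  have inv: "inv_into UNIV \<sigma> (\<sigma> x) = x" for x using \<sigma>(1) by (simp add: bij_is_inj)
  then have inv2: "(`) (inv_into UNIV \<sigma>) ` (`) \<sigma> ` ?K = ?K" by (simp add: image_image)
  show ?thesis
  proof (rule that[of ?K outer])
    show "trisphere ?K" by (rule trisphere_vertex_faces)
    show "outer \<in> \<Union>?K" unfolding Union_vertex_faces by (rule outer(1))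
    show "relabelling (sphere_arrangement outer ?K) (schoen_tropicalisation val G \<tau>)"
      unfolding eq by (rule relabelling_sphere_arrangement[OF \<sigma>(1)])
    show "relabelling (schoen_tropicalisation val G \<tau>) (sphere_arrangement outer ?K)"
      unfolding eq using relabelling_sphere_arrangement[OF bij_imp_bij_inv[OF \<sigma>(1)], of "\<sigma> outer" "(`) \<sigma> ` ?K"]
      unfolding inv inv2 .
  qed
qed

end

theorem theorem1p6:
  fixes val :: "'k::alg_closed_field \<Rightarrow> ereal"
    and G1 :: "'a graph" and G2 :: "'b graph"
    and \<tau>1 :: "('a \<Rightarrow> real) \<Rightarrow> real^2" and \<tau>2 :: "('b \<Rightarrow> real) \<Rightarrow> real^2"
  assumes "field_valuation val"
    and "finite_simple_graph G1" and "three_regular G1" and "three_connected G1"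
    and "planar_embedding G1 \<tau>1"
    and "finite_simple_graph G2" and "three_regular G2" and "three_connected G2"
    and "planar_embedding G2 \<tau>2"
  shows "tropically_transformable val
           (schoen_tropicalisation val G1 \<tau>1) (schoen_tropicalisation val G2 \<tau>2)"
proof -
  interpret G1: embedded_graph G1 \<tau>1 by unfold_locales fact+
  interpret G2: embedded_graph G2 \<tau>2 by unfold_locales fact+
  obtain K1 C1 where 1: "trisphere K1" "C1 \<in> \<Union>K1"
    "relabelling (schoen_tropicalisation val G1 \<tau>1) (sphere_arrangement C1 K1)"
    by (rule G1.schoen_tropicalisation_sphere[OF assms(1)])
  obtain K2 C2 where 2: "trisphere K2" "C2 \<in> \<Union>K2"
    "relabelling (sphere_arrangement C2 K2) (schoen_tropicalisation val G2 \<tau>2)"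
    by (rule G2.schoen_tropicalisation_sphere[OF assms(1)])
  \<comment> \<open>The relabellings between components and their closures are put before and after
    the sequence of moves.\<close>
  from sphere_arrangements_transformable[OF assms(1) 1(1,2) 2(1,2)] 1(3) 2(3) show ?thesis
    unfolding tropically_transformable_def
    by (metis (mono_tags, lifting) converse_rtranclp_into_rtranclp rtranclp.rtrancl_into_rtrancl)
qed

end
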